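(* Let $\phi:\mathbb{R}\to\mathbb{C}$ be Riemann's non-differentiable function $$\phi(x)=\sum_{k\in\mathbb{Z}}\frac{e^{-4\pi^2 i k^2 x}-1}{-4\pi^2k^2},$$ where the term $k=0$ is understood as $ix$. For $x\in[0,1]$ write $t_x=x/(2\pi)$, and for $x=p/q$ write $t_{p,q}=t_{p/q}=p/(2\pi q)$. Let $x=p/q\in[0,1]\cap\mathbb{Q}$ be an irreducible fraction with $q>0$. (a) If $q\equiv0,1,3\pmod 4$, there exists an eighth root of unity $e_{p,q}\in\mathbb{S}^1$ such that $$\lim_{r\to0^+}\frac{\phi(t_{p,q}+r)-\phi(t_{p,q})}{|\phi(t_{p,q}+r)-\phi(t_{p,q})|}=e_{p,q}\frac{1+i}{\sqrt2},\qquad \lim_{r\to0^+}\frac{\phi(t_{p,q}-r)-\phi(t_{p,q})}{|\phi(t_{p,q}-r)-\phi(t_{p,q})|}=e_{p,q}\frac{1-i}{\sqrt2}.$$ (b) If $q\equiv2\pmod4$, then for any $\mathbb{V}\in\mathbb{S}^1$ there exist sequences $r_n,s_n\to0^+$ (as $n\to\infty$) such that $$\lim_{n\to\infty}\frac{\phi(t_{p,q}+r_n)-\phi(t_{p,q})}{|\phi(t_{p,q}+r_n)-\phi(t_{p,q})|}=\mathbb{V}=\lim_{n\to\infty}\frac{\phi(t_{p,q}-s_n)-\phi(t_{p,q})}{|\phi(t_{p,q}-s_n)-\phi(t_{p,q})|}.$$ Let $x=\rho\in[0,1]\setminus\mathbb{Q}$. (c) There exists a nonempty open set $V\subset\mathbb{S}^1$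 such that for any $\mathbb{V}\in V$ there exists a sequence $r_n\to0$ (as $n\to\infty$) such that $$\lim_{n\to\infty}\frac{\phi(t_\rho+r_n)-\phi(t_\rho)}{|\phi(t_\rho+r_n)-\phi(t_\rho)|}=\mathbb{V}.$$
   Context: $\mathbb{S}^1=\{z\in\mathbb{C}:|z|=1\}$. Whenever a quotient $\frac{\phi(t+r)-\phi(t)}{|\phi(t+r)-\phi(t)|}$ appears along a sequence or in a limit, it is part of the assertion that the denominator is nonzero along the sequence (respectively for all sufficiently small $r>0$). *)

theory Defs
  imports "HOL-Analysis.Analysis"
begin

definition riemann_term :: "real \<Rightarrow> int \<Rightarrow> complex" where
  "riemann_term x k =
     (if k = 0 then \<i> * complex_of_real x
      else (exp (- 4 * (complex_of_real pi)\<^sup>2 * \<i> * (of_int k)\<^sup>2 * complex_of_real x) - 1)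
           / (- 4 * (complex_of_real pi)\<^sup>2 * (of_int k)\<^sup>2))"

definition riemann_phi :: "real \<Rightarrow> complex" where
  "riemann_phi x = (\<Sum>\<^sub>\<infinity>k\<in>UNIV. riemann_term x k)"

definition riemann_t :: "real \<Rightarrow> real" where
  "riemann_t x = x / (2 * pi)"

text \<open>
  The direction of the increment of \<open>riemann_phi\<close> from \<open>t\<close> to \<open>t + h\<close>. It is \<open>0\<close> by convention when
  the increment vanishes, so statements about its limits also assert
  \<open>riemann_phi (t + h) \<noteq> riemann_phi t\<close> explicitly.
\<close>
definition riemann_dir :: "real \<Rightarrow> real \<Rightarrow> complex" where
  "riemann_dir t h = (riemann_phi (t + h) - riemann_phi t)
     / complex_of_real (cmod (riemann_phi (t + h) - riemann_phi t))"

lemma riemann_term_norm_le: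
  "norm (riemann_term x k) \<le> (if k = 0 then \<bar>x\<bar> else 1 / (real_of_int k)\<^sup>2)"
proof (cases "k = 0")
  case True
  then show ?thesis by (simp add: riemann_term_def norm_mult)
next
  case False
  have e: "- 4 * (complex_of_real pi)\<^sup>2 * \<i> * (of_int k)\<^sup>2 * complex_of_real x
      = \<i> * complex_of_real (- 4 * pi\<^sup>2 * (of_int k)\<^sup>2 * x)" by simp
  have n: "norm (exp (- 4 * (complex_of_real pi)\<^sup>2 * \<i> * (of_int k)\<^sup>2 * complex_of_real x)) = 1"
    unfolding e by (rule norm_exp_i_times)
  have num: "norm (exp (- 4 * (complex_of_real pi)\<^sup>2 * \<i> * (of_int k)\<^sup>2 * complex_of_real x) - 1) \<le> 2"
    using norm_triangle_ineq4[of "exp (- 4 * (complex_of_real pi)\<^sup>2 * \<i> * (of_int k)\<^sup>2 * complex_of_real x)" 1] n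
    by simp
  have den: "norm (- 4 * (complex_of_real pi)\<^sup>2 * (of_int k)\<^sup>2) = 4 * pi\<^sup>2 * (real_of_int k)\<^sup>2"
    by (simp add: norm_mult norm_power)
  have "1 * 1 \<le> pi * pi" using pi_gt3 by (intro mult_mono) auto
  then have pi1: "1 \<le> pi\<^sup>2" by (simp add: power2_eq_square)
  have k2: "0 < (real_of_int k)\<^sup>2" using False by simp
  have "norm (riemann_term x k) \<le> 2 / (4 * pi\<^sup>2 * (real_of_int k)\<^sup>2)"
    using False num unfolding riemann_term_def
    by (simp only: if_False norm_divide den) (intro divide_right_mono, auto)
  also have "\<dots> \<le> 2 / (2 * (real_of_int k)\<^sup>2)"
    using pi1 k2 by (intro divide_left_mono mult_right_mono mult_pos_pos) auto
  finally show ?thesis using False by simp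
qed

lemma riemann_term_abs_summable: "(\<lambda>k. norm (riemann_term x k)) summable_on (UNIV :: int set)"
proof -
  let ?g = "\<lambda>k::int. if k = 0 then \<bar>x\<bar> else 1 / (real_of_int k)\<^sup>2"
  have N: "(\<lambda>n::nat. 1 / (real n)\<^sup>2) summable_on UNIV"
    using inverse_power_summable[of 2, where 'a=real]
    by (intro summable_nonneg_imp_summable_on) (auto simp: field_simps)
  have s: "(\<lambda>n. 1 / (real_of_int n)\<^sup>2) summable_on (f ` (UNIV::nat set))"
    if "inj f" "\<And>n. (real_of_int (f n))\<^sup>2 = (real n)\<^sup>2" for f
    unfolding summable_on_reindex[OF that(1)] using N by (simp add: o_def that(2))
  have "(\<lambda>n. 1 / (real_of_int n)\<^sup>2) summable_on (range int \<union> range (\<lambda>n. - int n))"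
    by (intro summable_on_union s) (auto simp: inj_on_def)
  moreover have "range int \<union> range (\<lambda>n. - int n) = UNIV"
    by (metis (no_types, lifting) UNIV_eq_I UnI1 UnI2 int_cases2 rangeI)
  ultimately have "(\<lambda>n::int. 1 / (real_of_int n)\<^sup>2) summable_on UNIV" by simp
  then have "(\<lambda>n::int. 1 / (real_of_int n)\<^sup>2) summable_on (UNIV - {0})"
    by (rule summable_on_subset_banach) auto
  then have "?g summable_on (UNIV - {0})"
    by (subst summable_on_cong[where g="\<lambda>n. 1 / (real_of_int n)\<^sup>2"]) auto
  then have "?g summable_on (insert 0 (UNIV - {0}))"
    by (simp only: summable_on_insert_iff)
  moreover have "insert 0 (UNIV - {0}) = (UNIV :: int set)" by auto
  ultimately have "?g summable_on UNIV" by (simp only:)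
  then show ?thesis
    by (rule summable_on_comparison_test) (use riemann_term_norm_le in auto)
qed

end

theory Submission imports Defs "HOL-Complex_Analysis.Complex_Analysis" "HOL-Real_Asymp.Real_Asymp" begin

text \<open>Up to a linear change of variables \<open>riemann_phi\<close> is the boundary value of a primitive \<open>jint\<close> of the
  theta function \<open>\<theta> \<tau> = (\<Sum>k. exp (\<i> * pi * k\<^sup>2 * \<tau>))\<close>. Integrating the modularity of
  \<open>\<theta>\<close> under the theta group and letting the path tend to the real axis relates the increments of
  \<open>jint\<close> at \<open>\<gamma> x\<close> to those at \<open>x\<close>, with an eighth root of unity as multiplier.

  The theta group has the two cusps \<open>0\<close> and \<open>1\<close>. At \<open>0\<close> the increment is of size \<open>sqrt h\<close> with
  perpendicular one-sided tangents; at \<open>1\<close> it is \<open>h powr (3/2)\<close> times a periodic function of \<open>1 / h\<close> that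
  winds around the origin. Transport to the other rationals gives (a) and (b).

  At an irrational point the even continued fraction produces elements of the group that blow up ever
  smaller neighbourhoods to a fixed size; by compactness the rescaled curves converge along a subsequence.
  The limit curve has corners, and around a corner it sweeps out an arc of directions, which gives (c).\<close>

section \<open>Theta inversion on the positive reals\<close>

text \<open>The theta function has no boundary values on the real axis, so its modularity cannot be
  integrated along real segments directly. One integration by parts moves the derivative from
  \<open>jint\<close> onto the automorphy factor; what remains involves only \<open>jint\<close>,
  which is continuous up to the real axis, and the height of the path can go to 0.

  Modularity rests on period 2 and inversion. Inversion comes from a finite identity for binomial
  coefficients, the Poisson formula on a cyclic group, whose two sides tend to theta series.

  At x = p/q the argument of \<open>jint\<close> is - 2 * x. In lowest terms it has an even entry
  exactly when q mod 4 is 0, 1 or 3 (orbit of 0), and two odd entries when q mod 4 = 2 (orbit of 1);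
  hence the case split. The factor - 4 * pi in the change of variable reverses orientation, so right
  increments of \<open>riemann_phi\<close> are left increments of \<open>jint\<close>.

  At an irrational point no expansion is available. Only the existence of one limit curve is used;
  its corners are dense because the orbit of 0 is dense.\<close>

lemma sum_cos_roots_unity:
  fixes l :: nat and r :: int
  assumes "l > 0"
  shows "(\<Sum>j<l. cos (2 * pi * real j * real_of_int r / real l)) = (if int l dvd r then real l else 0)"
proof -
  define w where "w = cis (2 * pi * real_of_int r / real l)"
  have pw: "w ^ j = cis (2 * pi * real j * real_of_int r / real l)" for j
    unfolding w_def Complex.DeMoivre by (simp add: field_simps)
  have "(\<Sum>j<l. cos (2 * pi * real j * real_of_int r / real l)) = Re (\<Sum>j<l. w ^ j)"
    by (simp add: pw)
  also have "\<dots> = (if int l dvd r then real l else 0)"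
  proof (cases "int l dvd r")
    case True
    then obtain k where k: "r = int l * k" by blast
    have "w = cis (2 * pi * real_of_int k)"
      unfolding w_def k using assms by (simp add: mult.assoc)
    also have "\<dots> = 1" by (rule cis_multiple_2pi) (rule Ints_of_int)
    finally show ?thesis using True by simp
  next
    case False
    have "w \<noteq> 1"
    proof
      assume "w = 1"
      then have "cos (2 * pi * real_of_int r / real l) = 1"
        by (metis w_def cis.sel(1) one_complex.sel(1))
      then obtain k :: int where "2 * pi * real_of_int r / real l = real_of_int k * 2 * pi"
        unfolding cos_one_2pi_int by blast
      then have "real_of_int r = real_of_int (k * int l)" using assms by (simp add: field_simps)
      then have "r = k * int l" by linarith
      with False show False by simp
    qed
    moreover have "w ^ l = cis (2 * pi * real_of_int r)"
      unfolding pw using assms by (simp add: mult.assoc)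
    then have "w ^ l = 1" using cis_multiple_2pi[OF Ints_of_int] by metis
    ultimately show ?thesis using False by (simp add: sum_gp_strict)
  qed
  finally show ?thesis .
qed

text \<open>De Moivre applied to the binomial expansion of cis x + cis (- x). Frequencies are
  indexed by the offset \<open>int m - int s\<close> from the centre, the form in which
  orthogonality of characters is applied.\<close>

lemma two_cos_power:
  "(2 * cos x) ^ (2 * m) = (\<Sum>s\<le>2*m. real (2 * m choose s) * cos (2 * real_of_int (int m - int s) * x))"
proof -
  have "complex_of_real (2 * cos x) = cis x + cis (-x)"
    by (simp add: complex_eq_iff)
  then have "complex_of_real ((2 * cos x) ^ (2 * m)) = (cis (-x) + cis x) ^ (2 * m)"
    by (simp only: of_real_power add.commute)
  also have "\<dots> = (\<Sum>s\<le>2*m. of_nat (2 * m choose s) * cis (-x) ^ s * cis x ^ (2 * m - s))"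
    by (rule binomial_ring)
  also have "\<dots> = (\<Sum>s\<le>2*m. of_nat (2 * m choose s) * cis (2 * real_of_int (int m - int s) * x))"
  proof (rule sum.cong)
    fix s assume "s \<in> {..2*m}"
    then have "cis (-x) ^ s * cis x ^ (2 * m - s) = cis (2 * real_of_int (int m - int s) * x)"
      unfolding Complex.DeMoivre cis_mult by (simp add: of_nat_diff algebra_simps)
    then show "of_nat (2 * m choose s) * cis (-x) ^ s * cis x ^ (2 * m - s)
        = of_nat (2 * m choose s) * cis (2 * real_of_int (int m - int s) * x)"
      by (simp only: mult.assoc)
  qed simp
  finally have "Re (complex_of_real ((2 * cos x) ^ (2 * m)))
     = Re (\<Sum>s\<le>2*m. of_nat (2 * m choose s) * cis (2 * real_of_int (int m - int s) * x))"
    by simp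
  then show ?thesis by simp
qed

lemma sum_centred:
  fixes f :: "nat \<Rightarrow> real"
  shows "(\<Sum>s\<le>2*m. f s) = f m + (\<Sum>i=1..m. f (m - i) + f (m + i))"
proof -
  have "{..2*m} = insert m ({..<m} \<union> {m<..2*m})" by auto
  then have "(\<Sum>s\<le>2*m. f s) = f m + ((\<Sum>s<m. f s) + (\<Sum>s\<in>{m<..2*m}. f s))"
    by (simp only:) (subst sum.insert, auto intro!: sum.union_disjoint)
  moreover have "(\<Sum>s<m. f s) = (\<Sum>i=1..m. f (m - i))"
    by (rule sum.reindex_bij_witness[of _ "\<lambda>i. m - i" "\<lambda>s. m - s"]) auto
  moreover have "(\<Sum>s\<in>{m<..2*m}. f s) = (\<Sum>i=1..m. f (m + i))"
    by (rule sum.reindex_bij_witness[of _ "\<lambda>i. m + i" "\<lambda>s. s - m"]) auto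
  ultimately show ?thesis by (simp add: sum.distrib)
qed

lemma sum_multiples:
  fixes f :: "nat \<Rightarrow> real"
  assumes "l > 0" and "\<And>i. i > m \<Longrightarrow> f i = 0"
  shows "(\<Sum>i=1..m. if l dvd i then f i else 0) = (\<Sum>k. f (Suc k * l))"
proof -
  have "(\<Sum>i=1..m. if l dvd i then f i else 0) = (\<Sum>i\<in>{i\<in>{1..m}. l dvd i}. f i)"
    by (subst sum.inter_filter) auto
  also have "\<dots> = (\<Sum>k\<in>{k. Suc k * l \<le> m}. f (Suc k * l))"
  proof (rule sum.reindex_bij_witness[of _ "\<lambda>k. Suc k * l" "\<lambda>i. i div l - 1"])
    fix i assume i: "i \<in> {i\<in>{1..m}. l dvd i}"
    then obtain k where k: "i = l * k" by blast
    with i have "k \<noteq> 0" by (intro notI) auto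
    then show "Suc (i div l - 1) * l = i" using k assms(1) by simp
    with i show "i div l - 1 \<in> {k. Suc k * l \<le> m}" by simp
    show "f (Suc (i div l - 1) * l) = f i" using \<open>Suc (i div l - 1) * l = i\<close> by simp
  next
    fix k assume "k \<in> {k. Suc k * l \<le> m}"
    then show "Suc k * l div l - 1 = k" "Suc k * l \<in> {i \<in> {1..m}. l dvd i}"
      using assms(1) by (auto simp: Suc_le_eq)
  qed
  also have "\<dots> = (\<Sum>k. f (Suc k * l))"
  proof (rule suminf_finite[symmetric])
    have "{k. Suc k * l \<le> m} \<subseteq> {..m}"
    proof
      fix k assume "k \<in> {k. Suc k * l \<le> m}"
      then have "Suc k * l \<le> m" by simp
      moreover have "Suc k * 1 \<le> Suc k * l" using assms(1) by (intro mult_le_mono2) simp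
      ultimately show "k \<in> {..m}" by simp
    qed
    then show "finite {k. Suc k * l \<le> m}" by (rule finite_subset) simp
    show "f (Suc k * l) = 0" if "k \<notin> {k. Suc k * l \<le> m}" for k
      by (rule assms(2)) (use that in simp)
  qed
  finally show ?thesis .
qed

text \<open>A discrete Gaussian, about exp (- s^2 / m) for s of order sqrt m. Dividing by the
  central coefficient keeps the constant of Stirling's formula out of it; the value is 0 for s >
  m.\<close>

definition central_ratio :: "nat \<Rightarrow> nat \<Rightarrow> real" where
  "central_ratio m s = real (2 * m choose (m + s)) / real (2 * m choose m)"

text \<open>Averaging \<open>(2 * cos (pi * j / l)) ^ (2 * m)\<close> over all residues j modulo
  \<open>l\<close> keeps exactly the binomial coefficients whose offset from the centre is a
  multiple of \<open>l\<close>: Poisson summation on the cyclic group of order \<open>l\<close>. An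
  odd \<open>l\<close> leaves no self-paired residue besides 0.\<close>

lemma polya_identity:
  assumes l: "l = 2 * L + 1"
  shows "1 + 2 * (\<Sum>j<L. cos (pi * real (Suc j) / real l) ^ (2 * m))
       = real l * (real (2 * m choose m) / 4 ^ m) * (1 + 2 * (\<Sum>k. central_ratio m (Suc k * l)))"
proof -
  have l0: "l > 0" using l by simp
  define g where "g j = cos (pi * real j / real l) ^ (2 * m)" for j
  define f where "f s = (if int l dvd int m - int s then real (2 * m choose s) else 0)" for s
  have sym: "g (l - j) = g j" if "j \<le> l" for j
  proof -
    have "pi * real (l - j) / real l = pi - pi * real j / real l"
      using that l0 by (simp add: of_nat_diff field_simps)
    then show ?thesis by (simp add: g_def power_mult)
  qed
  \<comment> \<open>Residue 0, then the residues 1 to \<open>L\<close>, then their mirror images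
    \<open>l - 1\<close> down to \<open>l - L\<close>; \<open>g\<close> agrees on mirror
    images.\<close>
  have "{..<l} = insert 0 ((Suc ` {..<L}) \<union> ((\<lambda>j. l - Suc j) ` {..<L}))"
  proof (intro set_eqI iffI)
    fix j assume j: "j \<in> {..<l}"
    consider "j = 0" | "0 < j" "j \<le> L" | "L < j" by linarith
    then show "j \<in> insert 0 ((Suc ` {..<L}) \<union> ((\<lambda>j. l - Suc j) ` {..<L}))"
    proof cases
      case 2
      then have "j = Suc (j - 1)" "j - 1 \<in> {..<L}" by auto
      then show ?thesis by blast
    next
      case 3
      then have "j = l - Suc (l - j - 1)" "l - j - 1 \<in> {..<L}" using j l by auto
      then show ?thesis by blast
    qed simp
  qed (use l in auto)
  then have "(\<Sum>j<l. g j) = sum g (insert 0 ((Suc ` {..<L}) \<union> ((\<lambda>j. l - Suc j) ` {..<L})))"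
    by (rule arg_cong)
  also have "\<dots> = g 0 + sum g ((Suc ` {..<L}) \<union> ((\<lambda>j. l - Suc j) ` {..<L}))"
    by (rule sum.insert) (use l in auto)
  also have "sum g ((Suc ` {..<L}) \<union> ((\<lambda>j. l - Suc j) ` {..<L}))
      = (\<Sum>j\<in>Suc ` {..<L}. g j) + (\<Sum>j\<in>(\<lambda>j. l - Suc j) ` {..<L}. g j)"
    by (rule sum.union_disjoint) (use l in auto)
  also have "(\<Sum>j\<in>Suc ` {..<L}. g j) = (\<Sum>j<L. g (Suc j))"
    by (subst sum.reindex) auto
  also have "(\<Sum>j\<in>(\<lambda>j. l - Suc j) ` {..<L}. g j) = (\<Sum>j<L. g (l - Suc j))"
    by (subst sum.reindex) (use l in \<open>auto simp: inj_on_def\<close>)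
  also have "\<dots> = (\<Sum>j<L. g (Suc j))"
    by (intro sum.cong refl sym) (use l in auto)
  finally have g_sum: "(\<Sum>j<l. g j) = 1 + 2 * (\<Sum>j<L. g (Suc j))"
    by (simp add: g_def)
  have "4 ^ m * (\<Sum>j<l. g j) = (\<Sum>j<l. (2 * cos (pi * real j / real l)) ^ (2 * m))"
    by (simp add: g_def sum_distrib_left power_mult_distrib power_mult)
  also have "\<dots> = (\<Sum>j<l. \<Sum>s\<le>2*m. real (2 * m choose s)
                   * cos (2 * real_of_int (int m - int s) * (pi * real j / real l)))"
    by (simp only: two_cos_power)
  also have "\<dots> = (\<Sum>s\<le>2*m. real (2 * m choose s)
                   * (\<Sum>j<l. cos (2 * pi * real j * real_of_int (int m - int s) / real l)))"
    by (subst sum.swap) (simp add: sum_distrib_left mult_ac)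
  also have "\<dots> = real l * (\<Sum>s\<le>2*m. f s)"
    unfolding sum_cos_roots_unity[OF l0] f_def by (auto simp: sum_distrib_left intro!: sum.cong)
  also have "(\<Sum>s\<le>2*m. f s) = f m + (\<Sum>i=1..m. f (m - i) + f (m + i))"
    by (rule sum_centred)
  also have "(\<Sum>i=1..m. f (m - i) + f (m + i))
      = (\<Sum>i=1..m. if l dvd i then 2 * real (2 * m choose (m + i)) else 0)"
  proof (rule sum.cong)
    fix i assume i: "i \<in> {1..m}"
    have "2 * m choose (m - i) = 2 * m choose (m + i)"
      using i by (subst binomial_symmetric) (auto simp: algebra_simps intro!: arg_cong2[where f="(choose)"])
    then show "f (m - i) + f (m + i) = (if l dvd i then 2 * real (2 * m choose (m + i)) else 0)"
      using i by (auto simp: f_def)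
  qed simp
  also have "\<dots> = (\<Sum>k. 2 * real (2 * m choose (m + Suc k * l)))"
    by (rule sum_multiples[OF l0]) simp
  also have "\<dots> = (\<Sum>k. 2 * real (2 * m choose m) * central_ratio m (Suc k * l))"
    by (simp add: central_ratio_def)
  also have "\<dots> = 2 * real (2 * m choose m) * (\<Sum>k. central_ratio m (Suc k * l))"
  proof (rule suminf_mult)
    have "finite {k. Suc k * l \<le> m}"
    proof (rule finite_subset[of _ "{..m}"])
      show "{k. Suc k * l \<le> m} \<subseteq> {..m}"
      proof
        fix k assume "k \<in> {k. Suc k * l \<le> m}"
        moreover have "Suc k * 1 \<le> Suc k * l" using l0 by (intro mult_le_mono2) simp
        ultimately show "k \<in> {..m}" by simp
      qed
    qed simp
    then show "summable (\<lambda>k. central_ratio m (Suc k * l))"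
      by (rule summable_finite) (simp add: central_ratio_def)
  qed
  also have "f m = real (2 * m choose m)" by (simp add: f_def)
  finally show ?thesis unfolding g_sum by (simp add: g_def field_simps)
qed

section \<open>Gaussian bounds for binomial ratios and for the cosine\<close>

lemma central_ratio_Suc:
  assumes "s < m"
  shows "central_ratio m (Suc s) = central_ratio m s * (real (m - s) / real (m + s + 1))"
proof -
  define N where "N = real (2 * m choose m)"
  define A where "A = real (2 * m choose Suc (m + s))"
  define B where "B = real (2 * m choose (m + s))"
  have "Suc (m + s) * (2 * m choose Suc (m + s)) = (2 * m - (m + s)) * (2 * m choose (m + s))"
    by (metis binomial_absorb_comp binomial_absorption)
  moreover have "2 * m - (m + s) = m - s" by simp
  ultimately have "real (Suc (m + s)) * A = real (m - s) * B"
    unfolding A_def B_def of_nat_mult[symmetric] by (simp only:)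
  then have "A = B * (real (m - s) / real (m + s + 1))" by (simp add: field_simps)
  then show ?thesis by (simp add: central_ratio_def A_def B_def)
qed

text \<open>Each step factor is 1 - (2s+1)/(m+s+1), at most exp of minus that fraction; replacing
  the denominators by the common \<open>m + S\<close> lets the odd numbers add up to a
  square.\<close>

lemma central_ratio_le:
  assumes "s \<le> S" "S \<le> m" "m > 0"
  shows "central_ratio m s \<le> exp (- (real s)\<^sup>2 / real (m + S))"
  using assms(1)
proof (induction s)
  case 0
  then show ?case by (simp add: central_ratio_def)
next
  case (Suc s)
  have sm: "s < m" using Suc assms by simp
  have "real (m - s) / real (m + s + 1) = 1 + - ((2 * real s + 1) / real (m + s + 1))"
    using sm by (simp add: of_nat_diff field_simps)
  also have "\<dots> \<le> exp (- ((2 * real s + 1) / real (m + s + 1)))" by (rule exp_ge_add_one_self)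
  also have "\<dots> \<le> exp (- ((2 * real s + 1) / real (m + S)))"
    using Suc.prems by (auto intro!: divide_left_mono)
  finally have "central_ratio m (Suc s) \<le> exp (- (real s)\<^sup>2 / real (m + S)) * exp (- ((2 * real s + 1) / real (m + S)))"
    unfolding central_ratio_Suc[OF sm] using Suc by (intro mult_mono) auto
  also have "\<dots> = exp (- (real (Suc s))\<^sup>2 / real (m + S))"
    by (simp add: exp_add[symmetric] power2_eq_square add_divide_distrib[symmetric] diff_divide_distrib[symmetric] algebra_simps)
  finally show ?case .
qed

text \<open>The same telescoping for the reciprocal step factor 1 + (2s+1)/(m-s), now with the
  denominators bounded below by \<open>m - S\<close>.\<close>

lemma central_ratio_ge:
  assumes "s \<le> S" "S < m"
  shows "central_ratio m s \<ge> exp (- (real s)\<^sup>2 / real (m - S))"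
  using assms(1)
proof (induction s)
  case 0
  then show ?case by (simp add: central_ratio_def)
next
  case (Suc s)
  have sm: "s < m" using Suc assms by simp
  have "real (m + s + 1) / real (m - s) = 1 + (2 * real s + 1) / real (m - s)"
    using sm by (simp add: of_nat_diff field_simps)
  also have "\<dots> \<le> exp ((2 * real s + 1) / real (m - s))" by (rule exp_ge_add_one_self)
  also have "\<dots> \<le> exp ((2 * real s + 1) / real (m - S))"
    using Suc.prems assms(2) by (auto intro!: divide_left_mono)
  finally have "inverse (exp ((2 * real s + 1) / real (m - S))) \<le> inverse (real (m + s + 1) / real (m - s))"
    using sm by (intro le_imp_inverse_le) auto
  then have "exp (- ((2 * real s + 1) / real (m - S))) \<le> real (m - s) / real (m + s + 1)"
    by (simp add: exp_minus)
  then have "central_ratio m (Suc s) \<ge> exp (- (real s)\<^sup>2 / real (m - S)) * exp (- ((2 * real s + 1) / real (m - S)))"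
    unfolding central_ratio_Suc[OF sm] using Suc by (intro mult_mono) (auto simp: central_ratio_def)
  also have "exp (- (real s)\<^sup>2 / real (m - S)) * exp (- ((2 * real s + 1) / real (m - S)))
     = exp (- (real (Suc s))\<^sup>2 / real (m - S))"
    by (simp add: exp_add[symmetric] power2_eq_square add_divide_distrib[symmetric] diff_divide_distrib[symmetric] algebra_simps)
  finally show ?case .
qed

text \<open>The product exp (x^2 / 2) * cos x decreases, its derivative being exp (x^2 / 2) * (x *
  cos x - sin x). This yields a summable majorant for high powers of cosines.\<close>

lemma cos_le_exp_neg_square:
  fixes x :: real
  assumes "0 \<le> x" "x \<le> pi / 2"
  shows "cos x \<le> exp (- x\<^sup>2 / 2)"
proof -
  have tan: "y * cos y \<le> sin y" if "0 \<le> y" "y \<le> pi / 2" for y :: real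
  proof -
    have "sin 0 - 0 * cos 0 \<le> sin y - y * cos y"
    proof (rule DERIV_nonneg_imp_nondecreasing[OF that(1)])
      fix z assume z: "0 \<le> z" "z \<le> y"
      have "((\<lambda>y. sin y - y * cos y) has_real_derivative z * sin z) (at z)"
        by (auto intro!: derivative_eq_intros simp: algebra_simps)
      moreover have "0 \<le> z * sin z"
        using z that pi_gt_zero by (intro mult_nonneg_nonneg sin_ge_zero) linarith+
      ultimately show "\<exists>d. ((\<lambda>y. sin y - y * cos y) has_real_derivative d) (at z) \<and> 0 \<le> d"
        by blast
    qed
    then show ?thesis by simp
  qed
  have "exp (x\<^sup>2 / 2) * cos x \<le> exp (0\<^sup>2 / 2) * cos 0"
  proof (rule DERIV_nonpos_imp_nonincreasing[OF assms(1)])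
    fix z assume z: "0 \<le> z" "z \<le> x"
    have "((\<lambda>x. exp (x\<^sup>2 / 2) * cos x) has_real_derivative exp (z\<^sup>2 / 2) * (z * cos z - sin z)) (at z)"
      by (auto intro!: derivative_eq_intros simp: algebra_simps)
    moreover have "exp (z\<^sup>2 / 2) * (z * cos z - sin z) \<le> 0"
      using tan[of z] z assms by (intro mult_nonneg_nonpos) auto
    ultimately show "\<exists>d. ((\<lambda>x. exp (x\<^sup>2 / 2) * cos x) has_real_derivative d) (at z) \<and> d \<le> 0"
      by blast
  qed
  then have "cos x \<le> inverse (exp (x\<^sup>2 / 2))" by (simp add: field_simps)
  then show ?thesis by (simp add: exp_minus)
qed

section \<open>Limit of the finite identity as its width grows like the square root of m\<close>

definition real_theta :: "real \<Rightarrow> real" where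
  "real_theta t = 1 + 2 * (\<Sum>n. exp (- pi * (real (Suc n))\<^sup>2 * t))"

lemma summable_exp_neg_Suc:
  assumes "a > 0"
  shows "summable (\<lambda>n. exp (- a * real (Suc n)))"
proof -
  have "summable (\<lambda>n. exp (-a) ^ Suc n)"
    using assms by (intro summable_mult summable_geometric | subst power_Suc)+ auto
  moreover have "exp (-a) ^ Suc n = exp (- a * real (Suc n))" for n
    by (simp only: exp_of_nat_mult[symmetric] mult.commute)
  ultimately show ?thesis by (simp only:)
qed

text \<open>Trades the square in the exponent for a linear term, so that a geometric series
  majorises the theta series and its discrete versions.\<close>

lemma exp_neg_Suc_square_le:
  assumes "a \<ge> 0" "a \<le> b"
  shows "exp (- b * (real (Suc n))\<^sup>2) \<le> exp (- a * real (Suc n))"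
proof -
  have "a * real (Suc n) \<le> b * real (Suc n)" using assms by (intro mult_right_mono) auto
  also have "\<dots> * 1 \<le> b * real (Suc n) * real (Suc n)"
    using assms by (intro mult_left_mono) auto
  finally show ?thesis by (simp add: power2_eq_square algebra_simps)
qed

lemma real_theta_ge_1:
  assumes "t > 0"
  shows "real_theta t \<ge> 1"
proof -
  have "summable (\<lambda>n. exp (- pi * (real (Suc n))\<^sup>2 * t))"
  proof (rule summable_comparison_test'[OF summable_exp_neg_Suc[of "pi * t"]])
    show "norm (exp (- pi * (real (Suc n))\<^sup>2 * t)) \<le> exp (- (pi * t) * real (Suc n))" for n
      using exp_neg_Suc_square_le[of "pi * t" "pi * t" n] assms by (simp add: mult_ac)
  qed (use assms in simp)
  then have "0 \<le> (\<Sum>n. exp (- pi * (real (Suc n))\<^sup>2 * t))"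
    by (rule suminf_nonneg) simp
  then show ?thesis by (simp add: real_theta_def)
qed

text \<open>With this width (l m)^2 / m tends to pi * t. Hence
  \<open>central_ratio m (k * l m)\<close> tends to exp (- pi * k^2 * t) and
  \<open>cos (pi * j / l m) ^ (2 * m)\<close> to exp (- pi * j^2 / t): the two sides of
  \<open>polya_identity\<close> become theta at t and at 1 / t.\<close>

context
  fixes t :: real and L l :: "nat \<Rightarrow> nat"
  assumes t: "t > 0"
    and l: "\<And>m. l m = 2 * L m + 1"
    and lim: "(\<lambda>m. real (l m) / sqrt (real m)) \<longlonglongrightarrow> sqrt (pi * t)"
begin

lemma width_square_tendsto: "(\<lambda>m. (real (l m))\<^sup>2 / real m) \<longlonglongrightarrow> pi * t"
proof -
  have "(\<lambda>m. (real (l m) / sqrt (real m))\<^sup>2) \<longlonglongrightarrow> (sqrt (pi * t))\<^sup>2"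
    by (intro tendsto_intros lim)
  then show ?thesis using t by (simp add: power_divide)
qed

lemma width_over_tendsto: "(\<lambda>m. real (l m) / real m) \<longlonglongrightarrow> 0"
proof -
  have "(\<lambda>m. real (l m) / sqrt (real m) * inverse (sqrt (real m))) \<longlonglongrightarrow> sqrt (pi * t) * 0"
    by (intro tendsto_mult lim) real_asymp
  moreover have "real (l m) / sqrt (real m) * inverse (sqrt (real m)) = real (l m) / real m" for m
    by (simp add: divide_inverse mult.assoc flip: real_sqrt_mult inverse_mult_distrib)
  ultimately show ?thesis by simp
qed

lemma width_at_top: "filterlim (\<lambda>m. real (l m)) at_top sequentially"
proof -
  have "filterlim (\<lambda>m. real (l m) / sqrt (real m) * sqrt (real m)) at_top sequentially"
    by (rule filterlim_tendsto_pos_mult_at_top[OF lim]) (use t in simp, real_asymp)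
  moreover have ev: "\<forall>\<^sub>F m in sequentially. real (l m) / sqrt (real m) * sqrt (real m) = real (l m)"
    using eventually_gt_at_top[of 0] by eventually_elim simp
  ultimately show ?thesis using filterlim_cong[OF refl refl ev, of at_top] by blast
qed

text \<open>Dominated convergence for series (Tannery). Eventually (l m)^2 / m exceeds half of its
  limit, which fixes the rate \<open>pi * t / 4\<close> of a geometric majorant valid for all
  k.\<close>

lemma central_ratio_sum_tendsto:
  "(\<lambda>m. 1 + 2 * (\<Sum>k. central_ratio m (Suc k * l m))) \<longlonglongrightarrow> real_theta t"
proof -
  have ev: "\<forall>\<^sub>F m in sequentially. pi * t / 2 < (real (l m))\<^sup>2 / real m \<and> m > 0"
    using order_tendstoD(1)[OF width_square_tendsto, of "pi * t / 2"] t
    by (auto intro: eventually_conj eventually_gt_at_top)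
  have bound: "norm (central_ratio m (Suc k * l m)) \<le> exp (- (pi * t / 4) * real (Suc k))"
    if m: "pi * t / 2 < (real (l m))\<^sup>2 / real m \<and> m > 0" for m k
  proof (cases "Suc k * l m \<le> m")
    case True
    \<comment> \<open>The upper bound with \<open>S = m\<close>: it loses a factor 2 in the exponent
      but is uniform in k.\<close>
    have "central_ratio m (Suc k * l m) \<le> exp (- (real (Suc k * l m))\<^sup>2 / real (m + m))"
      using True m by (intro central_ratio_le) auto
    also have "\<dots> = exp (- ((real (l m))\<^sup>2 / real m / 2) * (real (Suc k))\<^sup>2)"
      by (simp only: of_nat_mult power_mult_distrib) (simp add: field_simps)
    also have "\<dots> \<le> exp (- (pi * t / 4) * real (Suc k))"
    proof (rule exp_neg_Suc_square_le)
      show "pi * t / 4 \<le> (real (l m))\<^sup>2 / real m / 2"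
        using divide_right_mono[OF less_imp_le[OF conjunct1[OF m]], of 2] by simp
    qed (use t in simp)
    finally show ?thesis by (simp add: central_ratio_def)
  next
    case False
    then have "2 * m choose (m + Suc k * l m) = 0" by (intro binomial_eq_0) simp
    then have "central_ratio m (Suc k * l m) = 0" unfolding central_ratio_def by (simp only: of_nat_0 div_0)
    then show ?thesis by simp
  qed
  have "(\<lambda>m. \<Sum>k. central_ratio m (Suc k * l m)) \<longlonglongrightarrow> (\<Sum>k. exp (- pi * (real (Suc k))\<^sup>2 * t))"
  proof (rule tannerys_theorem[THEN conjunct2, THEN conjunct2])
    fix k
    define s where "s m = Suc k * l m" for m
    have sm: "(\<lambda>m. real (s m) / real m) \<longlonglongrightarrow> real (Suc k) * 0"
      unfolding s_def of_nat_mult times_divide_eq_right[symmetric]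
      by (intro tendsto_intros width_over_tendsto)
    have s2: "(\<lambda>m. (real (s m))\<^sup>2 / real m) \<longlonglongrightarrow> (real (Suc k))\<^sup>2 * (pi * t)"
      unfolding s_def of_nat_mult power_mult_distrib times_divide_eq_right[symmetric]
      by (intro tendsto_intros width_square_tendsto)
    have ev: "\<forall>\<^sub>F m in sequentially. s m < m"
    proof -
      have "\<forall>\<^sub>F m in sequentially. real (s m) / real m < 1 \<and> m > 0"
        using order_tendstoD(2)[OF sm, of 1] by (auto intro: eventually_conj eventually_gt_at_top)
      then show ?thesis by eventually_elim (auto simp: divide_less_eq)
    qed
    have "(\<lambda>m. exp (- ((real (s m))\<^sup>2 / real m / (1 + real (s m) / real m)))) \<longlonglongrightarrow>
          exp (- ((real (Suc k))\<^sup>2 * (pi * t) / (1 + real (Suc k) * 0)))"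
      by (intro tendsto_intros s2 sm) simp
    moreover have "\<forall>\<^sub>F m in sequentially. exp (- ((real (s m))\<^sup>2 / real m / (1 + real (s m) / real m)))
        = exp (- (real (s m))\<^sup>2 / real (m + s m))"
      using eventually_gt_at_top[of 0] by eventually_elim (simp add: field_simps)
    ultimately have up: "(\<lambda>m. exp (- (real (s m))\<^sup>2 / real (m + s m))) \<longlonglongrightarrow> exp (- ((real (Suc k))\<^sup>2 * (pi * t)))"
      by (auto elim: Lim_transform_eventually)
    have "(\<lambda>m. exp (- ((real (s m))\<^sup>2 / real m / (1 - real (s m) / real m)))) \<longlonglongrightarrow>
          exp (- ((real (Suc k))\<^sup>2 * (pi * t) / (1 - real (Suc k) * 0)))"
      by (intro tendsto_intros s2 sm) simp
    moreover have "\<forall>\<^sub>F m in sequentially. exp (- ((real (s m))\<^sup>2 / real m / (1 - real (s m) / real m)))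
        = exp (- (real (s m))\<^sup>2 / real (m - s m))"
      using ev by eventually_elim (simp add: of_nat_diff field_simps)
    ultimately have low: "(\<lambda>m. exp (- (real (s m))\<^sup>2 / real (m - s m))) \<longlonglongrightarrow> exp (- ((real (Suc k))\<^sup>2 * (pi * t)))"
      by (auto elim: Lim_transform_eventually)
    \<comment> \<open>Here \<open>S\<close> is the offset itself, so both denominators
      \<open>m + S\<close> and \<open>m - S\<close> are asymptotic to m.\<close>
    have "(\<lambda>m. central_ratio m (s m)) \<longlonglongrightarrow> exp (- ((real (Suc k))\<^sup>2 * (pi * t)))"
    proof (rule tendsto_sandwich[OF _ _ low up])
      show "\<forall>\<^sub>F m in sequentially. exp (- (real (s m))\<^sup>2 / real (m - s m)) \<le> central_ratio m (s m)"
        using ev by eventually_elim (rule central_ratio_ge, auto)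
      show "\<forall>\<^sub>F m in sequentially. central_ratio m (s m) \<le> exp (- (real (s m))\<^sup>2 / real (m + s m))"
        using ev by eventually_elim (rule central_ratio_le, auto)
    qed
    then show "(\<lambda>m. central_ratio m (Suc k * l m)) \<longlonglongrightarrow> exp (- pi * (real (Suc k))\<^sup>2 * t)"
      by (simp add: s_def mult_ac)
  next
    show "\<forall>\<^sub>F (k, m) in at_top \<times>\<^sub>F sequentially.
        norm (central_ratio m (Suc k * l m)) \<le> exp (- (pi * t / 4) * real (Suc k))"
      unfolding eventually_prod_filter
      by (rule exI[of _ "\<lambda>_. True"], rule exI[of _ "\<lambda>m. pi * t / 2 < (real (l m))\<^sup>2 / real m \<and> m > 0"])
         (use ev bound in auto)
    show "summable (\<lambda>k. exp (- (pi * t / 4) * real (Suc k)))"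
      by (rule summable_exp_neg_Suc) (use t in simp)
  qed simp
  then show ?thesis unfolding real_theta_def by (intro tendsto_intros)
qed

text \<open>Tannery again, with the terms extended by 0 beyond \<open>L m\<close>. The majorant
  comes from \<open>cos_le_exp_neg_square\<close>, applicable since j < \<open>L m\<close> keeps the
  angle within pi / 2; the termwise limit rests on ln (cos x) / x^2 tending to - 1/2.\<close>

lemma cos_sum_tendsto:
  "(\<lambda>m. 1 + 2 * (\<Sum>j<L m. cos (pi * real (Suc j) / real (l m)) ^ (2 * m))) \<longlonglongrightarrow> real_theta (1 / t)"
proof -
  define b where "b j m = (if j < L m then cos (pi * real (Suc j) / real (l m)) ^ (2 * m) else 0)" for j m
  have sum_b: "(\<Sum>j<L m. cos (pi * real (Suc j) / real (l m)) ^ (2 * m)) = (\<Sum>j. b j m)" for m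
    by (subst suminf_finite[of "{..<L m}"]) (auto simp: b_def)
  have inv: "(\<lambda>m. inverse ((real (l m))\<^sup>2 / real m)) \<longlonglongrightarrow> inverse (pi * t)"
    by (intro tendsto_intros width_square_tendsto) (use t in simp)
  have ev: "\<forall>\<^sub>F m in sequentially. inverse (pi * t) / 2 < inverse ((real (l m))\<^sup>2 / real m)"
    using order_tendstoD(1)[OF inv, of "inverse (pi * t) / 2"] t by auto
  have bound: "norm (b j m) \<le> exp (- (pi / (2 * t)) * real (Suc j))"
    if m: "inverse (pi * t) / 2 < inverse ((real (l m))\<^sup>2 / real m)" for j m
  proof (cases "j < L m")
    case True
    define x where "x = pi * real (Suc j) / real (l m)"
    have "pi * (2 * real (Suc j)) \<le> pi * real (l m)"
      using True by (intro mult_left_mono) (auto simp: l)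
    then have x: "0 \<le> x" "x \<le> pi / 2"
      unfolding x_def by (auto simp: field_simps l)
    have "norm (b j m) = (cos x ^ 2) ^ m" using True x
      by (simp add: b_def x_def power_mult)
    also have "\<dots> \<le> (exp (- x\<^sup>2 / 2) ^ 2) ^ m"
      using x by (intro power_mono cos_le_exp_neg_square cos_ge_zero) auto
    also have "\<dots> = exp (- (pi\<^sup>2 * inverse ((real (l m))\<^sup>2 / real m)) * (real (Suc j))\<^sup>2)"
    proof -
      have "(exp y ^ 2) ^ m = exp (2 * real m * y)" for y :: real
        using exp_of_nat_mult[of "2 * m" y] by (simp add: power_mult)
      moreover have "2 * real m * (- x\<^sup>2 / 2) = - (pi\<^sup>2 * inverse ((real (l m))\<^sup>2 / real m)) * (real (Suc j))\<^sup>2"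
        by (simp only: x_def power_mult_distrib power_divide inverse_divide) simp
      ultimately show ?thesis by (simp only:)
    qed
    also have "\<dots> \<le> exp (- (pi\<^sup>2 * (inverse (pi * t) / 2)) * real (Suc j))"
      using m t by (intro exp_neg_Suc_square_le mult_left_mono) auto
    also have "pi\<^sup>2 * (inverse (pi * t) / 2) = pi / (2 * t)"
      using t by (simp add: field_simps power2_eq_square)
    finally show ?thesis .
  qed (simp add: b_def)
  have "(\<lambda>m. \<Sum>j. b j m) \<longlonglongrightarrow> (\<Sum>j. exp (- pi * (real (Suc j))\<^sup>2 * (1 / t)))"
  proof (rule tannerys_theorem[THEN conjunct2, THEN conjunct2])
    fix j
    define x where "x m = pi * real (Suc j) / real (l m)" for m
    have x0: "filterlim x (at_right 0) sequentially"
    proof (rule tendsto_imp_filterlim_at_right)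
      have "(\<lambda>m. pi * real (Suc j) * inverse (real (l m))) \<longlonglongrightarrow> pi * real (Suc j) * 0"
        by (intro tendsto_intros tendsto_inverse_0_at_top width_at_top)
      then show "x \<longlonglongrightarrow> 0" by (simp add: x_def[abs_def] divide_inverse)
      show "\<forall>\<^sub>F m in sequentially. x m > 0" by (auto simp: x_def l)
    qed
    have "((\<lambda>x. ln (cos x) / x\<^sup>2) \<longlongrightarrow> -1/2) (at_right (0::real))" by real_asymp
    from filterlim_compose[OF this x0]
    have ln_cos: "(\<lambda>m. ln (cos (x m)) / (x m)\<^sup>2) \<longlonglongrightarrow> -1/2" .
    have "(\<lambda>m. exp (2 * (pi * real (Suc j))\<^sup>2 * inverse ((real (l m))\<^sup>2 / real m) * (ln (cos (x m)) / (x m)\<^sup>2)))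
       \<longlonglongrightarrow> exp (2 * (pi * real (Suc j))\<^sup>2 * inverse (pi * t) * (-1/2))"
      by (intro tendsto_exp tendsto_mult tendsto_const inv ln_cos)
    also have "2 * (pi * real (Suc j))\<^sup>2 * inverse (pi * t) * (-1/2) = - pi * (real (Suc j))\<^sup>2 * (1 / t)"
      using t by (simp add: field_simps power2_eq_square)
    finally have E: "(\<lambda>m. exp (2 * (pi * real (Suc j))\<^sup>2 * inverse ((real (l m))\<^sup>2 / real m) * (ln (cos (x m)) / (x m)\<^sup>2)))
       \<longlonglongrightarrow> exp (- pi * (real (Suc j))\<^sup>2 * (1 / t))" .
    have "\<forall>\<^sub>F m in sequentially. real j + 1 < real (l m) / 2"
      using width_at_top[unfolded filterlim_at_top_dense, rule_format, of "2 * (real j + 1)"]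
      by eventually_elim simp
    then have "\<forall>\<^sub>F m in sequentially.
        exp (2 * (pi * real (Suc j))\<^sup>2 * inverse ((real (l m))\<^sup>2 / real m) * (ln (cos (x m)) / (x m)\<^sup>2)) = b j m"
    proof eventually_elim
      case (elim m)
      have jL: "j < L m" using elim by (simp add: l)
      have lp: "real (l m) > 0" by (simp add: l)
      have "pi * (2 * real (Suc j)) < pi * real (l m)"
        using elim by (intro mult_strict_left_mono) auto
      moreover have "0 < pi * real (Suc j)" by simp
      ultimately have "x m < pi / 2" "0 < x m"
        using lp unfolding x_def by (auto simp: divide_less_eq)
      then have c: "cos (x m) > 0" by (intro cos_gt_zero) auto
      have "2 * (pi * real (Suc j))\<^sup>2 * inverse ((real (l m))\<^sup>2 / real m) * (ln (cos (x m)) / (x m)\<^sup>2)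
          = real (2 * m) * ln (cos (x m))"
      proof -
        have "2 * a\<^sup>2 * inverse (b\<^sup>2 / c) * (y / (a / b)\<^sup>2) = 2 * c * y"
          if "a \<noteq> 0" "b \<noteq> 0" for a b c y :: real
          using that by (simp add: field_simps)
        from this[of "pi * real (Suc j)" "real (l m)" "real m" "ln (cos (x m))"] show ?thesis
          using lp by (simp add: x_def)
      qed
      also have "exp \<dots> = cos (x m) ^ (2 * m)"
        using c by (simp only: exp_of_nat_mult exp_ln)
      finally show ?case using jL by (simp add: b_def x_def)
    qed
    with E show "(\<lambda>m. b j m) \<longlonglongrightarrow> exp (- pi * (real (Suc j))\<^sup>2 * (1 / t))"
      by (rule Lim_transform_eventually)
  next
    show "\<forall>\<^sub>F (j, m) in at_top \<times>\<^sub>F sequentially.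
        norm (b j m) \<le> exp (- (pi / (2 * t)) * real (Suc j))"
      unfolding eventually_prod_filter
      by (rule exI[of _ "\<lambda>_. True"], rule exI[of _ "\<lambda>m. inverse (pi * t) / 2 < inverse ((real (l m))\<^sup>2 / real m)"])
         (use ev bound in auto)
    show "summable (\<lambda>j. exp (- (pi / (2 * t)) * real (Suc j)))"
      by (rule summable_exp_neg_Suc) (use t in simp)
  qed simp
  then show ?thesis unfolding sum_b real_theta_def by (intro tendsto_intros)
qed

text \<open>Solving \<open>polya_identity\<close> for the central coefficient leaves a quotient of
  quantities with known limits, the denominator's being nonzero; no asymptotics of binomial
  coefficients enter.\<close>

lemma central_binomial_tendsto_aux:
  "(\<lambda>m. sqrt (real m) * (real (2 * m choose m) / 4 ^ m)) \<longlonglongrightarrow> real_theta (1 / t) / (sqrt (pi * t) * real_theta t)"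
proof -
  have "(\<lambda>m. (1 + 2 * (\<Sum>j<L m. cos (pi * real (Suc j) / real (l m)) ^ (2 * m)))
      / (real (l m) / sqrt (real m) * (1 + 2 * (\<Sum>k. central_ratio m (Suc k * l m)))))
      \<longlonglongrightarrow> real_theta (1 / t) / (sqrt (pi * t) * real_theta t)"
    by (intro tendsto_intros lim central_ratio_sum_tendsto cos_sum_tendsto)
       (use real_theta_ge_1[OF t] t in auto)
  moreover have "\<forall>\<^sub>F m in sequentially. 1 + 2 * (\<Sum>k. central_ratio m (Suc k * l m)) > 0"
    by (rule order_tendstoD(1)[OF central_ratio_sum_tendsto]) (use real_theta_ge_1[OF t] in auto)
  then have "\<forall>\<^sub>F m in sequentially. (1 + 2 * (\<Sum>j<L m. cos (pi * real (Suc j) / real (l m)) ^ (2 * m)))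
      / (real (l m) / sqrt (real m) * (1 + 2 * (\<Sum>k. central_ratio m (Suc k * l m))))
     = sqrt (real m) * (real (2 * m choose m) / 4 ^ m)"
  proof eventually_elim
    case (elim m)
    then show ?case unfolding polya_identity[OF l] using l[of m] by simp
  qed
  ultimately show ?thesis by (rule Lim_transform_eventually)
qed

end

lemma central_binomial_tendsto:
  assumes t: "t > 0"
  shows "(\<lambda>m. sqrt (real m) * (real (2 * m choose m) / 4 ^ m))
           \<longlonglongrightarrow> real_theta (1 / t) / (sqrt (pi * t) * real_theta t)"
proof -
  \<comment> \<open>Makes \<open>l m\<close> an odd integer within distance 1 of sqrt (pi * t *
    m).\<close>
  define L where "L m = nat \<lfloor>sqrt (pi * t * real m) / 2\<rfloor>" for m
  define l where "l m = 2 * L m + 1" for m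
  have near: "\<bar>real (l m) / sqrt (real m) - sqrt (pi * t)\<bar> \<le> 1 / sqrt (real m)" if "m > 0" for m
  proof -
    have "sqrt (pi * t * real m) / 2 \<ge> 0" using t by simp
    then have "real (L m) \<le> sqrt (pi * t * real m) / 2" "sqrt (pi * t * real m) / 2 < real (L m) + 1"
      unfolding L_def by linarith+
    then have "\<bar>real (l m) - sqrt (pi * t * real m)\<bar> \<le> 1"
      unfolding l_def by simp
    moreover have "real (l m) / sqrt (real m) - sqrt (pi * t) = (real (l m) - sqrt (pi * t * real m)) / sqrt (real m)"
      using that by (simp add: real_sqrt_mult field_simps)
    ultimately show ?thesis using that by (simp add: divide_right_mono)
  qed
  have "(\<lambda>m. real (l m) / sqrt (real m) - sqrt (pi * t)) \<longlonglongrightarrow> 0"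
  proof (rule tendsto_rabs_zero_cancel, rule tendsto_sandwich[of "\<lambda>_. 0"])
    show "\<forall>\<^sub>F m in sequentially. \<bar>real (l m) / sqrt (real m) - sqrt (pi * t)\<bar> \<le> 1 / sqrt (real m)"
      using eventually_gt_at_top[of 0] by eventually_elim (rule near)
    show "(\<lambda>m. 1 / sqrt (real m)) \<longlonglongrightarrow> 0" by real_asymp
  qed auto
  then have "(\<lambda>m. real (l m) / sqrt (real m)) \<longlonglongrightarrow> sqrt (pi * t)"
    by (simp add: LIM_zero_iff)
  from central_binomial_tendsto_aux[OF t l_def this] show ?thesis .
qed

text \<open>The limit of \<open>central_binomial_tendsto\<close> does not depend on \<open>t\<close>, so comparing with \<open>t = 1\<close> avoids
  Stirling's formula and the Gaussian integral.\<close>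

lemma real_theta_inversion:
  assumes t: "t > 0"
  shows "real_theta (1 / t) = sqrt t * real_theta t"
proof -
  have "real_theta (1 / t) / (sqrt (pi * t) * real_theta t) = real_theta (1 / 1) / (sqrt (pi * 1) * real_theta 1)"
    by (rule LIMSEQ_unique[OF central_binomial_tendsto central_binomial_tendsto]) (use t in auto)
  then show ?thesis
    using real_theta_ge_1[of 1] real_theta_ge_1[OF t] t
    by (simp add: real_sqrt_mult field_simps)
qed

section \<open>The Jacobi theta function and its primitive\<close>

text \<open>Index n stands for the pair of frequencies k = n + 1 and k = - (n + 1), whence the
  factors 2 in the series built on it. Even n therefore means odd k.\<close>

definition freq :: "nat \<Rightarrow> real" where "freq n = pi * (real (Suc n))\<^sup>2"

abbreviation ifreq :: "nat \<Rightarrow> complex" where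
  "ifreq n \<equiv> \<i> * complex_of_real (freq n)"

definition nome :: "nat \<Rightarrow> complex \<Rightarrow> complex" where
  "nome n \<tau> = exp (\<i> * complex_of_real (freq n) * \<tau>)"

definition jtheta :: "complex \<Rightarrow> complex" where
  "jtheta \<tau> = 1 + (\<Sum>n. 2 * nome n \<tau>)"

text \<open>The termwise primitive of \<open>jtheta\<close> vanishing at 0. The weights 1 / k^2 make
  it converge on the closed half-plane, so its values on the real line make sense although theta
  does not extend there.\<close>

definition jint :: "complex \<Rightarrow> complex" where
  "jint \<tau> = \<tau> + (\<Sum>n. 2 * (nome n \<tau> - 1) / ifreq n)"

abbreviation jline :: "real \<Rightarrow> complex" where
  "jline x \<equiv> jint (complex_of_real x)"

lemma freq_pos [simp]: "freq n > 0"
  by (simp add: freq_def)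

lemma freq_nonzero [simp]: "freq n \<noteq> 0"
  using freq_pos[of n] by linarith

lemma norm_nome: "norm (nome n \<tau>) = exp (- freq n * Im \<tau>)"
  by (simp add: nome_def)

lemma norm_nome_le_1: "Im \<tau> \<ge> 0 \<Longrightarrow> norm (nome n \<tau>) \<le> 1"
  unfolding norm_nome using freq_pos[of n] by (simp del: freq_pos)

lemma summable_inverse_freq: "summable (\<lambda>n. c / freq n)"
proof -
  have "summable (\<lambda>n. inverse ((real (Suc n))\<^sup>2))"
    using inverse_power_summable[of 2, where 'a=real] by (subst summable_Suc_iff) simp
  from summable_mult[OF this, of "c / pi"] show ?thesis
    by (simp add: freq_def field_simps)
qed

lemma norm_jint_term_le:
  assumes "Im \<tau> \<ge> 0"
  shows "norm (2 * (nome n \<tau> - 1) / ifreq n) \<le> 4 / freq n"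
proof -
  have "norm (nome n \<tau> - 1) \<le> norm (nome n \<tau>) + norm (1::complex)"
    by (rule norm_triangle_ineq4)
  also have "\<dots> \<le> 2" using norm_nome_le_1[OF assms, of n] by simp
  finally have "2 * norm (nome n \<tau> - 1) / freq n \<le> 4 / freq n"
    by (intro divide_right_mono) (auto intro: less_imp_le)
  then show ?thesis by (simp add: norm_mult norm_divide less_imp_le del: right_diff_distrib_numeral)
qed

lemma continuous_on_jint: "continuous_on {\<tau>. Im \<tau> \<ge> 0} jint"
proof -
  have "continuous_on {\<tau>. Im \<tau> \<ge> 0} (\<lambda>\<tau>. \<Sum>n. 2 * (nome n \<tau> - 1) / ifreq n)"
  proof (rule uniform_limit_theorem)
    show "uniform_limit {\<tau>. Im \<tau> \<ge> 0} (\<lambda>m \<tau>. \<Sum>n<m. 2 * (nome n \<tau> - 1) / ifreq n)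
        (\<lambda>\<tau>. \<Sum>n. 2 * (nome n \<tau> - 1) / ifreq n) sequentially"
      by (rule Weierstrass_m_test[OF norm_jint_term_le summable_inverse_freq]) simp
  qed (auto simp: nome_def intro!: always_eventually continuous_intros)
  then show ?thesis
    unfolding jint_def[abs_def] by (intro continuous_intros)
qed

lemma nome_summable_bound:
  assumes "\<delta> > 0"
  shows "summable (\<lambda>n. 2 * exp (- freq n * \<delta>))"
proof (rule summable_mult, rule summable_comparison_test'[OF summable_exp_neg_Suc[of "pi * \<delta>"]])
  show "norm (exp (- freq n * \<delta>)) \<le> exp (- (pi * \<delta>) * real (Suc n))" for n
    using exp_neg_Suc_square_le[of "pi * \<delta>" "pi * \<delta>" n] assms by (simp add: freq_def mult_ac)
qed (use assms in simp)

text \<open>Termwise differentiation on the half-plane above height \<open>Im \<tau> / 2\<close>,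
  where the differentiated series has a summable majorant independent of the point.\<close>

lemma has_field_derivative_jint:
  assumes "Im \<tau> > 0"
  shows "(jint has_field_derivative jtheta \<tau>) (at \<tau>)"
proof -
  define \<delta> where "\<delta> = Im \<tau> / 2"
  have \<delta>: "\<delta> > 0" "\<delta> < Im \<tau>" using assms by (auto simp: \<delta>_def)
  define S where "S = {z. Im z > \<delta>}"
  have "open S" "convex S" unfolding S_def
    by (simp_all add: open_halfspace_Im_gt convex_halfspace_Im_gt)
  have "((\<lambda>\<tau>. \<Sum>n. 2 * (nome n \<tau> - 1) / ifreq n) has_field_derivative
      (\<Sum>n. 2 * nome n \<tau>)) (at \<tau>)"
  proof (rule has_field_derivative_series'(2)[OF \<open>convex S\<close>])
    show "((\<lambda>\<tau>. 2 * (nome n \<tau> - 1) / ifreq n) has_field_derivative 2 * nome n z) (at z within S)"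
      for n z
      unfolding nome_def by (auto intro!: derivative_eq_intros simp: field_simps)
    show "uniformly_convergent_on S (\<lambda>n x. \<Sum>i<n. 2 * nome i x)"
    proof (rule Weierstrass_m_test'[OF _ nome_summable_bound[OF \<delta>(1)]])
      fix n z assume "z \<in> S"
      then have "freq n * \<delta> \<le> freq n * Im z" by (intro mult_left_mono) (auto simp: S_def less_imp_le)
      then show "norm (2 * nome n z) \<le> 2 * exp (- freq n * \<delta>)"
        by (simp add: norm_mult norm_nome)
    qed
    show "\<tau> \<in> S" "\<tau> \<in> interior S" using \<delta> \<open>open S\<close> by (auto simp: S_def interior_open)
    show "summable (\<lambda>n. 2 * (nome n \<tau> - 1) / ifreq n)"
      by (rule summable_comparison_test'[OF summable_inverse_freq[of 4]])
         (use norm_jint_term_le[of \<tau>] assms in auto)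
  qed
  then show ?thesis
    unfolding jint_def[abs_def] jtheta_def by (auto intro!: derivative_eq_intros)
qed

lemma jtheta_holomorphic: "jtheta holomorphic_on {\<tau>. Im \<tau> > 0}"
proof -
  have "jint holomorphic_on {\<tau>. Im \<tau> > 0}"
    by (rule holomorphic_onI, rule field_differentiable_at_within)
       (use has_field_derivative_jint in \<open>auto simp: field_differentiable_def\<close>)
  then have "deriv jint holomorphic_on {\<tau>. Im \<tau> > 0}"
    by (rule holomorphic_deriv) (simp add: open_halfspace_Im_gt)
  then show ?thesis
    by (rule holomorphic_transform) (use has_field_derivative_jint DERIV_imp_deriv in auto)
qed

lemma nome_add_even: "nome n (\<tau> + 2 * of_int k) = nome n \<tau>"
proof -
  have "exp (\<i> * complex_of_real (freq n) * (\<tau> + 2 * of_int k))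
      = exp (\<i> * complex_of_real (freq n) * \<tau> + 2 * of_int (int (Suc n) ^ 2 * k) * complex_of_real pi * \<i>)"
    by (rule arg_cong[where f = exp]) (simp add: freq_def algebra_simps)
  also have "\<dots> = exp (\<i> * complex_of_real (freq n) * \<tau>)"
    using exp_integer_2pi[OF Ints_of_int, of "int (Suc n) ^ 2 * k"] unfolding exp_add by simp
  finally show ?thesis by (simp add: nome_def)
qed

lemma jtheta_add_even: "jtheta (\<tau> + 2 * of_int k) = jtheta \<tau>"
  by (simp add: jtheta_def nome_add_even)

lemma jint_0 [simp]: "jint 0 = 0"
  by (simp add: jint_def nome_def)

text \<open>Reflection in the imaginary axis conjugates every \<open>nome\<close>. It turns each
  expansion on one side of 0 into one on the other side.\<close>

lemma cnj_jint:
  assumes "Im \<tau> \<ge> 0"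
  shows "jint (- cnj \<tau>) = - cnj (jint \<tau>)"
proof -
  have n: "nome n (- cnj \<tau>) = cnj (nome n \<tau>)" for n
    by (simp add: nome_def exp_cnj)
  have "summable (\<lambda>n. 2 * (nome n \<tau> - 1) / ifreq n)"
    by (rule summable_comparison_test'[OF summable_inverse_freq[of 4]])
       (use norm_jint_term_le[OF assms] in auto)
  then have "(\<lambda>n. cnj (2 * (nome n \<tau> - 1) / ifreq n)) sums
      cnj (\<Sum>n. 2 * (nome n \<tau> - 1) / ifreq n)"
    unfolding sums_cnj by (rule summable_sums)
  then have "(\<lambda>n. - cnj (2 * (nome n \<tau> - 1) / ifreq n)) sums
      - cnj (\<Sum>n. 2 * (nome n \<tau> - 1) / ifreq n)"
    by (rule sums_minus)
  also have "(\<lambda>n. - cnj (2 * (nome n \<tau> - 1) / ifreq n))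
     = (\<lambda>n. 2 * (nome n (- cnj \<tau>) - 1) / ifreq n)"
    by (simp add: n fun_eq_iff)
  finally show ?thesis by (simp add: jint_def sums_iff)
qed

lemma jtheta_imaginary:
  assumes "t > 0"
  shows "jtheta (\<i> * complex_of_real t) = complex_of_real (real_theta t)"
proof -
  have s: "summable (\<lambda>n. exp (- pi * (real (Suc n))\<^sup>2 * t))"
    using summable_mult[OF nome_summable_bound[OF assms], of "1/2"] by (simp add: freq_def mult_ac)
  have n: "nome n (\<i> * complex_of_real t) = complex_of_real (exp (- pi * (real (Suc n))\<^sup>2 * t))" for n
    unfolding nome_def by (subst exp_of_real[symmetric], rule arg_cong[where f = exp])
       (simp add: freq_def complex_eq_iff)
  have "jtheta (\<i> * complex_of_real t) = 1 + complex_of_real (\<Sum>n. 2 * exp (- pi * (real (Suc n))\<^sup>2 * t))"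
    unfolding jtheta_def n by (subst suminf_of_real) (use s in \<open>auto intro: summable_mult\<close>)
  also have "(\<Sum>n. 2 * exp (- pi * (real (Suc n))\<^sup>2 * t)) = 2 * (\<Sum>n. exp (- pi * (real (Suc n))\<^sup>2 * t))"
    by (rule suminf_mult[OF s])
  finally show ?thesis by (simp add: real_theta_def)
qed

lemma Im_neg_inverse_pos:
  assumes "Im \<tau> > 0"
  shows "Im (- 1 / \<tau>) > 0"
proof -
  have "Im (- 1 / \<tau>) = Im \<tau> / ((Re \<tau>)\<^sup>2 + (Im \<tau>)\<^sup>2)" by (simp add: Im_divide)
  also have "\<dots> > 0" using assms by (intro divide_pos_pos add_nonneg_pos) auto
  finally show ?thesis .
qed

text \<open>Identity theorem: on the imaginary axis the claim is
  \<open>real_theta_inversion\<close>, and both sides are holomorphic on the half-plane. The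
  principal root is so because \<open>- \<i> * \<tau>\<close> has positive real part.\<close>

lemma jtheta_inversion:
  assumes "Im \<tau> > 0"
  shows "jtheta (- 1 / \<tau>) = csqrt (- \<i> * \<tau>) * jtheta \<tau>"
proof -
  let ?H = "{\<tau>. Im \<tau> > 0}"
  let ?U = "(\<lambda>t. \<i> * complex_of_real t) ` {0<..}"
  define f where "f z = jtheta (- 1 / z) - csqrt (- \<i> * z) * jtheta z" for z
  have "f \<tau> = 0"
  proof (rule analytic_continuation[of f ?H ?U \<i>])
    have "(jtheta \<circ> (\<lambda>z. - 1 / z)) holomorphic_on ?H"
    proof (rule holomorphic_on_compose_gen[OF _ jtheta_holomorphic])
      show "(\<lambda>z. - 1 / z) holomorphic_on ?H" by (intro holomorphic_intros) auto
      show "(\<lambda>z. - 1 / z) ` ?H \<subseteq> ?H" using Im_neg_inverse_pos by blast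
    qed
    moreover have "(\<lambda>z. csqrt (- \<i> * z)) holomorphic_on ?H"
      by (rule holomorphic_on_csqrt') (auto intro!: holomorphic_intros simp: complex_nonpos_Reals_iff)
    ultimately show "f holomorphic_on ?H"
      unfolding f_def[abs_def] o_def by (intro holomorphic_on_diff holomorphic_on_mult jtheta_holomorphic)
    show "open ?H" "connected ?H"
      by (auto simp: open_halfspace_Im_gt convex_halfspace_Im_gt intro: convex_connected)
    show "\<i> islimpt ?U"
    proof (rule connected_imp_perfect)
      show "connected ?U" by (intro connected_continuous_image continuous_intros) auto
      show ii: "\<i> \<in> ?U" by (rule image_eqI[of _ _ 1]) auto
      fix x
      have "\<i> * complex_of_real 2 \<in> ?U" by (rule image_eqI[of _ _ 2]) auto
      with ii show "?U \<noteq> {x}" by (metis (no_types, lifting) mult.right_neutral mult_cancel_left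
        complex_i_not_zero of_real_eq_1_iff singletonD numeral_eq_one_iff num.distinct(1))
    qed
  next
    fix z assume "z \<in> ?U"
    then obtain t where t: "t > 0" "z = \<i> * complex_of_real t" by auto
    have "jtheta (- 1 / z) = jtheta (\<i> * complex_of_real (1 / t))"
      using t by (intro arg_cong[where f = jtheta]) (simp add: field_simps)
    also have "\<dots> = complex_of_real (sqrt t * real_theta t)"
      using t jtheta_imaginary[of "1 / t"] real_theta_inversion[of t] by simp
    also have "\<dots> = csqrt (- \<i> * z) * jtheta z"
      using t jtheta_imaginary[of t] by simp
    finally show "f z = 0" by (simp add: f_def)
  qed (use assms in auto)
  then show ?thesis by (simp add: f_def)
qed

text \<open>For \<open>\<tau>\<close> in the upper half-plane the principal root lies in the open
  first quadrant, so turning it by - pi / 4 keeps it in the right half-plane and on the principal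
  branch.\<close>

lemma csqrt_neg_ii_times:
  assumes "Im \<tau> > 0"
  shows "csqrt (- \<i> * \<tau>) = cis (- pi / 4) * csqrt \<tau>"
proof (rule csqrt_unique)
  show "(cis (- pi / 4) * csqrt \<tau>)\<^sup>2 = - \<i> * \<tau>"
    by (simp add: power_mult_distrib Complex.DeMoivre)
  define x y where "x = Re (csqrt \<tau>)" and "y = Im (csqrt \<tau>)"
  have "Im ((csqrt \<tau>)\<^sup>2) = 2 * (x * y)"
    by (simp only: power2_eq_square times_complex.sel x_def y_def) (simp only: mult.commute mult_2)
  then have "x * y > 0" using assms by simp
  moreover have "x \<ge> 0" unfolding x_def by (rule Re_csqrt)
  ultimately have "Re (csqrt \<tau>) > 0 \<and> Im (csqrt \<tau>) > 0"
    unfolding x_def[symmetric] y_def[symmetric] by (auto simp: zero_less_mult_iff)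
  then have "0 < Re (cis (- pi / 4) * csqrt \<tau>)"
    by (auto simp: cos_45 sin_45 intro!: add_pos_pos)
  then show "0 < Re (cis (- pi / 4) * csqrt \<tau>) \<or>
    Re (cis (- pi / 4) * csqrt \<tau>) = 0 \<and> 0 \<le> Im (cis (- pi / 4) * csqrt \<tau>)" by blast
qed

text \<open>The exponential in the k-th term is a \<open>nome\<close> at - 4 * pi * t; k and - k
  contribute equally, and the term k = 0 matches the linear term of \<open>jint\<close>.\<close>

lemma riemann_phi_eq_jint: "riemann_phi t = - (\<i> / (4 * pi)) * jline (- 4 * pi * t)"
proof -
  define g where "g n = (nome n (complex_of_real (- 4 * pi * t)) - 1) / ifreq n" for n
  have term_eq: "riemann_term t k = - (\<i> / (4 * pi)) * g n" if "k\<^sup>2 = (int (Suc n))\<^sup>2" for k n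
  proof -
    have k0: "k \<noteq> 0" using that by auto
    have k2: "(of_int k)\<^sup>2 = (complex_of_real (real (Suc n)))\<^sup>2"
      using arg_cong[OF that, of "of_int :: int \<Rightarrow> complex"] by simp
    have "exp (- 4 * (complex_of_real pi)\<^sup>2 * \<i> * (of_int k)\<^sup>2 * complex_of_real t) = nome n (complex_of_real (- 4 * pi * t))"
      unfolding nome_def k2 by (rule arg_cong[where f = exp]) (simp add: freq_def power2_eq_square)
    then have "riemann_term t k = (nome n (complex_of_real (- 4 * pi * t)) - 1) / (- 4 * (complex_of_real pi)\<^sup>2 * (complex_of_real (real (Suc n)))\<^sup>2)"
      using k0 unfolding riemann_term_def k2 by simp
    also have "- 4 * (complex_of_real pi)\<^sup>2 * (complex_of_real (real (Suc n)))\<^sup>2 = - (4 * complex_of_real pi * complex_of_real (freq n))"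
      by (simp add: freq_def power2_eq_square)
    finally show ?thesis by (simp add: g_def)
  qed
  have "summable (\<lambda>n. norm (2 * g n))"
    by (rule summable_comparison_test'[OF summable_inverse_freq[of 4]])
       (use norm_jint_term_le[of "complex_of_real (- 4 * pi * t)"] in \<open>auto simp: g_def\<close>)
  then have gs: "summable (\<lambda>n. norm (g n))"
    using summable_mult[of "\<lambda>n. norm (2 * g n)" "1/2"] by (simp add: norm_mult)
  have gsum: "((\<lambda>n. - (\<i> / (4 * pi)) * g n) has_sum - (\<i> / (4 * pi)) * suminf g) UNIV"
    by (intro has_sum_cmult_right norm_summable_imp_has_sum[OF gs]) (use gs summable_norm_cancel in auto)
  have part: "(riemann_term t has_sum - (\<i> / (4 * pi)) * suminf g) (range f)"
    if "inj f" "\<And>n. (f n)\<^sup>2 = (int (Suc n))\<^sup>2" for f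
    unfolding has_sum_reindex[OF that(1)] o_def using gsum term_eq[OF that(2)] by simp
  \<comment> \<open>The unordered sum over the integers is split into positive, negative and zero
    index.\<close>
  have "(riemann_term t has_sum - (\<i> / (4 * pi)) * suminf g + - (\<i> / (4 * pi)) * suminf g)
     (range (\<lambda>n. int (Suc n)) \<union> range (\<lambda>n. - int (Suc n)))"
    by (intro has_sum_Un_disjoint part) (auto simp: inj_on_def power2_eq_square algebra_simps)
  then have "(riemann_term t has_sum riemann_term t 0 + (- (\<i> / (4 * pi)) * suminf g + - (\<i> / (4 * pi)) * suminf g))
     (insert 0 (range (\<lambda>n. int (Suc n)) \<union> range (\<lambda>n. - int (Suc n))))"
    by (intro has_sum_insert) auto
  also have "insert 0 (range (\<lambda>n. int (Suc n)) \<union> range (\<lambda>n. - int (Suc n))) = UNIV"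
  proof (intro set_eqI iffI)
    fix k :: int
    consider "k = 0" | "k = int (Suc (nat k - 1))" | "k = - int (Suc (nat (- k) - 1))" by linarith
    then show "k \<in> insert 0 (range (\<lambda>n. int (Suc n)) \<union> range (\<lambda>n. - int (Suc n)))" by cases blast+
  qed simp
  finally have "riemann_phi t = riemann_term t 0 + (- (\<i> / (4 * pi)) * suminf g + - (\<i> / (4 * pi)) * suminf g)"
    unfolding riemann_phi_def by (rule infsumI)
  moreover have "suminf (\<lambda>n. 2 * g n) = 2 * suminf g"
    by (rule suminf_mult) (use gs summable_norm_cancel in auto)
  then have "jline (- 4 * pi * t) = complex_of_real (- 4 * pi * t) + 2 * suminf g"
    by (simp add: jint_def g_def)
  ultimately show ?thesis by (simp only:) (simp add: riemann_term_def field_simps)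
qed

section \<open>The theta group\<close>

text \<open>Matrices with rows (a, b) and (c, d), closed under right multiplication by the inversion
  and the even translations. The generator added last thus acts on \<tau> first, which suits both
  the induction for the multiplier and the continued fraction.\<close>

inductive theta_group :: "int \<Rightarrow> int \<Rightarrow> int \<Rightarrow> int \<Rightarrow> bool" where
  one: "theta_group 1 0 0 1"
| inversion: "theta_group a b c d \<Longrightarrow> theta_group b (- a) d (- c)"
| translation: "theta_group a b c d \<Longrightarrow> theta_group a (b + 2 * k * a) c (d + 2 * k * c)"

lemma theta_group_det: "theta_group a b c d \<Longrightarrow> a * d - b * c = 1"
  by (induction rule: theta_group.induct) (simp_all add: algebra_simps)

text \<open>\<open>\<epsilon>\<close> absorbs the discrepancy between principal roots under
  composition. It belongs to the four entries and not to the map they define: negating all entries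
  changes it.\<close>

definition theta_multiplier :: "int \<Rightarrow> int \<Rightarrow> int \<Rightarrow> int \<Rightarrow> complex \<Rightarrow> bool" where
  "theta_multiplier a b c d \<epsilon> \<longleftrightarrow> (\<forall>\<tau>. Im \<tau> > 0 \<longrightarrow>
     jtheta ((of_int a * \<tau> + of_int b) / (of_int c * \<tau> + of_int d))
       = \<epsilon> * csqrt (of_int c * \<tau> + of_int d) * jtheta \<tau>)"

lemma theta_multiplier_inversion: "theta_multiplier 0 (- 1) 1 0 (cis (- pi / 4))"
  using jtheta_inversion csqrt_neg_ii_times by (simp add: theta_multiplier_def)

lemma denominator_nonzero:
  assumes "a * d - b * c = 1" "Im \<tau> > 0"
  shows "of_int c * \<tau> + of_int d \<noteq> (0::complex)"
proof
  assume *: "of_int c * \<tau> + of_int d = (0::complex)"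
  from arg_cong[OF this, of Im] assms(2) have "c = 0" by simp
  with * have "d = 0" by simp
  with \<open>c = 0\<close> assms(1) show False by simp
qed

lemma continuous_on_csqrt_affine:
  "continuous_on {\<tau>. Im \<tau> > 0} (\<lambda>\<tau>. csqrt (of_int c * \<tau> + of_int d))"
proof (cases "c = 0")
  case False
  have "(\<lambda>\<tau>. csqrt (of_int c * \<tau> + of_int d)) holomorphic_on {\<tau>. Im \<tau> > 0}"
    by (rule holomorphic_on_csqrt') (use False in \<open>auto intro!: holomorphic_intros simp: complex_nonpos_Reals_iff\<close>)
  then show ?thesis by (rule holomorphic_on_imp_continuous_on)
qed simp

text \<open>On composing with the inversion, a product of two principal roots meets the principal
  root of the product; the square of their quotient is the constant - i. A continuous function with
  finitely many values on the connected half-plane is constant, so the multiplier changes by a fixed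
  square root of - i, an eighth root of unity.\<close>

lemma theta_group_multiplier:
  assumes "theta_group a b c d"
  shows "\<exists>\<epsilon>. \<epsilon> ^ 8 = 1 \<and> theta_multiplier a b c d \<epsilon>"
  using assms
proof (induction rule: theta_group.induct)
  case one
  show ?case by (rule exI[of _ 1]) (simp add: theta_multiplier_def)
next
  case (translation a b c d k)
  then obtain \<epsilon> where \<epsilon>: "\<epsilon> ^ 8 = 1" "theta_multiplier a b c d \<epsilon>" by blast
  have "theta_multiplier a (b + 2 * k * a) c (d + 2 * k * c) \<epsilon>"
    unfolding theta_multiplier_def
  proof (intro allI impI)
    fix \<tau> :: complex assume "Im \<tau> > 0"
    then have "Im (\<tau> + 2 * of_int k) > 0" by simp
    with \<epsilon>(2) have "jtheta ((of_int a * (\<tau> + 2 * of_int k) + of_int b) / (of_int c * (\<tau> + 2 * of_int k) + of_int d))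
       = \<epsilon> * csqrt (of_int c * (\<tau> + 2 * of_int k) + of_int d) * jtheta \<tau>"
      by (simp only: theta_multiplier_def jtheta_add_even)
    then show "jtheta ((of_int a * \<tau> + of_int (b + 2 * k * a)) / (of_int c * \<tau> + of_int (d + 2 * k * c)))
       = \<epsilon> * csqrt (of_int c * \<tau> + of_int (d + 2 * k * c)) * jtheta \<tau>"
      by (simp add: algebra_simps)
  qed
  with \<epsilon>(1) show ?case by blast
next
  case (inversion a b c d)
  then obtain \<epsilon> where \<epsilon>: "\<epsilon> ^ 8 = 1" "theta_multiplier a b c d \<epsilon>" by blast
  let ?H = "{\<tau>. Im \<tau> > 0}"
  have det: "a * d - b * c = 1" using inversion theta_group_det by blast
  then have det': "b * (- c) - (- a) * d = 1" by simp
  define q where "q \<tau> = csqrt (of_int c * (- 1 / \<tau>) + of_int d) * csqrt (- \<i> * \<tau>) / csqrt (of_int d * \<tau> + of_int (- c))" for \<tau>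
  have q2: "(q \<tau>)\<^sup>2 = - \<i>" if "\<tau> \<in> ?H" for \<tau>
  proof -
    have nz: "of_int d * \<tau> + of_int (- c) \<noteq> 0" "\<tau> \<noteq> 0"
      using denominator_nonzero[OF det', of \<tau>] that by auto
    have "(q \<tau>)\<^sup>2 = (of_int c * (- 1 / \<tau>) + of_int d) * (- \<i> * \<tau>) / (of_int d * \<tau> + of_int (- c))"
      by (simp only: q_def power_mult_distrib power_divide power2_csqrt)
    also have "\<dots> = - \<i>" using nz by (simp add: field_simps)
    finally show ?thesis .
  qed
  have "q constant_on ?H"
  proof (rule continuous_finite_range_constant)
    show "connected ?H" by (simp add: convex_halfspace_Im_gt convex_connected)
    have "continuous_on ?H ((\<lambda>\<tau>. csqrt (of_int c * \<tau> + of_int d)) \<circ> (\<lambda>\<tau>. - 1 / \<tau>))"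
    proof (rule continuous_on_compose)
      show "continuous_on ?H (\<lambda>\<tau>. - 1 / \<tau>)" by (intro continuous_intros) auto
      show "continuous_on ((\<lambda>\<tau>. - 1 / \<tau>) ` ?H) (\<lambda>\<tau>. csqrt (of_int c * \<tau> + of_int d))"
        by (rule continuous_on_subset[OF continuous_on_csqrt_affine]) (use Im_neg_inverse_pos in blast)
    qed
    moreover have "continuous_on ?H (\<lambda>\<tau>. csqrt (- \<i> * \<tau>))"
    proof (rule continuous_on_eq)
      show "continuous_on ?H (\<lambda>\<tau>. cis (- pi / 4) * csqrt \<tau>)"
        by (intro continuous_intros continuous_on_csqrt_affine[of 1 0, simplified])
      show "cis (- pi / 4) * csqrt \<tau> = csqrt (- \<i> * \<tau>)" if "\<tau> \<in> ?H" for \<tau>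
        using csqrt_neg_ii_times[of \<tau>] that by simp
    qed
    ultimately show "continuous_on ?H q"
      unfolding q_def[abs_def] o_def
      by (intro continuous_on_divide continuous_on_mult continuous_on_csqrt_affine)
         (use denominator_nonzero[OF det'] in auto)
    have "q ` ?H \<subseteq> {z. z ^ 2 = - \<i>}" using q2 by auto
    then show "finite (q ` ?H)" by (rule finite_subset) (simp add: finite_nth_roots)
  qed
  then obtain w where w: "\<And>\<tau>. \<tau> \<in> ?H \<Longrightarrow> q \<tau> = w" unfolding constant_on_def by blast
  have "w\<^sup>2 = - \<i>" using w[of \<i>] q2[of \<i>] by simp
  then have "(w\<^sup>2) ^ 4 = 1" by (simp add: power4_eq_xxxx)
  then have w8: "w ^ 8 = 1" by (simp add: power_mult[symmetric])
  have "theta_multiplier b (- a) d (- c) (\<epsilon> * w)"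
    unfolding theta_multiplier_def
  proof (intro allI impI)
    fix \<tau> :: complex assume \<tau>: "Im \<tau> > 0"
    then have \<tau>0: "\<tau> \<noteq> 0" by auto
    have nz: "of_int d * \<tau> + of_int (- c) \<noteq> 0" using denominator_nonzero[OF det' \<tau>] .
    have eq: "(of_int b * \<tau> + of_int (- a)) / (of_int d * \<tau> + of_int (- c))
      = (of_int a * (- 1 / \<tau>) + of_int b) / (of_int c * (- 1 / \<tau>) + of_int d)"
    proof -
      have "(of_int a * (- 1 / \<tau>) + of_int b) / (of_int c * (- 1 / \<tau>) + of_int d)
        = (\<tau> * (of_int a * (- 1 / \<tau>) + of_int b)) / (\<tau> * (of_int c * (- 1 / \<tau>) + of_int d))"
        using \<tau>0 by simp
      also have "\<tau> * (of_int a * (- 1 / \<tau>) + of_int b) = of_int b * \<tau> + of_int (- a)"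
        using \<tau>0 by (simp add: field_simps)
      also have "\<tau> * (of_int c * (- 1 / \<tau>) + of_int d) = of_int d * \<tau> + of_int (- c)"
        using \<tau>0 by (simp add: field_simps)
      finally show ?thesis by simp
    qed
    have "jtheta ((of_int b * \<tau> + of_int (- a)) / (of_int d * \<tau> + of_int (- c)))
      = \<epsilon> * csqrt (of_int c * (- 1 / \<tau>) + of_int d) * jtheta (- 1 / \<tau>)"
      unfolding eq using \<epsilon>(2) Im_neg_inverse_pos[OF \<tau>] unfolding theta_multiplier_def by blast
    also have "\<dots> = \<epsilon> * (csqrt (of_int c * (- 1 / \<tau>) + of_int d) * csqrt (- \<i> * \<tau>)) * jtheta \<tau>"
      unfolding jtheta_inversion[OF \<tau>] by (simp only: mult_ac)
    also have "csqrt (of_int c * (- 1 / \<tau>) + of_int d) * csqrt (- \<i> * \<tau>) = w * csqrt (of_int d * \<tau> + of_int (- c))"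
      using w[of \<tau>] \<tau> nz unfolding q_def by (simp add: field_simps)
    finally show "jtheta ((of_int b * \<tau> + of_int (- a)) / (of_int d * \<tau> + of_int (- c)))
      = \<epsilon> * w * csqrt (of_int d * \<tau> + of_int (- c)) * jtheta \<tau>" by (simp only: mult_ac)
  qed
  moreover have "(\<epsilon> * w) ^ 8 = 1" using \<epsilon>(1) w8 by (simp add: power_mult_distrib)
  ultimately show ?case by blast
qed

text \<open>Integration by parts. The derivative of \<open>jint (g \<tau>)\<close> is
  \<open>\<epsilon> * M \<tau> * jtheta \<tau>\<close>, so subtracting
  \<open>\<epsilon> * (M \<tau> * (jint \<tau> - k))\<close> removes \<open>jtheta\<close>; as
  \<open>M\<close> has derivative - 3/2 c \<open>N\<close>, what remains is continuous up to the
  real axis. The constant \<open>k\<close> is free, to be chosen to suit each use.\<close>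

lemma jint_mobius_vertical:
  fixes a b c d :: int and x h :: real and k \<epsilon> :: complex
  assumes mult: "theta_multiplier a b c d \<epsilon>" and det: "a * d - b * c = 1"
    and pos: "\<And>s. s \<in> {0..1} \<Longrightarrow> of_int c * (x + s * h) + of_int d > 0"
  defines "J \<equiv> \<lambda>\<tau>::complex. of_int c * \<tau> + of_int d"
  defines "g \<equiv> \<lambda>\<tau>::complex. (of_int a * \<tau> + of_int b) / J \<tau>"
  defines "p \<equiv> \<lambda>\<eta> s. complex_of_real (x + s * h) + \<i> * complex_of_real \<eta>"
  defines "M \<equiv> \<lambda>\<tau>. csqrt (J \<tau>) / J \<tau> ^ 2"
  defines "N \<equiv> \<lambda>\<tau>. csqrt (J \<tau>) / J \<tau> ^ 3"
  defines "F \<equiv> \<lambda>\<tau>. jint (g \<tau>) - \<epsilon> * (M \<tau> * (jint \<tau> - k))"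
  shows "F (p 0 1) - F (p 0 0) = \<epsilon> * (3 / 2 * of_int c * of_real h) * integral {0..1} (\<lambda>s. N (p 0 s) * (jint (p 0 s) - k))"
proof -
  \<comment> \<open>On \<open>R\<close> the denominator stays in the right half-plane, off the
    branch cut, including at the real boundary.\<close>
  define R where "R = {\<tau>. Im \<tau> \<ge> 0 \<and> Re (J \<tau>) > 0}"
  have J0: "J \<tau> \<noteq> 0" "J \<tau> \<notin> \<real>\<^sub>\<le>\<^sub>0" if "\<tau> \<in> R" for \<tau>
    using that by (auto simp: R_def complex_nonpos_Reals_iff)
  have pR: "p \<eta> s \<in> R" if "\<eta> \<ge> 0" "s \<in> {0..1}" for \<eta> s
    using that pos[of s] by (simp add: R_def p_def J_def)
  have cJ: "continuous_on R J" unfolding J_def by (intro continuous_intros)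
  have csq: "continuous_on R (\<lambda>\<tau>. csqrt (J \<tau>))"
    by (rule continuous_on_compose2[OF holomorphic_on_imp_continuous_on[OF holomorphic_on_csqrt] cJ])
       (use J0 in auto)
  have cM: "continuous_on R M" and cN: "continuous_on R N"
    unfolding M_def N_def using J0 by (auto intro!: continuous_intros cJ csq)
  have cjint: "continuous_on R jint"
    by (rule continuous_on_subset[OF continuous_on_jint]) (auto simp: R_def)
  have Img: "Im (g \<tau>) = Im \<tau> / (cmod (J \<tau>))\<^sup>2" if "\<tau> \<in> R" for \<tau>
  proof -
    have "Im (g \<tau>) = (of_int (a * d - b * c) * Im \<tau>) / (cmod (J \<tau>))\<^sup>2"
      unfolding g_def Im_divide cmod_power2 by (simp add: J_def algebra_simps)
    then show ?thesis using det by simp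
  qed
  have cg: "continuous_on R g"
    unfolding g_def using J0 by (intro continuous_intros cJ) auto
  have cjg: "continuous_on R (\<lambda>\<tau>. jint (g \<tau>))"
    by (rule continuous_on_compose2[OF continuous_on_jint cg]) (use Img in \<open>auto simp: R_def\<close>)
  have cF: "continuous_on R F"
    unfolding F_def by (intro continuous_intros cjg cM cjint)
  have cint: "continuous_on R (\<lambda>\<tau>. N \<tau> * (jint \<tau> - k))"
    by (intro continuous_intros cN cjint)
  \<comment> \<open>At positive height the fundamental theorem of calculus applies along a
    horizontal segment.\<close>
  have eq: "F (p \<eta> 1) - F (p \<eta> 0) = \<epsilon> * (3 / 2 * of_int c * of_real h) * integral {0..1} (\<lambda>s. N (p \<eta> s) * (jint (p \<eta> s) - k))"
    if \<eta>: "\<eta> > 0" for \<eta>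
  proof -
    define D where "D \<tau> = \<epsilon> * (3 / 2 * of_int c) * (N \<tau> * (jint \<tau> - k))" for \<tau>
    have dF: "(F has_field_derivative D \<tau>) (at \<tau>)" if "\<tau> \<in> R" "Im \<tau> > 0" for \<tau>
    proof -
      have dJ: "(J has_field_derivative of_int c) (at \<tau>)"
        unfolding J_def by (auto intro!: derivative_eq_intros)
      have "(g has_field_derivative (of_int a * J \<tau> - (of_int a * \<tau> + of_int b) * of_int c) / (J \<tau> * J \<tau>)) (at \<tau>)"
        unfolding g_def by (rule DERIV_divide) (use dJ J0[OF that(1)] in \<open>auto intro!: derivative_eq_intros\<close>)
      moreover have "of_int a * J \<tau> - (of_int a * \<tau> + of_int b) * of_int c = of_int (a * d - b * c)"
        by (simp add: J_def algebra_simps)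
      ultimately have dg: "(g has_field_derivative 1 / J \<tau> ^ 2) (at \<tau>)"
        using det by (simp add: power2_eq_square)
      have "Im (g \<tau>) > 0" using Img[OF that(1)] that(2) J0[OF that(1)] by simp
      then have "((\<lambda>\<tau>. jint (g \<tau>)) has_field_derivative jtheta (g \<tau>) * (1 / J \<tau> ^ 2)) (at \<tau>)"
        by (intro DERIV_chain2[OF has_field_derivative_jint dg])
      moreover have "jtheta (g \<tau>) = \<epsilon> * csqrt (J \<tau>) * jtheta \<tau>"
        using mult that(2) unfolding theta_multiplier_def g_def J_def by blast
      ultimately have d1: "((\<lambda>\<tau>. jint (g \<tau>)) has_field_derivative \<epsilon> * (M \<tau> * jtheta \<tau>)) (at \<tau>)"
        by (simp add: M_def mult.assoc)
      have "((\<lambda>\<tau>. csqrt (J \<tau>)) has_field_derivative of_int c / (2 * csqrt (J \<tau>))) (at \<tau>)"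
        using DERIV_chain2[OF has_field_derivative_csqrt[OF J0(2)[OF that(1)]] dJ] by (simp add: field_simps)
      then have "(M has_field_derivative
          (of_int c / (2 * csqrt (J \<tau>)) * J \<tau> ^ 2 - csqrt (J \<tau>) * (2 * J \<tau> * of_int c)) / (J \<tau> ^ 2 * J \<tau> ^ 2)) (at \<tau>)"
        unfolding M_def by (rule DERIV_divide) (use dJ J0[OF that(1)] in \<open>auto intro!: derivative_eq_intros\<close>)
      also have "(of_int c / (2 * csqrt (J \<tau>)) * J \<tau> ^ 2 - csqrt (J \<tau>) * (2 * J \<tau> * of_int c)) / (J \<tau> ^ 2 * J \<tau> ^ 2)
          = - (3 / 2 * of_int c) * N \<tau>"
      proof -
        define r where "r = csqrt (J \<tau>)"
        have "J \<tau> = r\<^sup>2" "r \<noteq> 0" using J0[OF that(1)] by (auto simp: r_def)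
        then show ?thesis unfolding N_def r_def[symmetric]
          by (simp add: field_simps power2_eq_square power3_eq_cube)
      qed
      finally have dM: "(M has_field_derivative - (3 / 2 * of_int c) * N \<tau>) (at \<tau>)" .
      have "(F has_field_derivative \<epsilon> * (M \<tau> * jtheta \<tau>)
          - \<epsilon> * (- (3 / 2 * of_int c) * N \<tau> * (jint \<tau> - k) + M \<tau> * jtheta \<tau>)) (at \<tau>)"
        unfolding F_def
        by (auto intro!: derivative_eq_intros d1 dM has_field_derivative_jint[OF that(2)])
      also have "\<epsilon> * (M \<tau> * jtheta \<tau>)
          - \<epsilon> * (- (3 / 2 * of_int c) * N \<tau> * (jint \<tau> - k) + M \<tau> * jtheta \<tau>) = D \<tau>"
        by (simp add: D_def algebra_simps)
      finally show ?thesis .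
    qed
    have "((\<lambda>s. of_real h * D (p \<eta> s)) has_integral F (p \<eta> 1) - F (p \<eta> 0)) {0..1}"
    proof (rule fundamental_theorem_of_calculus)
      fix s :: real assume s: "s \<in> {0..1}"
      have "(p \<eta> has_vector_derivative of_real h) (at s within {0..1})"
        unfolding p_def by (auto intro!: derivative_eq_intros simp: scaleR_conv_of_real)
      moreover have "(F has_field_derivative D (p \<eta> s)) (at (p \<eta> s))"
        by (rule dF) (use pR \<eta> s in \<open>auto simp: p_def\<close>)
      ultimately show "((\<lambda>s. F (p \<eta> s)) has_vector_derivative of_real h * D (p \<eta> s)) (at s within {0..1})"
        using field_vector_diff_chain_within[of "p \<eta>" "of_real h" s "{0..1}" F "D (p \<eta> s)"]
        by (simp add: o_def has_field_derivative_at_within)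
    qed simp
    then have "F (p \<eta> 1) - F (p \<eta> 0) = integral {0..1} (\<lambda>s. of_real h * D (p \<eta> s))"
      by (rule integral_unique[symmetric])
    also have "\<dots> = integral {0..1} (\<lambda>s. (\<epsilon> * (3 / 2 * of_int c * of_real h)) * (N (p \<eta> s) * (jint (p \<eta> s) - k)))"
      by (rule arg_cong[where f = "integral {0..1}"]) (simp add: D_def fun_eq_iff mult_ac)
    finally show ?thesis by (simp only: integral_mult_right)
  qed
  \<comment> \<open>The defect of the formula at height \<open>\<eta>\<close>: zero for positive
    heights and continuous at 0, hence zero on the real line.\<close>
  define G where "G \<eta> = F (p \<eta> 1) - F (p \<eta> 0) - \<epsilon> * (3 / 2 * of_int c * of_real h) * integral {0..1} (\<lambda>s. N (p \<eta> s) * (jint (p \<eta> s) - k))" for \<eta>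
  have "continuous_on {0..1} (\<lambda>\<eta>. integral (cbox 0 1) (\<lambda>s. N (p \<eta> s) * (jint (p \<eta> s) - k)))"
  proof (rule integral_continuous_on_param)
    have "continuous_on ({0..1} \<times> cbox 0 1) (\<lambda>z. p (fst z) (snd z))"
      unfolding p_def by (intro continuous_intros)
    then have "continuous_on ({0..1} \<times> cbox 0 1) (\<lambda>z. N (p (fst z) (snd z)) * (jint (p (fst z) (snd z)) - k))"
      by (rule continuous_on_compose2[OF cint]) (use pR in auto)
    then show "continuous_on ({0..1} \<times> cbox 0 1) (\<lambda>(\<eta>, s). N (p \<eta> s) * (jint (p \<eta> s) - k))"
      by (simp add: case_prod_unfold)
  qed
  moreover have "continuous_on {0..1} (\<lambda>\<eta>. F (p \<eta> s))" if "s \<in> {0..1}" for s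
    by (rule continuous_on_compose2[OF cF]) (use pR that in \<open>auto simp: p_def intro!: continuous_intros\<close>)
  ultimately have cG: "continuous_on {0..1} G"
    unfolding G_def by (intro continuous_intros) auto
  have "(G \<longlongrightarrow> G 0) (at_right 0)"
    using continuous_on_Icc_at_rightD[OF cG] by simp
  moreover have "(G \<longlongrightarrow> 0) (at_right 0)"
    by (rule tendsto_eventually) (use eq in \<open>auto simp: G_def simp del: times_divide_eq_left intro!: eventually_at_rightI[of 0 1]\<close>)
  ultimately have "G 0 = 0" using tendsto_unique[OF trivial_limit_at_right_real] by blast
  then show ?thesis by (simp add: G_def)
qed

text \<open>With a positive denominator the principal complex roots become real square roots.
  Positivity at the two endpoints suffices because the denominator is affine.\<close>

lemma jint_mobius:
  fixes a b c d :: int and x h :: real and k \<epsilon> :: complex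
  assumes mult: "theta_multiplier a b c d \<epsilon>" and det: "a * d - b * c = 1"
    and pos: "of_int c * x + of_int d > 0" "of_int c * (x + h) + of_int d > 0"
  defines "j \<equiv> \<lambda>u::real. of_int c * u + of_int d"
  defines "g \<equiv> \<lambda>u::real. (of_int a * u + of_int b) / j u"
  shows "jline (g (x + h)) - jline (g x) =
    \<epsilon> * (of_real (sqrt (j (x + h)) / j (x + h) ^ 2) * (jline (x + h) - k)
        - of_real (sqrt (j x) / j x ^ 2) * (jline x - k)
        + of_real (3 / 2 * of_int c * h) * integral {0..1} (\<lambda>s. of_real (sqrt (j (x + s * h)) / j (x + s * h) ^ 3) * (jline (x + s * h) - k)))"
proof -
  have pos': "j (x + s * h) > 0" if "s \<in> {0..1}" for s
  proof -
    have "j (x + s * h) = (1 - s) * j x + s * j (x + h)" by (simp add: j_def algebra_simps)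
    moreover have "(1 - s) * j x + s * j (x + h) > 0"
    proof (cases "s = 0")
      case True
      then show ?thesis using pos by (simp add: j_def)
    next
      case False
      then have "s > 0" "1 - s \<ge> 0" using that by auto
      then show ?thesis using pos[folded j_def]
        by (intro add_nonneg_pos mult_nonneg_nonneg mult_pos_pos less_imp_le[of 0 "j x"]) (auto simp: j_def)
    qed
    ultimately show ?thesis by simp
  qed
  have J: "of_int c * of_real u + of_int d = complex_of_real (j u)" for u
    by (simp add: j_def)
  have G: "(of_int a * of_real u + of_int b) / complex_of_real (j u) = of_real (g u)" for u
    by (simp add: g_def)
  have Q: "csqrt (complex_of_real (j u)) = of_real (sqrt (j u))" if "j u > 0" for u
    using that by simp
  have q: "csqrt (complex_of_real (j (x + s * h))) = of_real (sqrt (j (x + s * h)))" if "s \<in> {0..1}" for s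
    using Q pos' that by blast
  note q0 = q[of 0, simplified] and q1 = q[of 1, simplified]
  have "integral {0..1} (\<lambda>s. csqrt (complex_of_real (j (x + s * h))) / complex_of_real (j (x + s * h)) ^ 3 * (jline (x + s * h) - k))
     = integral {0..1} (\<lambda>s. of_real (sqrt (j (x + s * h)) / j (x + s * h) ^ 3) * (jline (x + s * h) - k))"
    by (rule integral_cong) (use q in simp)
  note int_eq = this
  have "of_int c * (x + s * h) + of_int d > 0" if "s \<in> {0..1}" for s
    using pos'[OF that] by (simp add: j_def)
  note V = jint_mobius_vertical[OF mult det this, of k, unfolded of_real_0 mult_zero_right add_0_right J G mult_1 mult_zero_left]
  have "u - u' = e * (v - v' + t * i)" if "u - e * v - (u' - e * v') = e * t * i" for u u' v v' e t i :: complex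
    using that by (simp add: algebra_simps)
  note this[OF V[unfolded q0 q1 int_eq]]
  then show ?thesis by (simp only: of_real_divide of_real_power) simp
qed

section \<open>Behaviour at the cusp 0\<close>

text \<open>The oscillating part of \<open>jint\<close>: periodic with period 2 and bounded on the
  closed half-plane, with the bounded primitive \<open>josc2\<close>.\<close>

definition josc :: "complex \<Rightarrow> complex" where
  "josc \<tau> = (\<Sum>n. 2 * nome n \<tau> / ifreq n)"

definition josc2 :: "complex \<Rightarrow> complex" where
  "josc2 \<tau> = (\<Sum>n. 2 * nome n \<tau> / (ifreq n)\<^sup>2)"

lemma norm_josc_term_le:
  assumes "Im \<tau> \<ge> 0"
  shows "norm (2 * nome n \<tau> / ifreq n) \<le> 2 / freq n"
  using norm_nome_le_1[OF assms, of n] by (simp add: norm_mult norm_divide less_imp_le divide_right_mono)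

lemma freq_ge_1: "freq n \<ge> 1"
proof -
  have "1 * 1 \<le> pi * (real (Suc n))\<^sup>2"
    using pi_gt3 by (intro mult_mono) (auto simp: one_le_power)
  then show ?thesis by (simp add: freq_def)
qed

lemma norm_josc2_term_le:
  assumes "Im \<tau> \<ge> 0"
  shows "norm (2 * nome n \<tau> / (ifreq n)\<^sup>2) \<le> 2 / freq n"
proof -
  have "norm (2 * nome n \<tau> / (ifreq n)\<^sup>2)
      = norm (2 * nome n \<tau> / ifreq n) / freq n"
    by (simp add: norm_mult norm_divide power2_eq_square less_imp_le)
  also have "\<dots> \<le> 2 / freq n / 1"
    using norm_josc_term_le[OF assms, of n] freq_ge_1[of n] by (intro frac_le) auto
  finally show ?thesis by simp
qed

lemma summable_josc:
  assumes "Im \<tau> \<ge> 0"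
  shows "summable (\<lambda>n. 2 * nome n \<tau> / ifreq n)"
  by (rule summable_comparison_test'[OF summable_inverse_freq[of 2]])
     (use norm_josc_term_le[OF assms] in auto)

lemma summable_josc2:
  assumes "Im \<tau> \<ge> 0"
  shows "summable (\<lambda>n. 2 * nome n \<tau> / (ifreq n)\<^sup>2)"
  by (rule summable_comparison_test'[OF summable_inverse_freq[of 2]])
     (use norm_josc2_term_le[OF assms] in auto)

lemma jint_eq_josc:
  assumes "Im \<tau> \<ge> 0"
  shows "jint \<tau> = \<tau> + josc \<tau> - josc 0"
proof -
  have "(\<Sum>n. 2 * nome n \<tau> / ifreq n) - (\<Sum>n. 2 * nome n 0 / ifreq n)
    = (\<Sum>n. 2 * nome n \<tau> / ifreq n - 2 * nome n 0 / ifreq n)"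
    by (rule suminf_diff) (use summable_josc[OF assms] summable_josc[of 0] in auto)
  also have "\<dots> = (\<Sum>n. 2 * (nome n \<tau> - 1) / ifreq n)"
    by (simp add: nome_def right_diff_distrib diff_divide_distrib)
  finally show ?thesis by (simp add: jint_def josc_def)
qed

lemma continuous_on_josc: "continuous_on {\<tau>. Im \<tau> \<ge> 0} josc"
proof (rule continuous_on_eq)
  show "continuous_on {\<tau>. Im \<tau> \<ge> 0} (\<lambda>\<tau>. jint \<tau> - \<tau> + josc 0)"
    by (intro continuous_intros continuous_on_jint)
qed (use jint_eq_josc in auto)

lemma norm_josc2_le:
  assumes "Im \<tau> \<ge> 0"
  shows "norm (josc2 \<tau>) \<le> (\<Sum>n. 2 / freq n)"
  unfolding josc2_def
  by (rule norm_suminf_le[OF norm_josc2_term_le[OF assms] summable_inverse_freq])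

text \<open>The differentiated series converges uniformly on the closed half-plane, so the
  derivative is available at real points, where it is needed.\<close>

lemma has_field_derivative_josc2:
  assumes "Im \<tau> \<ge> 0"
  shows "(josc2 has_field_derivative josc \<tau>) (at \<tau> within {\<tau>. Im \<tau> \<ge> 0})"
proof -
  let ?S = "{\<tau>. Im \<tau> \<ge> 0}"
  obtain g where g: "\<And>\<tau>. \<tau> \<in> ?S \<Longrightarrow> (\<lambda>n. 2 * nome n \<tau> / (ifreq n)\<^sup>2) sums g \<tau>"
    "\<And>\<tau>. \<tau> \<in> ?S \<Longrightarrow> (g has_field_derivative josc \<tau>) (at \<tau> within ?S)"
  proof -
    have "\<exists>g. \<forall>\<tau>\<in>?S. (\<lambda>n. 2 * nome n \<tau> / (ifreq n)\<^sup>2) sums g \<tau> \<and>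
        (g has_field_derivative josc \<tau>) (at \<tau> within ?S)"
    proof (rule has_field_derivative_series)
      show "convex ?S" by (rule convex_halfspace_Im_ge)
      show "((\<lambda>\<tau>. 2 * nome n \<tau> / (ifreq n)\<^sup>2) has_field_derivative
          2 * nome n z / ifreq n) (at z within ?S)" for n z
        unfolding nome_def by (auto intro!: derivative_eq_intros simp: field_simps power2_eq_square)
      show "uniform_limit ?S (\<lambda>n x. \<Sum>i<n. 2 * nome i x / (\<i> * complex_of_real (freq i))) josc sequentially"
        unfolding josc_def by (rule Weierstrass_m_test[OF norm_josc_term_le summable_inverse_freq]) simp
      show "0 \<in> ?S" by simp
      show "summable (\<lambda>n. 2 * nome n 0 / (ifreq n)\<^sup>2)" by (rule summable_josc2) simp
    qed
    then show ?thesis using that by blast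
  qed
  have "josc2 z = g z" if "z \<in> ?S" for z
    using g(1)[OF that] by (simp add: josc2_def sums_iff)
  then show ?thesis
    by (intro has_field_derivative_transform_within[OF g(2) zero_less_one]) (use assms in auto)
qed

lemma josc2_of_real_has_vector_derivative:
  "((\<lambda>s. josc2 (of_real (x + s * h))) has_vector_derivative of_real h * josc (of_real (x + s * h))) (at s within A)"
proof -
  have "((\<lambda>s. complex_of_real (x + s * h)) has_vector_derivative of_real h) (at s within A)"
    by (auto intro!: derivative_eq_intros simp: scaleR_conv_of_real)
  moreover have "(josc2 has_field_derivative josc (of_real (x + s * h)))
      (at (of_real (x + s * h)) within (\<lambda>s. complex_of_real (x + s * h)) ` A)"
    by (rule has_field_derivative_subset[OF has_field_derivative_josc2]) auto
  ultimately show ?thesis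
    using field_vector_diff_chain_within[of "\<lambda>s. complex_of_real (x + s * h)" "of_real h" s A josc2] by (simp add: o_def)
qed

text \<open>What is kept of \<open>jint_mobius\<close> for the inversion with
  \<open>k = - josc 0\<close>: the boundary term, then 3/2 u^(-3/2) integrated to - 3 / sqrt u, then
  the \<open>josc\<close> part of the integral after one more integration by parts, which leaves
  \<open>josc2\<close>.\<close>

definition jmain :: "real \<Rightarrow> complex" where
  "jmain u = of_real (sqrt u / u ^ 2) * (of_real u + josc (of_real u)) - of_real (3 / sqrt u)
     + of_real (3 / 2 * (sqrt u / u ^ 3)) * josc2 (of_real u)"

text \<open>A second integration by parts. The discarded integrand is at most 15/4 u^(-7/2) times
  the bound of \<open>josc2\<close>; its integral is controlled by \<open>X\<close> alone, uniformly
  in \<open>Y\<close>, so \<open>Y\<close> may tend to infinity.\<close>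

lemma jint_inversion_increment:
  assumes "0 < X" "X \<le> Y"
  shows "norm (jline (- 1 / Y) - jline (- 1 / X) - cis (- pi / 4) * (jmain Y - jmain X))
     \<le> 3 / 2 * (\<Sum>n. 2 / freq n) / (X\<^sup>2 * sqrt X)"
proof -
  define h where "h = Y - X"
  define B where "B = (\<Sum>n. 2 / freq n)"
  have h0: "h \<ge> 0" using assms by (simp add: h_def)
  define u where "u s = X + s * h" for s
  have u_ge: "u s \<ge> X" if "s \<in> {0..1}" for s using that h0 by (simp add: u_def)
  then have u_pos: "u s > 0" if "s \<in> {0..1}" for s using that assms(1) by (meson less_le_trans)
  have u1: "u 1 = Y" and u0: "u 0 = X" by (simp_all add: u_def h_def)
  have B0: "B \<ge> 0" unfolding B_def by (rule suminf_nonneg[OF summable_inverse_freq]) (simp add: less_imp_le)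
  define f where "f s = of_real (sqrt (u s) / u s ^ 3) * (jline (u s) - (- josc 0))" for s
  \<comment> \<open>\<open>P\<close> is the explicit part, \<open>r\<close> the remainder in P' =
    3/2 h f - r, and \<open>\<phi>\<close> an antiderivative of the bound on the norm of
    \<open>r\<close>.\<close>
  define P where "P s = of_real (3 / 2 * (sqrt (u s) / u s ^ 3)) * josc2 (of_real (u s)) - of_real (3 / sqrt (u s))" for s
  define r where "r s = complex_of_real h * (of_real (15 / 4 * (sqrt (u s) / u s ^ 4)) * josc2 (of_real (u s)))" for s
  define \<phi> where "\<phi> s = - (3 / 2 * B) / ((u s)\<^sup>2 * sqrt (u s))" for s
  have du: "(u has_real_derivative h) (at s within {0..1})" for s
    unfolding u_def by (auto intro!: derivative_eq_intros)
  have dsq: "((\<lambda>s. sqrt (u s)) has_real_derivative h / (2 * sqrt (u s))) (at s within {0..1})" if "s \<in> {0..1}" for s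
    using DERIV_chain2[OF DERIV_real_sqrt[OF u_pos[OF that]] du] by (simp add: field_simps)
  have dP: "(P has_vector_derivative of_real (3 / 2 * h) * f s - r s) (at s within {0..1})" if s: "s \<in> {0..1}" for s
  proof -
    have p: "u s > 0" "sqrt (u s) \<noteq> 0" using u_pos[OF s] by auto
    have "((\<lambda>s. 3 / 2 * (sqrt (u s) / u s ^ 3)) has_real_derivative - (15 / 4) * h * (sqrt (u s) / u s ^ 4)) (at s within {0..1})"
    proof -
      define q where "q = sqrt (u s)"
      have q: "u s = q\<^sup>2" "q > 0" using p by (auto simp: q_def)
      have "((\<lambda>s. 3 / 2 * (sqrt (u s) / u s ^ 3)) has_real_derivative
        3 / 2 * ((h / (2 * sqrt (u s)) * u s ^ 3 - sqrt (u s) * (3 * u s ^ 2 * h)) / (u s ^ 3 * u s ^ 3))) (at s within {0..1})"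
        by (rule DERIV_cmult, rule DERIV_divide[OF dsq[OF s]]) (use p in \<open>auto intro!: derivative_eq_intros du\<close>)
      moreover have "3 / 2 * ((h / (2 * sqrt (u s)) * u s ^ 3 - sqrt (u s) * (3 * u s ^ 2 * h)) / (u s ^ 3 * u s ^ 3))
         = - (15 / 4) * h * (sqrt (u s) / u s ^ 4)"
        unfolding q_def[symmetric] q(1) using q(2) by (simp add: field_simps) (simp add: eval_nat_numeral)
      ultimately show ?thesis by simp
    qed
    then have "((\<lambda>s. complex_of_real (3 / 2 * (sqrt (u s) / u s ^ 3))) has_vector_derivative of_real (- (15 / 4) * h * (sqrt (u s) / u s ^ 4))) (at s within {0..1})"
      by (intro has_vector_derivative_of_real) (simp add: has_real_derivative_iff_has_vector_derivative)
    moreover have "((\<lambda>s. 3 / sqrt (u s)) has_real_derivative - (3 / 2 * h) * (sqrt (u s) / u s ^ 2)) (at s within {0..1})"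
    proof -
      define q where "q = sqrt (u s)"
      have q: "u s = q\<^sup>2" "q > 0" using p by (auto simp: q_def)
      have "((\<lambda>s. 3 / sqrt (u s)) has_real_derivative (0 * sqrt (u s) - 3 * (h / (2 * sqrt (u s)))) / (sqrt (u s) * sqrt (u s))) (at s within {0..1})"
        by (rule DERIV_divide[OF DERIV_const dsq[OF s]]) (use p in auto)
      moreover have "(0 * sqrt (u s) - 3 * (h / (2 * sqrt (u s)))) / (sqrt (u s) * sqrt (u s)) = - (3 / 2 * h) * (sqrt (u s) / u s ^ 2)"
        unfolding q_def[symmetric] q(1) using q(2) by (simp add: field_simps power2_eq_square)
      ultimately show ?thesis by simp
    qed
    then have "((\<lambda>s. complex_of_real (3 / sqrt (u s))) has_vector_derivative of_real (- (3 / 2 * h) * (sqrt (u s) / u s ^ 2))) (at s within {0..1})"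
      by (intro has_vector_derivative_of_real) (simp add: has_real_derivative_iff_has_vector_derivative)
    moreover have "((\<lambda>s. josc2 (of_real (u s))) has_vector_derivative of_real h * josc (of_real (u s))) (at s within {0..1})"
      unfolding u_def by (rule josc2_of_real_has_vector_derivative)
    ultimately have "(P has_vector_derivative
        of_real (3 / 2 * (sqrt (u s) / u s ^ 3)) * (of_real h * josc (of_real (u s)))
        + of_real (- (15 / 4) * h * (sqrt (u s) / u s ^ 4)) * josc2 (of_real (u s))
        - of_real (- (3 / 2 * h) * (sqrt (u s) / u s ^ 2))) (at s within {0..1})"
      unfolding P_def by (intro has_vector_derivative_diff has_vector_derivative_mult)
    also have "of_real (3 / 2 * (sqrt (u s) / u s ^ 3)) * (of_real h * josc (of_real (u s)))
        + of_real (- (15 / 4) * h * (sqrt (u s) / u s ^ 4)) * josc2 (of_real (u s))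
        - of_real (- (3 / 2 * h) * (sqrt (u s) / u s ^ 2)) = of_real (3 / 2 * h) * f s - r s"
    proof -
      have "sqrt (u s) / u s ^ 2 = sqrt (u s) / u s ^ 3 * u s" using p by (simp add: field_simps eval_nat_numeral)
      then have e: "complex_of_real (- (3 / 2 * h) * (sqrt (u s) / u s ^ 2)) = of_real (- (3 / 2 * h) * (sqrt (u s) / u s ^ 3 * u s))"
        by (simp only:)
      have "of_real (3 / 2 * a) * (of_real h * o1) + of_real (- (15 / 4) * h * b) * o2 - of_real (- (3 / 2 * h) * (a * v))
        = of_real (3 / 2 * h) * (of_real a * (of_real v + o1 - o0 - (- o0))) - of_real h * (of_real (15 / 4 * b) * o2)"
        for a b v :: real and o0 o1 o2 :: complex
        by (simp add: algebra_simps)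
      then show ?thesis
        unfolding f_def r_def e by (simp only: jint_eq_josc[of "of_real (u s)"] Im_complex_of_real order_refl)
    qed
    finally show ?thesis .
  qed
  have d\<phi>: "(\<phi> has_vector_derivative h * (15 / 4 * (sqrt (u s) / u s ^ 4)) * B) (at s within {0..1})" if s: "s \<in> {0..1}" for s
  proof -
    define q where "q = sqrt (u s)"
    have q: "u s = q\<^sup>2" "q > 0" using u_pos[OF s] by (auto simp: q_def)
    have "((\<lambda>s. (u s)\<^sup>2 * sqrt (u s)) has_real_derivative 2 * u s * h * sqrt (u s) + (u s)\<^sup>2 * (h / (2 * sqrt (u s)))) (at s within {0..1})"
      by (rule DERIV_cong[OF DERIV_mult[OF DERIV_power[OF du] dsq[OF s]]]) (simp add: mult_ac)
    then have "(\<phi> has_real_derivative (0 * ((u s)\<^sup>2 * sqrt (u s)) - (- (3 / 2 * B)) * (2 * u s * h * sqrt (u s) + (u s)\<^sup>2 * (h / (2 * sqrt (u s)))))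
        / ((u s)\<^sup>2 * sqrt (u s) * ((u s)\<^sup>2 * sqrt (u s)))) (at s within {0..1})"
      unfolding \<phi>_def by (rule DERIV_divide[OF DERIV_const]) (use u_pos[OF s] in auto)
    moreover have "(0 * ((u s)\<^sup>2 * sqrt (u s)) - (- (3 / 2 * B)) * (2 * u s * h * sqrt (u s) + (u s)\<^sup>2 * (h / (2 * sqrt (u s)))))
        / ((u s)\<^sup>2 * sqrt (u s) * ((u s)\<^sup>2 * sqrt (u s))) = h * (15 / 4 * (sqrt (u s) / u s ^ 4)) * B"
      unfolding q_def[symmetric] q(1) using q(2) by (simp add: field_simps) (simp add: eval_nat_numeral)
    ultimately show ?thesis by (simp add: has_real_derivative_iff_has_vector_derivative)
  qed
  have cf: "continuous_on {0..1} f"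
    unfolding f_def
    by (intro continuous_intros continuous_on_compose2[OF continuous_on_jint])
       (use u_pos in \<open>fastforce simp: u_def intro!: continuous_intros\<close>)+
  have fint: "((\<lambda>s. of_real (3 / 2 * h) * f s) has_integral of_real (3 / 2 * h) * integral {0..1} f) {0..1}"
    by (intro has_integral_mult_right integrable_integral integrable_continuous_real cf)
  have "((\<lambda>s. of_real (3 / 2 * h) * f s - r s) has_integral P 1 - P 0) {0..1}"
    by (rule fundamental_theorem_of_calculus[OF zero_le_one dP])
  from has_integral_diff[OF fint this]
  have rint: "(r has_integral of_real (3 / 2 * h) * integral {0..1} f - (P 1 - P 0)) {0..1}" by simp
  have \<phi>int: "((\<lambda>s. h * (15 / 4 * (sqrt (u s) / u s ^ 4)) * B) has_integral \<phi> 1 - \<phi> 0) {0..1}"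
    by (rule fundamental_theorem_of_calculus[OF zero_le_one d\<phi>])
  have "norm (integral {0..1} r) \<le> integral {0..1} (\<lambda>s. h * (15 / 4 * (sqrt (u s) / u s ^ 4)) * B)"
  proof (rule integral_norm_bound_integral)
    show "r integrable_on {0..1}" "(\<lambda>s. h * (15 / 4 * (sqrt (u s) / u s ^ 4)) * B) integrable_on {0..1}"
      using rint \<phi>int by blast+
    fix s :: real assume s: "s \<in> {0..1}"
    have "norm (r s) = h * (15 / 4 * (sqrt (u s) / u s ^ 4)) * norm (josc2 (of_real (u s)))"
      unfolding r_def norm_mult norm_of_real using h0 u_pos[OF s] by simp
    also have "\<dots> \<le> h * (15 / 4 * (sqrt (u s) / u s ^ 4)) * B"
      unfolding B_def using h0 u_pos[OF s] by (intro mult_left_mono norm_josc2_le) auto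
    finally show "norm (r s) \<le> h * (15 / 4 * (sqrt (u s) / u s ^ 4)) * B" .
  qed
  then have "norm (of_real (3 / 2 * h) * integral {0..1} f - (P 1 - P 0)) \<le> \<phi> 1 - \<phi> 0"
    using integral_unique[OF rint] integral_unique[OF \<phi>int] by simp
  also have "\<dots> \<le> 3 / 2 * B / (X\<^sup>2 * sqrt X)"
    unfolding \<phi>_def u1 u0 using B0 assms by simp
  finally have bound: "norm (of_real (3 / 2 * h) * integral {0..1} f - (P 1 - P 0)) \<le> 3 / 2 * B / (X\<^sup>2 * sqrt X)" .
  have "jline (- 1 / Y) - jline (- 1 / X) = cis (- pi / 4) *
      (of_real (sqrt Y / Y ^ 2) * (jline Y - (- josc 0)) - of_real (sqrt X / X ^ 2) * (jline X - (- josc 0))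
       + of_real (3 / 2 * h) * integral {0..1} f)"
    unfolding f_def u_def
    using jint_mobius[OF theta_multiplier_inversion, of X h "- josc 0",
        unfolded of_int_1 of_int_0 of_int_minus mult_1 mult_1_right mult_zero_left add_0_right add_0_left] assms
    by (simp only: h_def) (simp add: mult_ac)
  then have increment: "jline (- 1 / Y) - jline (- 1 / X) = cis (- pi / 4) *
      (of_real (sqrt Y / Y ^ 2) * (of_real Y + josc (of_real Y) - josc 0 - (- josc 0))
       - of_real (sqrt X / X ^ 2) * (of_real X + josc (of_real X) - josc 0 - (- josc 0))
       + of_real (3 / 2 * h) * integral {0..1} f)"
    by (simp only: jint_eq_josc[of "of_real X"] jint_eq_josc[of "of_real Y"] Im_complex_of_real order_refl)
  have "P - Q - e * (ay * (y + jy) - t + w - (ax * (x + jx) - t' + w')) = e * (i - (w - t - (w' - t')))"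
    if "P - Q = e * (ay * (y + jy - o0 - (- o0)) - ax * (x + jx - o0 - (- o0)) + i)"
    for P Q e ay ax y x jy jx o0 t t' w w' i :: complex
    unfolding that by (simp add: algebra_simps)
  from this[OF increment]
  have "jline (- 1 / Y) - jline (- 1 / X) - cis (- pi / 4) * (jmain Y - jmain X)
    = cis (- pi / 4) * (of_real (3 / 2 * h) * integral {0..1} f - (P 1 - P 0))"
    unfolding P_def u1 u0 jmain_def .
  then show ?thesis using bound by (simp add: norm_mult B_def)
qed

lemma jmain_expand: "jmain u = of_real (sqrt u / u ^ 2 * u) + of_real (sqrt u / u ^ 2) * josc (of_real u) - of_real (3 / sqrt u)
     + of_real (3 / 2 * (sqrt u / u ^ 3)) * josc2 (of_real u)"
  by (simp only: jmain_def distrib_left of_real_mult)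

lemma jmain_tendsto_0: "(jmain \<longlongrightarrow> 0) at_top"
proof -
  have b1: "Bfun (\<lambda>u::real. josc (of_real u)) at_top"
    unfolding josc_def
    by (rule BfunI[of _ "\<Sum>n. 2 / freq n"], intro always_eventually allI norm_suminf_le norm_josc_term_le summable_inverse_freq) auto
  have b2: "Bfun (\<lambda>u::real. josc2 (of_real u)) at_top"
    by (rule BfunI[of _ "\<Sum>n. 2 / freq n"], intro always_eventually allI norm_josc2_le) auto
  have z: "((\<lambda>u. complex_of_real (w u) * B u) \<longlongrightarrow> 0) at_top" if "(w \<longlongrightarrow> 0) at_top" "Bfun B at_top" for w B
  proof -
    have "Zfun (\<lambda>u. complex_of_real (w u)) at_top"
      using tendsto_of_real[OF that(1), where 'a = complex] by (simp add: tendsto_Zfun_iff)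
    from bounded_bilinear.Zfun_prod_Bfun[OF bounded_bilinear_mult this that(2)] show ?thesis
      by (simp add: tendsto_Zfun_iff)
  qed
  have "((\<lambda>u. of_real (sqrt u / u ^ 2 * u) + of_real (sqrt u / u ^ 2) * josc (of_real u) - of_real (3 / sqrt u)
     + of_real (3 / 2 * (sqrt u / u ^ 3)) * josc2 (of_real u)) \<longlongrightarrow> of_real 0 + 0 - of_real 0 + 0) at_top"
    by (intro tendsto_add tendsto_diff z b1 b2 tendsto_of_real; real_asymp)
  then show ?thesis unfolding jmain_expand by simp
qed

text \<open>Sends one endpoint of the inversion to infinity, whose image is the cusp 0, with
  \<open>h = 1 / X\<close>. The coefficient 2 is 3 - 1: in \<open>jmain\<close> the linear term of
  \<open>jint\<close> gives sqrt h and the integral - 3 sqrt h. The \<open>josc2\<close> term has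
  the order of the error and doubles the constant to \<open>3 * B\<close>.\<close>

lemma jint_near_zero_left:
  obtains C where "\<And>h. 0 < h \<Longrightarrow> h \<le> 1 \<Longrightarrow>
    norm (- jline (- h) - cis (- pi / 4) * (of_real (2 * sqrt h) - of_real (h * sqrt h) * josc (of_real (1 / h)))) \<le> C * (h\<^sup>2 * sqrt h)"
proof -
  define B where "B = (\<Sum>n. 2 / freq n)"
  have main: "norm (- jline (- 1 / X) + cis (- pi / 4) * jmain X) \<le> 3 / 2 * B / (X\<^sup>2 * sqrt X)" if X: "X > 0" for X
  proof (rule tendsto_upperbound)
    have "((\<lambda>Y. jline (- 1 / Y)) \<longlongrightarrow> jline 0) at_top"
    proof (rule continuous_on_tendsto_compose[OF continuous_on_jint])
      show "((\<lambda>Y. complex_of_real (- 1 / Y)) \<longlongrightarrow> of_real 0) at_top"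
        by (rule tendsto_of_real) real_asymp
    qed auto
    then have "((\<lambda>Y. norm (jline (- 1 / Y) - jline (- 1 / X) - cis (- pi / 4) * (jmain Y - jmain X)))
       \<longlongrightarrow> norm (jline 0 - jline (- 1 / X) - cis (- pi / 4) * (0 - jmain X))) at_top"
      by (intro tendsto_intros jmain_tendsto_0)
    then show "((\<lambda>Y. norm (jline (- 1 / Y) - jline (- 1 / X) - cis (- pi / 4) * (jmain Y - jmain X)))
       \<longlongrightarrow> norm (- jline (- 1 / X) + cis (- pi / 4) * jmain X)) at_top" by simp
    show "\<forall>\<^sub>F Y in at_top. norm (jline (- 1 / Y) - jline (- 1 / X) - cis (- pi / 4) * (jmain Y - jmain X))
       \<le> 3 / 2 * B / (X\<^sup>2 * sqrt X)"
      using eventually_ge_at_top[of X] by eventually_elim (unfold B_def, rule jint_inversion_increment[OF X])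
  qed simp
  show ?thesis
  proof (rule that[of "3 * B"])
    fix h :: real assume h: "0 < h" "h \<le> 1"
    define X where "X = 1 / h"
    define q where "q = sqrt h"
    have q: "h = q\<^sup>2" "q > 0" using h by (auto simp: q_def)
    have X: "X > 0" "sqrt X = 1 / q" "X = 1 / q\<^sup>2"
      using h by (simp_all add: X_def q_def real_sqrt_divide)
    define w where "w = cis (- pi / 4) * (of_real (3 / 2 * (sqrt X / X ^ 3)) * josc2 (of_real X))"
    have "norm w \<le> 3 / 2 * (sqrt X / X ^ 3) * B"
    proof -
      have nonneg: "0 \<le> 3 / 2 * (sqrt X / X ^ 3)" using X(1) by simp
      have "norm w = \<bar>3 / 2 * (sqrt X / X ^ 3)\<bar> * norm (josc2 (of_real X))"
        unfolding w_def norm_mult norm_of_real norm_cis mult_1 ..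
      also have "\<dots> \<le> 3 / 2 * (sqrt X / X ^ 3) * B"
        unfolding B_def abs_of_nonneg[OF nonneg] by (rule mult_left_mono[OF norm_josc2_le nonneg]) simp
      finally show ?thesis .
    qed
    also have "sqrt X / X ^ 3 = h\<^sup>2 * sqrt h"
      using q(2) unfolding q_def[symmetric] X(2) unfolding X(3) q(1) by (simp add: field_simps eval_nat_numeral)
    finally have w: "norm w \<le> 3 / 2 * (h\<^sup>2 * sqrt h) * B" .
    have e1: "sqrt X / X ^ 2 = h * sqrt h" "sqrt X / X ^ 2 * X = sqrt h" "3 / sqrt X = 3 * sqrt h" "1 / (X\<^sup>2 * sqrt X) = h\<^sup>2 * sqrt h"
      using q(2) unfolding q_def[symmetric] X(2) unfolding X(3) q(1) by (simp_all add: field_simps eval_nat_numeral)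
    have cj: "cis (- pi / 4) * jmain X = - (cis (- pi / 4) * (of_real (2 * sqrt h) - of_real (h * sqrt h) * josc (of_real X))) + w"
      unfolding jmain_expand e1(2) unfolding e1 w_def by (simp only: of_real_mult of_real_numeral) (simp add: algebra_simps)
    have inv: "- 1 / X = - h" "1 / h = X" by (simp_all add: X_def)
    have "- jline (- h) - cis (- pi / 4) * (of_real (2 * sqrt h) - of_real (h * sqrt h) * josc (of_real (1 / h)))
      = (- jline (- 1 / X) + cis (- pi / 4) * jmain X) - w"
    proof -
      have "a - b = (a + (- b + w)) - w" for a b :: complex by simp
      then show ?thesis unfolding cj inv .
    qed
    also have "norm \<dots> \<le> norm (- jline (- 1 / X) + cis (- pi / 4) * jmain X) + norm w"
      by (rule norm_triangle_ineq4)
    also have "\<dots> \<le> 3 / 2 * B * (1 / (X\<^sup>2 * sqrt X)) + 3 / 2 * (h\<^sup>2 * sqrt h) * B"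
      by (rule add_mono[OF _ w]) (use main[OF X(1)] in simp)
    also have "\<dots> = 3 * B * (h\<^sup>2 * sqrt h)" unfolding e1 by simp
    finally show "norm (- jline (- h) - cis (- pi / 4) * (of_real (2 * sqrt h) - of_real (h * sqrt h) * josc (of_real (1 / h)))) \<le> 3 * B * (h\<^sup>2 * sqrt h)" .
  qed
qed

lemma jint_neg_real: "jline (- x) = - cnj (jline x)"
  using cnj_jint[of "of_real x"] by simp

lemma jint_near_zero:
  obtains C where "\<And>h. 0 < h \<Longrightarrow> h \<le> 1 \<Longrightarrow>
    norm (jline h - cis (pi / 4) * (of_real (2 * sqrt h) - of_real (h * sqrt h) * cnj (josc (of_real (1 / h))))) \<le> C * (h\<^sup>2 * sqrt h)"
proof -
  obtain C where C: "\<And>h. 0 < h \<Longrightarrow> h \<le> 1 \<Longrightarrow>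
    norm (- jline (- h) - cis (- pi / 4) * (of_real (2 * sqrt h) - of_real (h * sqrt h) * josc (of_real (1 / h)))) \<le> C * (h\<^sup>2 * sqrt h)"
    using jint_near_zero_left by blast
  have "norm (jline h - cis (pi / 4) * (of_real (2 * sqrt h) - of_real (h * sqrt h) * cnj (josc (of_real (1 / h))))) \<le> C * (h\<^sup>2 * sqrt h)"
    if "0 < h" "h \<le> 1" for h
  proof -
    have "jline h - cis (pi / 4) * (of_real (2 * sqrt h) - of_real (h * sqrt h) * cnj (josc (of_real (1 / h))))
      = cnj (- jline (- h) - cis (- pi / 4) * (of_real (2 * sqrt h) - of_real (h * sqrt h) * josc (of_real (1 / h))))"
      unfolding jint_neg_real by (simp add: cis_cnj)
    then show ?thesis using C[OF that] by (simp only: complex_mod_cnj)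
  qed
  then show ?thesis using that by blast
qed

section \<open>Behaviour at the cusp 1\<close>

text \<open>Index 2 n + 1 stands for the frequency k = 2 (n + 1), and doubling k quadruples
  k^2.\<close>

lemma nome_double_index: "nome (2 * n + 1) \<tau> = nome n (4 * \<tau>)"
  and freq_double_index: "freq (2 * n + 1) = 4 * freq n"
proof -
  have "real (Suc (2 * n + 1)) = 2 * real (Suc n)" by simp
  then show f: "freq (2 * n + 1) = 4 * freq n" unfolding freq_def by (simp only: power_mult_distrib) simp
  show "nome (2 * n + 1) \<tau> = nome n (4 * \<tau>)" unfolding nome_def f by (simp add: mult_ac)
qed

lemma josc_odd_terms_sums:
  assumes "Im \<tau> \<ge> 0"
  shows "(\<lambda>n. if odd n then 2 * nome n \<tau> / ifreq n else 0) sums (josc (4 * \<tau>) / 4)"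
proof -
  let ?f = "\<lambda>n. if odd n then 2 * nome n \<tau> / ifreq n else 0"
  have "(\<lambda>n. 2 * nome n (4 * \<tau>) / ifreq n) sums josc (4 * \<tau>)"
    unfolding josc_def by (rule summable_sums, rule summable_josc) (use assms in simp)
  then have "(\<lambda>n. 2 * nome n (4 * \<tau>) / ifreq n / 4) sums (josc (4 * \<tau>) / 4)"
    by (rule sums_divide)
  moreover have "2 * nome n (4 * \<tau>) / ifreq n / 4 = ?f (2 * n + 1)" for n
    unfolding nome_double_index freq_double_index by simp
  ultimately have "(\<lambda>n. ?f (2 * n + 1)) sums (josc (4 * \<tau>) / 4)" by (simp only:)
  then show ?thesis
    by (subst (asm) sums_mono_reindex) (auto simp: strict_mono_def elim!: oddE)
qed

lemma nome_add_one: "nome n (1 + \<tau>) = (if odd n then nome n \<tau> else - nome n \<tau>)"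
proof -
  have "nome n (1 + \<tau>) = exp (ifreq n) * nome n \<tau>"
    unfolding nome_def by (simp add: exp_add[symmetric] algebra_simps)
  also have "exp (ifreq n) = cis pi ^ (Suc n)\<^sup>2"
    unfolding Complex.DeMoivre by (simp add: cis_conv_exp freq_def mult_ac)
  also have "\<dots> = (if odd n then 1 else - 1)" by simp
  finally show ?thesis by simp
qed

text \<open>A unit shift multiplies the k-th term by (- 1)^k. Flipping the odd frequencies means
  subtracting the series from twice its even part, and the even part is a quarter of the series at 4
  \<tau>.\<close>

lemma josc_add_one:
  assumes "Im \<tau> \<ge> 0"
  shows "josc (1 + \<tau>) = josc (4 * \<tau>) / 2 - josc \<tau>"
proof -
  let ?t = "\<lambda>n. 2 * nome n \<tau> / ifreq n"
  have "(\<lambda>n. 2 * (if odd n then ?t n else 0) - ?t n) sums (2 * (josc (4 * \<tau>) / 4) - josc \<tau>)"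
    by (intro sums_diff sums_mult josc_odd_terms_sums[OF assms])
       (use summable_josc[OF assms] in \<open>simp add: josc_def summable_sums\<close>)
  also have "(\<lambda>n. 2 * (if odd n then ?t n else 0) - ?t n) = (\<lambda>n. 2 * nome n (1 + \<tau>) / ifreq n)"
    by (auto simp: nome_add_one fun_eq_iff)
  finally show ?thesis by (simp add: josc_def sums_iff)
qed

text \<open>Reduces the cusp 1 to two expansions at the cusp 0.\<close>

lemma jint_add_one:
  assumes "Im \<tau> \<ge> 0"
  shows "jint (1 + \<tau>) - jint 1 = jint (4 * \<tau>) / 2 - jint \<tau>"
proof -
  have "josc 1 = josc 0 / 2 - josc 0" using josc_add_one[of 0] by simp
  then show ?thesis
    using assms by (simp add: jint_eq_josc josc_add_one field_simps)
qed

text \<open>The part of \<open>josc\<close> with odd frequencies k, that is with even index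
  n.\<close>

definition jodd :: "complex \<Rightarrow> complex" where
  "jodd \<tau> = josc \<tau> - josc (4 * \<tau>) / 4"

lemma jodd_add_even: "jodd (\<tau> + 2 * of_int k) = jodd \<tau>"
proof -
  have "4 * (\<tau> + 2 * of_int k) = 4 * \<tau> + 2 * of_int (4 * k)" by simp
  then show ?thesis unfolding jodd_def josc_def by (simp only: nome_add_even)
qed

lemma jodd_sums:
  assumes "Im \<tau> \<ge> 0"
  shows "(\<lambda>n. if even n then 2 * nome n \<tau> / ifreq n else 0) sums jodd \<tau>"
proof -
  let ?t = "\<lambda>n. 2 * nome n \<tau> / ifreq n"
  have "(\<lambda>n. ?t n - (if odd n then ?t n else 0)) sums (josc \<tau> - josc (4 * \<tau>) / 4)"
    by (intro sums_diff josc_odd_terms_sums[OF assms])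
       (use summable_josc[OF assms] in \<open>simp add: josc_def summable_sums\<close>)
  also have "(\<lambda>n. ?t n - (if odd n then ?t n else 0)) = (\<lambda>n. if even n then ?t n else 0)"
    by auto
  finally show ?thesis by (simp only: jodd_def)
qed

text \<open>The Basel sum without its even-frequency quarter: 2 / pi * (pi^2 / 6) * (3 / 4).\<close>

lemma inverse_freq_even_sums: "(\<lambda>n. if even n then 2 / freq n else 0) sums (pi / 4)"
proof -
  have tot: "(\<lambda>n. 2 / freq n) sums (2 / pi * (pi\<^sup>2 / 6))"
    using sums_mult[OF inverse_squares_sums, of "2 / pi"] by (simp add: freq_def field_simps)
  have "(\<lambda>n. 2 / freq n / 4) sums (2 / pi * (pi\<^sup>2 / 6) / 4)"
    by (rule sums_divide[OF tot])
  moreover have "2 / freq n / 4 = (if odd (2 * n + 1) then 2 / freq (2 * n + 1) else 0)" for n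
    unfolding freq_double_index by simp
  ultimately have "(\<lambda>n. if odd (2 * n + 1) then 2 / freq (2 * n + 1) else 0) sums (2 / pi * (pi\<^sup>2 / 6) / 4)"
    by (simp only:)
  then have "(\<lambda>n. if odd n then 2 / freq n else 0) sums (2 / pi * (pi\<^sup>2 / 6) / 4)"
    by (subst (asm) sums_mono_reindex[where f = "\<lambda>n. if odd n then 2 / freq n else 0"])
       (simp add: strict_mono_def, metis oddE rangeI, assumption)
  from sums_diff[OF tot this]
  have "(\<lambda>n. 2 / freq n - (if odd n then 2 / freq n else 0)) sums (2 / pi * (pi\<^sup>2 / 6) - 2 / pi * (pi\<^sup>2 / 6) / 4)" .
  also have "(\<lambda>n. 2 / freq n - (if odd n then 2 / freq n else 0)) = (\<lambda>n. if even n then 2 / freq n else 0)"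
    by auto
  also have "2 / pi * (pi\<^sup>2 / 6) - 2 / pi * (pi\<^sup>2 / 6) / 4 = pi / 4"
    by (simp add: field_simps power2_eq_square)
  finally show ?thesis .
qed

lemma norm_jodd_le: "norm (jodd (of_real y)) \<le> pi / 4"
proof -
  have "norm (suminf (\<lambda>n. if even n then 2 * nome n (of_real y) / ifreq n else 0)) \<le>
     suminf (\<lambda>n. if even n then 2 / freq n else 0)"
    by (rule norm_suminf_le) (use norm_josc_term_le[of "of_real y"] inverse_freq_even_sums in \<open>auto simp: sums_iff\<close>)
  then show ?thesis
    using jodd_sums[of "of_real y"] inverse_freq_even_sums by (simp add: sums_iff)
qed

text \<open>The \<open>n = 0\<close> term dominates, so \<open>jodd\<close> winds around the origin like \<open>cis (pi * y)\<close>.\<close>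

lemma jodd_dominant_term: "norm (jodd (of_real y) - 2 * cis (pi * y) / (\<i> * pi)) \<le> pi / 4 - 2 / pi"
proof -
  let ?t = "\<lambda>n. if even n then 2 * nome n (of_real y) / ifreq n else 0"
  let ?c = "\<lambda>n. if even n then 2 / freq n else 0"
  have "(\<lambda>n. ?t (n + 1)) sums (jodd (of_real y) - (\<Sum>n<1. ?t n))"
    by (rule sums_split_initial_segment[OF jodd_sums]) simp
  moreover have "(\<lambda>n. ?c (n + 1)) sums (pi / 4 - (\<Sum>n<1. ?c n))"
    by (rule sums_split_initial_segment[OF inverse_freq_even_sums])
  moreover have "norm (?t (n + 1)) \<le> ?c (n + 1)" for n
    using norm_josc_term_le[of "of_real y" "n + 1"] by simp
  then have "norm (suminf (\<lambda>n. ?t (n + 1))) \<le> suminf (\<lambda>n. ?c (n + 1))"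
    using calculation(2) by (intro norm_suminf_le) (auto simp: sums_iff)
  moreover have "?t 0 = 2 * cis (pi * y) / (\<i> * pi)" "?c 0 = 2 / pi"
    by (simp_all add: nome_def freq_def cis_conv_exp mult.assoc)
  ultimately show ?thesis by (simp add: sums_iff)
qed

text \<open>Divided by its first term, \<open>jodd\<close> stays in the unit disc about 1, because
  (pi/4 - 2/pi) * pi/2 = pi^2/8 - 1 < 1. Its argument thus follows that of the first term within pi
  / 2, and the intermediate value theorem produces every direction.\<close>

lemma jodd_direction:
  assumes "norm u = 1"
  obtains y C where "C > 0" "jodd (of_real y) = of_real C * u"
proof -
  define W where "W y = jodd (of_real y) * (\<i> * pi / 2) * cis (- pi * y)" for y :: real
  have cj: "continuous_on UNIV (\<lambda>y. jodd (complex_of_real y))"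
    unfolding jodd_def by (intro continuous_intros continuous_on_compose2[OF continuous_on_josc]) auto
  have cW: "continuous_on UNIV W" unfolding W_def by (intro continuous_intros cj)
  have W1: "norm (W y - 1) < 1" for y
  proof -
    have c: "cis (pi * y) * cis (- pi * y) = 1" by (simp add: cis_mult)
    have "W y - 1 = (jodd (of_real y) - 2 * cis (pi * y) / (\<i> * pi)) * (\<i> * pi / 2) * cis (- pi * y)"
    proof -
      have "2 * cis (pi * y) / (\<i> * pi) * (\<i> * pi / 2) * cis (- pi * y) = cis (pi * y) * cis (- pi * y)" by simp
      then show ?thesis unfolding W_def c by (simp only: left_diff_distrib)
    qed
    then have "norm (W y - 1) = norm (jodd (of_real y) - 2 * cis (pi * y) / (\<i> * pi)) * (pi / 2)"
      by (simp only: norm_mult norm_divide norm_cis norm_of_real norm_ii) simp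
    also have "\<dots> \<le> (pi / 4 - 2 / pi) * (pi / 2)"
      by (intro mult_right_mono jodd_dominant_term) simp
    also have "\<dots> = pi * pi / 8 - 1" by (simp add: field_simps)
    also have "pi * pi < 4 * 4" using pi_less_4 pi_gt_zero by (intro mult_strict_mono) auto
    then have "pi * pi / 8 - 1 < 1" by simp
    finally show ?thesis .
  qed
  have ReW: "Re (W y) > 0" for y
    using W1[of y] abs_Re_le_cmod[of "W y - 1"] by simp
  have Wnz: "W y \<notin> \<real>\<^sub>\<le>\<^sub>0" "W y \<noteq> 0" for y
    using ReW[of y] by (auto simp: complex_nonpos_Reals_iff)
  \<comment> \<open>A continuous determination of the argument of
    \<open>cis (pi * y) * W y\<close>.\<close>
  define g where "g y = pi * y + Im (Ln (W y))" for y
  have cg: "continuous_on S g" for S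
    unfolding g_def using continuous_on_subset[OF cW, of S] Wnz by (intro continuous_intros) auto
  \<comment> \<open>The factor i comes from clearing the denominator \<open>\<i> * pi\<close> of the
    first term.\<close>
  define \<beta> where "\<beta> = Arg (\<i> * u)"
  have ImLn: "\<bar>Im (Ln (W y))\<bar> < pi / 2" for y
    using Re_Ln_pos_lt[OF Wnz(2)] ReW by auto
  \<comment> \<open>Half a unit of y on either side moves pi * y by pi / 2, more than the argument
    of \<open>W\<close> can compensate.\<close>
  have "\<exists>y\<ge>\<beta> / pi - 1/2. y \<le> \<beta> / pi + 1/2 \<and> g y = \<beta>"
  proof (rule IVT')
    show "g (\<beta> / pi - 1/2) \<le> \<beta>" using ImLn[of "\<beta> / pi - 1/2"] by (simp add: g_def algebra_simps)
    show "\<beta> \<le> g (\<beta> / pi + 1/2)" using ImLn[of "\<beta> / pi + 1/2"] by (simp add: g_def algebra_simps)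
  qed (use cg in auto)
  then obtain y where y: "g y = \<beta>" by blast
  have "W y = of_real (norm (W y)) * cis (Im (Ln (W y)))"
    using rcis_cmod_Arg[of "W y"] by (simp add: rcis_def Arg_eq_Im_Ln[OF Wnz(2)])
  then have "cis (pi * y) * W y = of_real (norm (W y)) * cis (g y)"
    by (metis (no_types, lifting) cis_mult g_def mult.left_commute)
  also have "cis (g y) = \<i> * u"
    unfolding y \<beta>_def using assms by (subst cis_Arg) (auto simp: sgn_div_norm norm_mult)
  also have "cis (pi * y) * W y = jodd (of_real y) * (\<i> * pi / 2)"
  proof -
    have "cis (pi * y) * cis (- pi * y) = 1" by (simp add: cis_mult)
    then show ?thesis unfolding W_def by (metis (no_types, lifting) mult.left_commute mult.right_neutral mult.commute)
  qed
  finally have "jodd (of_real y) = of_real (2 / pi * norm (W y)) * u"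
    by (simp add: field_simps)
  moreover have "2 / pi * norm (W y) > 0" using Wnz(2)[of y] by simp
  ultimately show ?thesis using that by blast
qed

text \<open>In \<open>jline (4 * h) / 2 - jline h\<close> the square root terms cancel since sqrt (4
  h) = 2 sqrt h; the next ones combine to \<open>jodd\<close> at 1 / (4 h). The error constant 17 C
  is 32 C / 2 + C, and the range of \<open>h\<close> ensures 4 h \<le> 1.\<close>

lemma jint_near_one:
  obtains C where "\<And>h. 0 < h \<Longrightarrow> h \<le> 1/4 \<Longrightarrow>
    norm (jline (1 + h) - jint 1 + 4 * cis (pi / 4) * of_real (h * sqrt h) * cnj (jodd (of_real (1 / (4 * h)))))
      \<le> C * (h\<^sup>2 * sqrt h)"
proof -
  obtain C where C: "\<And>h. 0 < h \<Longrightarrow> h \<le> 1 \<Longrightarrow>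
    norm (jline h - cis (pi / 4) * (of_real (2 * sqrt h) - of_real (h * sqrt h) * cnj (josc (of_real (1 / h))))) \<le> C * (h\<^sup>2 * sqrt h)"
    using jint_near_zero by blast
  have "norm (jline (1 + h) - jint 1 + 4 * cis (pi / 4) * of_real (h * sqrt h) * cnj (jodd (of_real (1 / (4 * h)))))
      \<le> 17 * C * (h\<^sup>2 * sqrt h)" if h: "0 < h" "h \<le> 1/4" for h
  proof -
    define J where "J = cnj (josc (of_real (1 / h)))"
    define J4 where "J4 = cnj (josc (of_real (1 / (4 * h))))"
    define e where "e h = jline h - cis (pi / 4) * (of_real (2 * sqrt h) - of_real (h * sqrt h) * cnj (josc (of_real (1 / h))))" for h
    have s4: "sqrt (4 * h) = 2 * sqrt h" by (simp add: real_sqrt_mult)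
    have a1: "jline (1 + h) - jint 1 = jline (4 * h) / 2 - jline h"
      using jint_add_one[of "of_real h"] by simp
    have a2: "cnj (jodd (of_real (1 / (4 * h)))) = J4 - J / 4"
      using h by (simp add: jodd_def J_def J4_def)
    have a3: "jline (4 * h) = e (4 * h) + cis (pi / 4) * (of_real (4 * sqrt h) - of_real (8 * (h * sqrt h)) * J4)"
      unfolding e_def s4 J4_def by simp
    have a4: "jline h = e h + cis (pi / 4) * (of_real (2 * sqrt h) - of_real (h * sqrt h) * J)"
      unfolding e_def J_def by simp
    have "jline (1 + h) - jint 1 + 4 * cis (pi / 4) * of_real (h * sqrt h) * cnj (jodd (of_real (1 / (4 * h))))
       = e (4 * h) / 2 - e h"
      unfolding a1 a2 a3 a4 by (simp add: algebra_simps add_divide_distrib diff_divide_distrib)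
    also have "norm \<dots> \<le> norm (e (4 * h) / 2) + norm (e h)" by (rule norm_triangle_ineq4)
    also have "\<dots> \<le> C * ((4 * h)\<^sup>2 * sqrt (4 * h)) / 2 + C * (h\<^sup>2 * sqrt h)"
      using C[of h] C[of "4 * h"] h unfolding e_def[symmetric] by simp
    also have "\<dots> = 17 * C * (h\<^sup>2 * sqrt h)" unfolding s4 by (simp add: algebra_simps power2_eq_square)
    finally show ?thesis .
  qed
  then show ?thesis using that by blast
qed

section \<open>Transfer to rational points\<close>

text \<open>The Euclidean reduction moves p / q itself, which is multiplication from the left,
  whereas the group is generated from the right; closure on the left takes its own
  induction.\<close>

lemma theta_group_left_inversion: "theta_group a b c d \<Longrightarrow> theta_group (- c) (- d) a b"
proof (induction rule: theta_group.induct)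
  case one
  show ?case using theta_group.inversion[OF theta_group.one] by simp
next
  case (inversion a b c d)
  then show ?case using theta_group.inversion[OF inversion.IH] by simp
next
  case (translation a b c d k)
  then show ?case using theta_group.translation[OF translation.IH, of k] by (simp add: algebra_simps)
qed

lemma theta_group_left_translation: "theta_group a b c d \<Longrightarrow> theta_group (a + 2 * k * c) (b + 2 * k * d) c d"
proof (induction rule: theta_group.induct)
  case one
  show ?case using theta_group.translation[OF theta_group.one, of k] by simp
next
  case (inversion a b c d)
  then show ?case using theta_group.inversion[OF inversion.IH] by simp
next
  case (translation a b c d l)
  then show ?case using theta_group.translation[OF translation.IH, of l] by (simp add: algebra_simps)
qed

lemma theta_group_uminus: "theta_group a b c d \<Longrightarrow> theta_group (- a) (- b) (- c) (- d)"
  using theta_group.inversion[OF theta_group.inversion] by fastforce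

text \<open>A Euclidean algorithm with even quotients sorts the rationals into the two cusps \<open>0\<close> and \<open>1\<close>.\<close>

lemma theta_group_cusps:
  fixes p q :: int
  assumes "coprime p q" "q \<noteq> 0"
  shows "(even (p * q) \<longrightarrow> (\<exists>a c. theta_group a p c q)) \<and>
    (odd (p * q) \<longrightarrow> (\<exists>a b c d. theta_group a b c d \<and> a + b = p \<and> c + d = q))"
  using assms
\<comment> \<open>A matrix with second column (p, q) sends 0 to p / q; one with row sums p and q
  sends 1 there.\<close>
proof (induction "nat \<bar>q\<bar>" arbitrary: p q rule: less_induct)
  case less
  \<comment> \<open>\<open>p'\<close> represents p modulo 2 |q| in the interval from - |q| to |q|;
    the factor \<open>sgn q\<close> in \<open>k\<close> admits negative q. Even quotients preserve
    the parity of p * q.\<close>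
  define m where "m = \<bar>q\<bar>"
  define p' where "p' = (p + m) mod (2 * m) - m"
  define k where "k = sgn q * ((p + m) div (2 * m))"
  have m: "m > 0" using less.prems by (simp add: m_def)
  have p'_range: "- m \<le> p'" "p' < m"
    using pos_mod_bound[of "2 * m" "p + m"] m by (simp_all add: p'_def)
  have "p + m = 2 * m * ((p + m) div (2 * m)) + (p + m) mod (2 * m)" by simp
  moreover have "2 * m * ((p + m) div (2 * m)) = 2 * k * q"
    by (simp add: k_def m_def abs_sgn mult_ac)
  ultimately have p: "p = p' + 2 * k * q" by (simp add: p'_def)
  have cop: "coprime p' q"
  proof -
    have "gcd p q = gcd p' q"
      unfolding p by (metis gcd.commute gcd_add_mult add.commute)
    then show ?thesis using less.prems(1) by (simp add: coprime_iff_gcd_eq_1)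
  qed
  have par: "even (p * q) \<longleftrightarrow> even (p' * q)" unfolding p by simp
  have "(even (p' * q) \<longrightarrow> (\<exists>a c. theta_group a p' c q)) \<and>
    (odd (p' * q) \<longrightarrow> (\<exists>a b c d. theta_group a b c d \<and> a + b = p' \<and> c + d = q))"
  proof -
    consider "p' = 0" | "p' = - m" | "p' \<noteq> 0" "\<bar>p'\<bar> < m" using p'_range by linarith
    then show ?thesis
    proof cases
      case 1
      then have "is_unit q" using cop by simp
      then have "q = 1 \<or> q = - 1" by auto
      then show ?thesis
        using 1 theta_group.one theta_group_uminus[OF theta_group.one] by auto
    next
      case 2
      then have "is_unit q" using cop by (simp add: m_def coprime_commute)
      then have q: "q = 1 \<or> q = - 1" by auto
      then have p1: "p' = - 1" using 2 by (auto simp: m_def)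
      \<comment> \<open>Translation by - 2 takes 1 to - 1.\<close>
      have "theta_group 1 (- 2) 0 1" using theta_group.translation[OF theta_group.one, of "-1"] by simp
      then have "\<exists>a b c d. theta_group a b c d \<and> a + b = p' \<and> c + d = q"
        using q p1 theta_group_uminus[OF theta_group.one] by (metis add.commute add_0 add_uminus_conv_diff
          diff_numeral_special(11) minus_diff_eq one_add_one uminus_add_conv_diff diff_minus_eq_add add_diff_cancel_left' minus_zero)
      then show ?thesis using q p1 by auto
    next
      case 3
      \<comment> \<open>The inversion replaces p' / q by q / (- p'), whose denominator is
        smaller.\<close>
      then have "nat \<bar>- p'\<bar> < nat \<bar>q\<bar>" by (simp add: m_def)
      moreover have "coprime q (- p')" using cop by (simp add: coprime_commute)
      ultimately have IH: "(even (q * (- p')) \<longrightarrow> (\<exists>a c. theta_group a q c (- p'))) \<and>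
        (odd (q * (- p')) \<longrightarrow> (\<exists>a b c d. theta_group a b c d \<and> a + b = q \<and> c + d = - p'))"
        using less.hyps[of "- p'" q] 3 by simp
      show ?thesis
      proof (intro conjI impI)
        assume "even (p' * q)"
        then obtain a c where "theta_group a q c (- p')" using IH by auto
        from theta_group_left_inversion[OF this] show "\<exists>a c. theta_group a p' c q" by auto
      next
        assume "odd (p' * q)"
        then obtain a b c d where g: "theta_group a b c d" "a + b = q" "c + d = - p'" using IH by auto
        from g(3) have "- c + - d = p'" by simp
        with theta_group_left_inversion[OF g(1)] g(2)
        show "\<exists>a b c d. theta_group a b c d \<and> a + b = p' \<and> c + d = q" by blast
      qed
    qed
  qed
  then show ?case
  proof (elim conjE, intro conjI impI)
    assume "even (p' * q) \<longrightarrow> (\<exists>a c. theta_group a p' c q)" "even (p * q)"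
    then obtain a c where "theta_group a p' c q" using par by blast
    from theta_group_left_translation[OF this, of k] show "\<exists>a c. theta_group a p c q" unfolding p by blast
  next
    assume "odd (p' * q) \<longrightarrow> (\<exists>a b c d. theta_group a b c d \<and> a + b = p' \<and> c + d = q)" "odd (p * q)"
    then obtain a b c d where g: "theta_group a b c d" "a + b = p'" "c + d = q" using par by blast
    have "(a + 2 * k * c) + (b + 2 * k * d) = p" unfolding p g(2,3)[symmetric] by (simp add: algebra_simps)
    with theta_group_left_translation[OF g(1), of k] g(3)
    show "\<exists>a b c d. theta_group a b c d \<and> a + b = p \<and> c + d = q" by blast
  qed
qed

text \<open>With \<open>k = jline x\<close> in \<open>jint_mobius\<close> one boundary term vanishes
  and the integral, carrying a factor h, is of higher order. What survives is the automorphy factor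
  \<open>sqrt j / j\<^sup>2\<close>, and the power of \<open>j\<^sup>2\<close> accounts for passing
  from h to the transported increment r. The filter is arbitrary to serve one-sided limits and
  sequences alike; \<open>\<sigma>\<close> selects the side.\<close>

lemma jint_transfer:
  fixes a b c d :: int and x \<sigma> \<alpha> C \<delta> :: real and h :: "'a \<Rightarrow> real" and \<epsilon> L :: complex
  assumes mult: "theta_multiplier a b c d \<epsilon>" and det: "a * d - b * c = 1"
  defines "j \<equiv> of_int c * x + of_int d"
  assumes j: "j > 0" and \<sigma>: "\<bar>\<sigma>\<bar> = 1" and \<alpha>: "\<alpha> \<ge> 0" and \<delta>: "\<delta> > 0"
    and bound: "\<And>h. 0 < h \<Longrightarrow> h < \<delta> \<Longrightarrow> norm (jline (x + \<sigma> * h) - jline x) \<le> C * h powr \<alpha>"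
    and h: "filterlim h (at_right 0) F"
    and lim: "((\<lambda>t. (jline (x + \<sigma> * h t) - jline x) / of_real (h t powr \<alpha>)) \<longlongrightarrow> L) F"
  defines "z \<equiv> (of_int a * x + of_int b) / j"
    and "r \<equiv> \<lambda>t. h t / (j * (j + of_int c * \<sigma> * h t))"
  shows "filterlim r (at_right 0) F"
    and "((\<lambda>t. (jline (z + \<sigma> * r t) - jline z) / of_real (r t powr \<alpha>))
           \<longlongrightarrow> \<epsilon> * of_real (sqrt j / j\<^sup>2 * j\<^sup>2 powr \<alpha>) * L) F"
proof -
  define J where "J u = of_int c * u + of_int d" for u :: real
  have Jx: "J (x + u) = j + of_int c * u" for u by (simp add: J_def j_def algebra_simps)
  have h0: "(h \<longlongrightarrow> 0) F" and hpos: "\<forall>\<^sub>F t in F. h t > 0"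
    using h by (auto simp: filterlim_at eventually_conj_iff elim: eventually_mono)
  have jh: "((\<lambda>t. j + of_int c * \<sigma> * h t) \<longlongrightarrow> j) F"
    by (rule tendsto_eq_intros h0 refl | simp)+
  \<comment> \<open>Within this radius the denominator stays between j / 2 and 2 j, the range behind
    the kernel bound \<open>N\<close>.\<close>
  define \<delta>' where "\<delta>' = min \<delta> (j / (2 * (\<bar>of_int c\<bar> + 1)))"
  have \<delta>': "\<delta>' > 0" using \<delta> j by (auto simp: \<delta>'_def)
  have close: "\<bar>of_int c * u\<bar> < j / 2" if "\<bar>u\<bar> < \<delta>'" for u
  proof -
    have "\<bar>of_int c * u\<bar> \<le> \<bar>of_int c\<bar> * \<delta>'" using that by (auto simp: abs_mult intro!: mult_left_mono)
    also have "\<dots> < (\<bar>of_int c\<bar> + 1) * \<delta>'" using \<delta>' by (simp add: algebra_simps)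
    also have "\<dots> \<le> (\<bar>of_int c\<bar> + 1) * (j / (2 * (\<bar>of_int c\<bar> + 1)))"
      by (intro mult_left_mono) (auto simp: \<delta>'_def)
    also have "\<dots> = j / 2" by (simp add: field_simps)
    finally show ?thesis .
  qed
  have small: "\<forall>\<^sub>F t in F. 0 < h t \<and> h t < \<delta>'"
    using hpos order_tendstoD(2)[OF h0 \<delta>'] by eventually_elim simp
  have jpos: "\<forall>\<^sub>F t in F. j + of_int c * \<sigma> * h t > 0"
    using order_tendstoD(1)[OF jh j] .
  have r0: "(r \<longlongrightarrow> 0) F"
  proof -
    have "(r \<longlongrightarrow> 0 / (j * j)) F"
      unfolding r_def by (intro tendsto_intros h0 jh) (use j in simp)
    then show ?thesis by simp
  qed
  have rpos: "\<forall>\<^sub>F t in F. r t > 0"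
    using hpos jpos by eventually_elim (simp add: r_def j)
  show "filterlim r (at_right 0) F"
    using tendsto_imp_filterlim_at_right[OF r0 rpos] .
  define \<Delta> where "\<Delta> t = jline (x + \<sigma> * h t) - jline x" for t
  define I where "I t = integral {0..1} (\<lambda>s. of_real (sqrt (J (x + s * (\<sigma> * h t))) / J (x + s * (\<sigma> * h t)) ^ 3)
        * (jline (x + s * (\<sigma> * h t)) - jline x))" for t
  define m where "m t = sqrt (j + of_int c * \<sigma> * h t) / (j + of_int c * \<sigma> * h t)\<^sup>2" for t
  have incr: "\<forall>\<^sub>F t in F. jline (z + \<sigma> * r t) - jline z
      = \<epsilon> * (of_real (m t) * \<Delta> t + of_real (3 / 2 * of_int c * (\<sigma> * h t)) * I t)"
    using jpos
  proof eventually_elim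
    case (elim t)
    \<comment> \<open>Two values of a Moebius map of determinant 1 differ by the difference of the
      arguments over the product of the denominators.\<close>
    have "(of_int a * (x + \<sigma> * h t) + of_int b) / J (x + \<sigma> * h t) = z + \<sigma> * r t"
    proof -
      have "(of_int a * (x + \<sigma> * h t) + of_int b) * j
         = (of_int a * x + of_int b) * (j + of_int c * \<sigma> * h t) + \<sigma> * h t * of_int (a * d - b * c)"
        by (simp add: j_def algebra_simps)
      then have "(of_int a * (x + \<sigma> * h t) + of_int b) * j
         = (of_int a * x + of_int b) * (j + of_int c * \<sigma> * h t) + \<sigma> * h t" using det by simp
      moreover have "A / k = B / j + \<sigma> * (u / (j * k))"
        if "A * j = B * k + \<sigma> * u" "k > 0" for A B k u
        using that j by (simp add: field_simps)
      ultimately show ?thesis using elim unfolding Jx z_def r_def by (simp only: mult.assoc)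
    qed
    moreover have "(of_int a * x + of_int b) / J x = z" by (simp add: z_def J_def j_def)
    ultimately show ?case
      using jint_mobius[OF mult det, of x "\<sigma> * h t" "jline x"] elim j
      unfolding \<Delta>_def I_def m_def J_def[symmetric] Jx j_def by (simp add: Jx algebra_simps)
  qed
  define N where "N = sqrt (2 * j) / (j / 2) ^ 3"
  have C0: "C \<ge> 0"
  proof -
    have "0 \<le> C * (\<delta> / 2) powr \<alpha>" using order_trans[OF norm_ge_zero bound[of "\<delta> / 2"]] \<delta> by simp
    then show ?thesis using \<delta> by (simp add: zero_le_mult_iff)
  qed
  have Ibound: "\<forall>\<^sub>F t in F. norm (I t) \<le> N * C * h t powr \<alpha>"
    using small
  proof eventually_elim
    case (elim t)
    let ?f = "\<lambda>s. of_real (sqrt (J (x + s * (\<sigma> * h t))) / J (x + s * (\<sigma> * h t)) ^ 3)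
        * (jline (x + s * (\<sigma> * h t)) - jline x)"
    have J2: "j / 2 < J (x + s * (\<sigma> * h t))" "J (x + s * (\<sigma> * h t)) < 2 * j" if "s \<in> {0..1}" for s
    proof -
      have "\<bar>s * (\<sigma> * h t)\<bar> \<le> 1 * (1 * h t)"
        using that elim \<sigma> unfolding abs_mult by (intro mult_mono) auto
      then have "\<bar>of_int c * (s * (\<sigma> * h t))\<bar> < j / 2" by (intro close) (use elim in auto)
      then show "j / 2 < J (x + s * (\<sigma> * h t))" "J (x + s * (\<sigma> * h t)) < 2 * j"
        unfolding Jx using j by linarith+
    qed
    have Jnz: "J (x + s * (\<sigma> * h t)) \<noteq> 0" if "s \<in> {0..1}" for s
      using J2[OF that] j by linarith
    have "norm (integral {0..1} ?f) \<le> N * (C * h t powr \<alpha>) * (1 - 0)"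
    proof (rule integral_bound)
      show "continuous_on {0..1} ?f"
        using Jnz unfolding J_def
        by (intro continuous_intros continuous_on_compose2[OF continuous_on_jint]) auto
      fix s :: real assume s: "s \<in> {0..1}"
      have "sqrt (J (x + s * (\<sigma> * h t))) / J (x + s * (\<sigma> * h t)) ^ 3 \<le> N"
        unfolding N_def using J2[OF s] j by (intro frac_le power_mono) auto
      moreover have "norm (jline (x + s * (\<sigma> * h t)) - jline x) \<le> C * h t powr \<alpha>"
      proof (cases "s = 0")
        case True
        then show ?thesis using C0 by simp
      next
        case False
        then have "0 < s * h t" "s * h t \<le> h t" using s elim by (auto simp: mult_left_le_one_le)
        then have "norm (jline (x + \<sigma> * (s * h t)) - jline x) \<le> C * (s * h t) powr \<alpha>"
          using elim \<open>s * h t \<le> h t\<close> by (intro bound) (simp_all add: \<delta>'_def)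
        also have "\<dots> \<le> C * h t powr \<alpha>"
          using C0 \<alpha> \<open>0 < s * h t\<close> \<open>s * h t \<le> h t\<close> by (intro mult_left_mono powr_mono2) auto
        finally show ?thesis by (simp add: mult_ac)
      qed
      moreover have "0 \<le> sqrt (J (x + s * (\<sigma> * h t))) / J (x + s * (\<sigma> * h t)) ^ 3"
        using J2[OF s] j by simp
      ultimately show "norm (?f s) \<le> N * (C * h t powr \<alpha>)"
        unfolding norm_mult norm_of_real by (intro mult_mono) auto
    qed simp
    then show ?case by (simp add: I_def mult.assoc)
  qed
  \<comment> \<open>The integral is of order \<open>h t powr \<alpha>\<close>, so its prefactor h
    makes the term negligible.\<close>
  have E0: "((\<lambda>t. of_real (3 / 2 * of_int c * (\<sigma> * h t)) * I t / of_real (h t powr \<alpha>)) \<longlongrightarrow> 0) F"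
  proof (rule tendsto_norm_zero_cancel, rule tendsto_sandwich[of "\<lambda>_. 0"])
    show "((\<lambda>t. 3 / 2 * \<bar>of_int c\<bar> * (N * C) * h t) \<longlongrightarrow> 0) F"
      by (rule tendsto_eq_intros h0 refl | simp)+
    show "\<forall>\<^sub>F t in F. norm (of_real (3 / 2 * of_int c * (\<sigma> * h t)) * I t / of_real (h t powr \<alpha>)) \<le> 3 / 2 * \<bar>of_int c\<bar> * (N * C) * h t"
      using Ibound hpos
    proof eventually_elim
      case (elim t)
      have "norm (of_real (3 / 2 * of_int c * (\<sigma> * h t)) * I t / of_real (h t powr \<alpha>)) = 3 / 2 * \<bar>of_int c\<bar> * h t * norm (I t) / h t powr \<alpha>"
        using elim(2) \<sigma> by (simp add: norm_mult norm_divide abs_mult)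
      also have "\<dots> \<le> 3 / 2 * \<bar>of_int c\<bar> * h t * (N * C * h t powr \<alpha>) / h t powr \<alpha>"
        using elim by (intro divide_right_mono mult_left_mono) auto
      also have "\<dots> = 3 / 2 * \<bar>of_int c\<bar> * (N * C) * h t" using elim(2) by simp
      finally show ?case .
    qed
  qed auto
  have m0: "(m \<longlongrightarrow> sqrt j / j\<^sup>2) F"
    unfolding m_def by (intro tendsto_intros jh) (use j in simp)
  have pw: "((\<lambda>t. (j * (j + of_int c * \<sigma> * h t)) powr \<alpha>) \<longlongrightarrow> (j * j) powr \<alpha>) F"
    by (intro tendsto_intros jh) (use j in simp)
  have "((\<lambda>t. \<epsilon> * (of_real (m t) * (\<Delta> t / of_real (h t powr \<alpha>)) + of_real (3 / 2 * of_int c * (\<sigma> * h t)) * I t / of_real (h t powr \<alpha>))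
       * of_real ((j * (j + of_int c * \<sigma> * h t)) powr \<alpha>))
     \<longlongrightarrow> \<epsilon> * (of_real (sqrt j / j\<^sup>2) * L + 0) * of_real ((j * j) powr \<alpha>)) F"
    using lim unfolding \<Delta>_def[symmetric] by (intro tendsto_intros E0 m0 pw)
  moreover have "\<forall>\<^sub>F t in F. \<epsilon> * (of_real (m t) * (\<Delta> t / of_real (h t powr \<alpha>)) + of_real (3 / 2 * of_int c * (\<sigma> * h t)) * I t / of_real (h t powr \<alpha>))
       * of_real ((j * (j + of_int c * \<sigma> * h t)) powr \<alpha>)
     = (jline (z + \<sigma> * r t) - jline z) / of_real (r t powr \<alpha>)"
    using incr hpos jpos
  proof eventually_elim
    case (elim t)
    have "r t powr \<alpha> = h t powr \<alpha> / (j * (j + of_int c * \<sigma> * h t)) powr \<alpha>"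
      unfolding r_def by (rule powr_divide)
    then have inv: "1 / complex_of_real (r t powr \<alpha>) = of_real ((j * (j + of_int c * \<sigma> * h t)) powr \<alpha>) / of_real (h t powr \<alpha>)"
      by simp
    have "X / of_real (r t powr \<alpha>) = X * of_real ((j * (j + of_int c * \<sigma> * h t)) powr \<alpha>) / of_real (h t powr \<alpha>)" for X :: complex
      using arg_cong[OF inv, of "\<lambda>u. X * u"] by simp
    then show ?case unfolding elim(1) by (simp add: add_divide_distrib algebra_simps)
  qed
  ultimately have "((\<lambda>t. (jline (z + \<sigma> * r t) - jline z) / of_real (r t powr \<alpha>))
     \<longlongrightarrow> \<epsilon> * (of_real (sqrt j / j\<^sup>2) * L + 0) * of_real ((j * j) powr \<alpha>)) F"
    by (rule Lim_transform_eventually)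
  then show "((\<lambda>t. (jline (z + \<sigma> * r t) - jline z) / of_real (r t powr \<alpha>))
           \<longlongrightarrow> \<epsilon> * of_real (sqrt j / j\<^sup>2 * j\<^sup>2 powr \<alpha>) * L) F"
    by (simp add: power2_eq_square mult_ac)
qed

section \<open>Corners on the orbit of 0, spirals on the orbit of 1\<close>

lemma norm_josc_le:
  assumes "Im \<tau> \<ge> 0"
  shows "norm (josc \<tau>) \<le> (\<Sum>n. 2 / freq n)"
  unfolding josc_def
  by (rule norm_suminf_le[OF norm_josc_term_le[OF assms] summable_inverse_freq])

lemma jint_zero_limit:
  obtains C where "\<And>h. 0 < h \<Longrightarrow> h < 1 \<Longrightarrow> norm (jline h / of_real (sqrt h) - 2 * cis (pi / 4)) \<le> C * h"
proof -
  define B where "B = (\<Sum>n. 2 / freq n)"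
  obtain C where C: "\<And>h. 0 < h \<Longrightarrow> h \<le> 1 \<Longrightarrow>
    norm (jline h - cis (pi / 4) * (of_real (2 * sqrt h) - of_real (h * sqrt h) * cnj (josc (of_real (1 / h))))) \<le> C * (h\<^sup>2 * sqrt h)"
    using jint_near_zero by blast
  have 1: "norm (jline h / of_real (sqrt h) - 2 * cis (pi / 4)) \<le> (\<bar>C\<bar> + B) * h" if h: "0 < h" "h < 1" for h
  proof -
    define e where "e = jline h - cis (pi / 4) * (of_real (2 * sqrt h) - of_real (h * sqrt h) * cnj (josc (of_real (1 / h))))"
    have "jline h = e + cis (pi / 4) * (of_real (2 * sqrt h) - of_real (h * sqrt h) * cnj (josc (of_real (1 / h))))"
      by (simp add: e_def)
    moreover have "(e + w * (of_real (2 * r) - of_real (h * r) * J)) / of_real r - 2 * w = e / of_real r - w * of_real h * J"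
      if "r \<noteq> 0" for w J :: complex and r :: real
      using that by (simp add: field_simps)
    ultimately have "jline h / of_real (sqrt h) - 2 * cis (pi / 4)
      = e / of_real (sqrt h) - cis (pi / 4) * of_real h * cnj (josc (of_real (1 / h)))"
      using h by (metis real_sqrt_eq_0_iff less_irrefl)
    also have "norm \<dots> \<le> norm (e / of_real (sqrt h)) + norm (cis (pi / 4) * of_real h * cnj (josc (of_real (1 / h))))"
      by (rule norm_triangle_ineq4)
    also have "norm (e / of_real (sqrt h)) \<le> \<bar>C\<bar> * h"
    proof -
      have "norm e \<le> C * (h\<^sup>2 * sqrt h)" unfolding e_def using C[of h] h by simp
      also have "\<dots> \<le> \<bar>C\<bar> * (h\<^sup>2 * sqrt h)" using h by (intro mult_right_mono) auto
      also have "h\<^sup>2 \<le> h" using h by (simp add: power2_eq_square)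
      then have "\<bar>C\<bar> * (h\<^sup>2 * sqrt h) \<le> \<bar>C\<bar> * (h * sqrt h)" using h by (intro mult_left_mono mult_right_mono) auto
      finally show ?thesis using h by (simp add: norm_divide field_simps)
    qed
    also have "norm (cis (pi / 4) * of_real h * cnj (josc (of_real (1 / h)))) \<le> B * h"
      using norm_josc_le[of "of_real (1 / h)"] h unfolding norm_mult B_def complex_mod_cnj by (simp add: mult.commute)
    finally show ?thesis by (simp add: algebra_simps)
  qed
  show ?thesis by (rule that[OF 1])
qed

lemma jint_zero_bound:
  obtains C where "\<And>h \<sigma>. 0 < h \<Longrightarrow> h < 1 \<Longrightarrow> \<bar>\<sigma>\<bar> = 1 \<Longrightarrow> norm (jline (\<sigma> * h)) \<le> C * h powr (1/2)"
proof -
  obtain C where C: "\<And>h. 0 < h \<Longrightarrow> h < 1 \<Longrightarrow> norm (jline h / of_real (sqrt h) - 2 * cis (pi / 4)) \<le> C * h"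
    using jint_zero_limit by blast
  have right: "norm (jline h) \<le> (\<bar>C\<bar> + 2) * h powr (1/2)" if h: "0 < h" "h < 1" for h
  proof -
    have "norm (jline h / of_real (sqrt h)) \<le> norm (jline h / of_real (sqrt h) - 2 * cis (pi / 4)) + norm (2 * cis (pi / 4))"
      by (metis diff_add_cancel norm_triangle_ineq)
    also have "\<dots> \<le> C * h + 2" using C[OF h] by (simp add: norm_mult)
    also have "\<dots> \<le> \<bar>C\<bar> * h + 2" using h by (intro add_right_mono mult_right_mono) auto
    also have "\<dots> \<le> \<bar>C\<bar> * 1 + 2" using h by (intro add_right_mono mult_left_mono) auto
    finally show ?thesis using h by (simp add: norm_divide field_simps powr_half_sqrt)
  qed
  show ?thesis
  proof (rule that)
    fix h \<sigma> :: real assume h: "0 < h" "h < 1" and "\<bar>\<sigma>\<bar> = 1"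
    then have "\<sigma> = 1 \<or> \<sigma> = - 1" by auto
    then have "norm (jline (\<sigma> * h)) = norm (jline h)"
    proof
      assume "\<sigma> = - 1"
      then have "jline (\<sigma> * h) = - cnj (jline h)" using jint_neg_real[of h] by simp
      then show ?thesis by simp
    qed simp
    then show "norm (jline (\<sigma> * h)) \<le> (\<bar>C\<bar> + 2) * h powr (1/2)"
      using right[OF h] by simp
  qed
qed

lemma jint_corner_at_zero:
  "((\<lambda>h. jline h / of_real (h powr (1/2))) \<longlongrightarrow> 2 * cis (pi / 4)) (at_right 0)"
  "((\<lambda>h. jline (- h) / of_real (h powr (1/2))) \<longlongrightarrow> - (2 * cis (- pi / 4))) (at_right 0)"
proof -
  obtain C where C: "\<And>h. 0 < h \<Longrightarrow> h < 1 \<Longrightarrow> norm (jline h / of_real (sqrt h) - 2 * cis (pi / 4)) \<le> C * h"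
    using jint_zero_limit by blast
  have ev: "\<forall>\<^sub>F h in at_right 0. 0 < h \<and> h < (1::real)"
    by (rule eventually_at_rightI[of 0 1]) auto
  have "((\<lambda>h. jline h / of_real (h powr (1/2)) - 2 * cis (pi / 4)) \<longlongrightarrow> 0) (at_right 0)"
  proof (rule Lim_null_comparison[where g = "\<lambda>h. C * h"])
    show "\<forall>\<^sub>F h in at_right 0. norm (jline h / of_real (h powr (1/2)) - 2 * cis (pi / 4)) \<le> C * h"
      using ev
    proof eventually_elim
      case (elim h)
      then show ?case using C[of h] by (simp only: powr_half_sqrt less_imp_le)
    qed
    have "((\<lambda>h. C * h) \<longlongrightarrow> C * 0) (at_right 0)" by (intro tendsto_intros)
    then show "((\<lambda>h. C * h) \<longlongrightarrow> 0) (at_right 0)" by simp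
  qed
  then show 1: "((\<lambda>h. jline h / of_real (h powr (1/2))) \<longlongrightarrow> 2 * cis (pi / 4)) (at_right 0)"
    by (rule LIM_zero_cancel)
  have "((\<lambda>h. - cnj (jline h / of_real (h powr (1/2)))) \<longlongrightarrow> - cnj (2 * cis (pi / 4))) (at_right 0)"
    by (intro tendsto_intros 1)
  then show "((\<lambda>h. jline (- h) / of_real (h powr (1/2))) \<longlongrightarrow> - (2 * cis (- pi / 4))) (at_right 0)"
    unfolding jint_neg_real by (simp add: cis_cnj)
qed

text \<open>The substitution inverse to h / (j * (j + c * h)). It turns a limit along transported
  increments into a one-sided limit.\<close>

lemma filterlim_at_right_scaled:
  fixes j c :: real
  assumes "j > 0"
  shows "filterlim (\<lambda>r. j\<^sup>2 * r / (1 - c * j * r)) (at_right 0) (at_right 0)"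
    and "\<forall>\<^sub>F r in at_right 0. (j\<^sup>2 * r / (1 - c * j * r)) / (j * (j + c * (j\<^sup>2 * r / (1 - c * j * r)))) = r"
proof -
  have den: "((\<lambda>r. 1 - c * j * r) \<longlongrightarrow> 1) (at_right 0)"
    by (rule tendsto_eq_intros refl | simp)+
  have pos: "\<forall>\<^sub>F r in at_right 0. 1 - c * j * r > 0"
    by (rule order_tendstoD(1)[OF den]) simp
  have rpos: "\<forall>\<^sub>F r in at_right 0. (0::real) < r" by (rule eventually_at_right_less)
  show "filterlim (\<lambda>r. j\<^sup>2 * r / (1 - c * j * r)) (at_right 0) (at_right 0)"
  proof (rule tendsto_imp_filterlim_at_right)
    have "((\<lambda>r. j\<^sup>2 * r / (1 - c * j * r)) \<longlongrightarrow> j\<^sup>2 * 0 / 1) (at_right 0)"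
      by (intro tendsto_intros den) simp
    then show "((\<lambda>r. j\<^sup>2 * r / (1 - c * j * r)) \<longlongrightarrow> 0) (at_right 0)" by simp
    show "\<forall>\<^sub>F r in at_right 0. 0 < j\<^sup>2 * r / (1 - c * j * r)"
      using pos rpos by eventually_elim (use assms in simp)
  qed
  show "\<forall>\<^sub>F r in at_right 0. (j\<^sup>2 * r / (1 - c * j * r)) / (j * (j + c * (j\<^sup>2 * r / (1 - c * j * r)))) = r"
    using pos
  proof eventually_elim
    case (elim r)
    have "j + c * (j\<^sup>2 * r / (1 - c * j * r)) = j / (1 - c * j * r)"
      using elim by (simp add: field_simps power2_eq_square)
    then show ?case using elim assms by (simp add: power2_eq_square)
  qed
qed

lemma norm_eighth_root:
  fixes e :: complex
  assumes "e ^ 8 = 1"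
  shows "norm e = 1"
  using assms by (metis norm_ge_zero norm_one norm_power power_eq_1_iff zero_neq_numeral)

text \<open>A group element sends 0 to p / q and has denominator q at 0; its multiplier turns the
  corner found there, and the automorphy factor only rescales it by a positive number.\<close>

lemma jint_corner:
  fixes p q :: int
  assumes "coprime p q" "q > 0" "even (p * q)"
  defines "z \<equiv> real_of_int p / real_of_int q"
  obtains e K where "e ^ 8 = 1" "K > 0"
    "((\<lambda>r. (jline (z + r) - jline z) / of_real (sqrt r)) \<longlongrightarrow> of_real K * (e * cis (pi / 4))) (at_right 0)"
    "((\<lambda>r. (jline (z - r) - jline z) / of_real (sqrt r)) \<longlongrightarrow> - of_real K * (e * cis (- pi / 4))) (at_right 0)"
proof -
  obtain a c where g: "theta_group a p c q"
    using theta_group_cusps[of p q] assms by auto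
  then obtain e where e: "e ^ 8 = 1" "theta_multiplier a p c q e" using theta_group_multiplier by blast
  have det: "a * q - p * c = 1" by (rule theta_group_det[OF g])
  define j where "j = real_of_int q"
  have j: "j > 0" using assms by (simp add: j_def)
  obtain C where C: "\<And>h \<sigma>. 0 < h \<Longrightarrow> h < 1 \<Longrightarrow> \<bar>\<sigma>\<bar> = 1 \<Longrightarrow> norm (jline (\<sigma> * h)) \<le> C * h powr (1/2)"
    using jint_zero_bound by blast
  have transfer: "((\<lambda>r. (jline (z + \<sigma> * r) - jline z) / of_real (sqrt r))
      \<longlongrightarrow> e * of_real (sqrt j / j\<^sup>2 * j\<^sup>2 powr (1/2)) * L) (at_right 0)"
    if \<sigma>: "\<bar>\<sigma>\<bar> = 1" and L: "((\<lambda>h. jline (\<sigma> * h) / of_real (h powr (1/2))) \<longlongrightarrow> L) (at_right 0)" for \<sigma> L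
  proof -
    \<comment> \<open>Chosen so that the transported increment \<open>r t\<close> equals t for small
      t.\<close>
    define h where "h = (\<lambda>r. j\<^sup>2 * r / (1 - (of_int c * \<sigma>) * j * r))"
    define r where "r = (\<lambda>t. h t / (j * (j + (of_int c * \<sigma>) * h t)))"
    have h: "filterlim h (at_right 0) (at_right 0)"
      unfolding h_def by (rule filterlim_at_right_scaled(1)[OF j])
    have "((\<lambda>t. (jline (z + \<sigma> * r t) - jline z) / of_real (r t powr (1/2)))
      \<longlongrightarrow> e * of_real (sqrt j / j\<^sup>2 * j\<^sup>2 powr (1/2)) * L) (at_right 0)"
    proof -
      have num: "0 \<le> (1/2 :: real)" "0 < (1 :: real)" "real_of_int c * 0 + real_of_int q = j" by (simp_all add: j_def)
      have z: "(real_of_int a * 0 + real_of_int p) / j = z" by (simp add: z_def j_def)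
      have B: "norm (jline (0 + \<sigma> * h) - jline 0) \<le> C * h powr (1/2)" if "0 < h" "h < 1" for h
        using C[OF that \<sigma>] by simp
      have L': "((\<lambda>t. (jline (0 + \<sigma> * h t) - jline 0) / of_real (h t powr (1/2))) \<longlongrightarrow> L) (at_right 0)"
        using filterlim_compose[OF L h] by simp
      show ?thesis
        using jint_transfer(2)[OF e(2) det _ \<sigma> num(1,2) B h L', unfolded num(3) z, OF j] by (simp only: r_def)
    qed
    moreover have "\<forall>\<^sub>F t in at_right 0. (jline (z + \<sigma> * r t) - jline z) / of_real (r t powr (1/2))
        = (jline (z + \<sigma> * t) - jline z) / of_real (sqrt t)"
      using filterlim_at_right_scaled(2)[OF j, of "of_int c * \<sigma>"] eventually_at_right_less[of 0]
    proof eventually_elim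
      case (elim t)
      have "r t = t" unfolding r_def h_def by (rule elim(1))
      then show ?case using elim(2) by (simp add: powr_half_sqrt)
    qed
    ultimately show ?thesis by (rule Lim_transform_eventually)
  qed
  define K where "K = 2 * (sqrt j / j\<^sup>2 * j\<^sup>2 powr (1/2))"
  show ?thesis
  proof (rule that[OF e(1)])
    show "K > 0" using j by (simp add: K_def)
    have K: "e * of_real (sqrt j / j\<^sup>2 * j\<^sup>2 powr (1/2)) * (2 * w) = of_real K * (e * w)" for w
      by (simp add: K_def)
    show "((\<lambda>r. (jline (z + r) - jline z) / of_real (sqrt r)) \<longlongrightarrow> of_real K * (e * cis (pi / 4))) (at_right 0)"
      using transfer[of 1 "2 * cis (pi / 4)"] jint_corner_at_zero(1) unfolding K by simp
    show "((\<lambda>r. (jline (z - r) - jline z) / of_real (sqrt r)) \<longlongrightarrow> - of_real K * (e * cis (- pi / 4))) (at_right 0)"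
      using transfer[of "-1" "- (2 * cis (- pi / 4))"] jint_corner_at_zero(2) unfolding mult_minus_right K by simp
  qed
qed

text \<open>The reflection symmetry at 0 carries over to 1, as both terms of
  \<open>jint_add_one\<close> have it.\<close>

lemma jint_one_minus: "jline (1 - h) - jint 1 = - cnj (jline (1 + h) - jint 1)"
proof -
  have "jline (1 - h) - jint 1 = jline (- (4 * h)) / 2 - jline (- h)"
    using jint_add_one[of "of_real (- h)"] by simp
  also have "\<dots> = - cnj (jline (4 * h) / 2 - jline h)"
    unfolding jint_neg_real by simp
  also have "jline (4 * h) / 2 - jline h = jline (1 + h) - jint 1"
    using jint_add_one[of "of_real h"] by simp
  finally show ?thesis .
qed

lemma jint_one_bound:
  obtains C where "\<And>h \<sigma>. 0 < h \<Longrightarrow> h < 1/4 \<Longrightarrow> \<bar>\<sigma>\<bar> = 1 \<Longrightarrow>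
    norm (jline (1 + \<sigma> * h) - jline 1) \<le> C * h powr (3/2)"
proof -
  obtain C where C: "\<And>h. 0 < h \<Longrightarrow> h \<le> 1/4 \<Longrightarrow>
    norm (jline (1 + h) - jint 1 + 4 * cis (pi / 4) * of_real (h * sqrt h) * cnj (jodd (of_real (1 / (4 * h)))))
      \<le> C * (h\<^sup>2 * sqrt h)"
    using jint_near_one by blast
  have main: "norm (jline (1 + h) - jint 1) \<le> (\<bar>C\<bar> + pi) * h powr (3/2)" if h: "0 < h" "h < 1/4" for h
  proof -
    let ?m = "4 * cis (pi / 4) * of_real (h * sqrt h) * cnj (jodd (of_real (1 / (4 * h))))"
    have "norm (jline (1 + h) - jint 1) \<le> norm (jline (1 + h) - jint 1 + ?m) + norm ?m"
      using norm_triangle_ineq4[of "jline (1 + h) - jint 1 + ?m" ?m] by simp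
    also have "norm (jline (1 + h) - jint 1 + ?m) \<le> \<bar>C\<bar> * (h * sqrt h)"
    proof -
      have "norm (jline (1 + h) - jint 1 + ?m) \<le> C * (h\<^sup>2 * sqrt h)" using C[of h] h by simp
      also have "\<dots> \<le> \<bar>C\<bar> * (h\<^sup>2 * sqrt h)" using h by (intro mult_right_mono) auto
      also have "h\<^sup>2 \<le> h" using h by (simp add: power2_eq_square)
      then have "\<bar>C\<bar> * (h\<^sup>2 * sqrt h) \<le> \<bar>C\<bar> * (h * sqrt h)" using h by (intro mult_left_mono mult_right_mono) auto
      finally show ?thesis .
    qed
    also have "norm ?m = 4 * (h * sqrt h) * norm (jodd (of_real (1 / (4 * h))))"
      using h by (simp add: norm_mult)
    also have "\<dots> \<le> 4 * (h * sqrt h) * (pi / 4)" using h by (intro mult_left_mono norm_jodd_le) auto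
    finally have "norm (jline (1 + h) - jint 1) \<le> (\<bar>C\<bar> + pi) * (h * sqrt h)" by (simp add: algebra_simps)
    also have "h * sqrt h = h powr (3/2)" using h powr_add[of h 1 "1/2"] by (simp add: powr_half_sqrt)
    finally show ?thesis .
  qed
  show ?thesis
  proof (rule that)
    fix h \<sigma> :: real assume h: "0 < h" "h < 1/4" and "\<bar>\<sigma>\<bar> = 1"
    then have "\<sigma> = 1 \<or> \<sigma> = - 1" by auto
    moreover have "norm (jline (1 - h) - jint 1) = norm (jline (1 + h) - jint 1)"
      unfolding jint_one_minus by (simp only: norm_minus_cancel complex_mod_cnj)
    ultimately show "norm (jline (1 + \<sigma> * h) - jline 1) \<le> (\<bar>C\<bar> + pi) * h powr (3/2)"
      using main[OF h] by auto
  qed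
qed

text \<open>By periodicity the leading term keeps a fixed direction along h = 1 / (4 * (y + 2 * n)),
  and \<open>jodd_direction\<close> supplies the y for a prescribed one. The left side follows by
  reflection.\<close>

lemma jint_spiral_at_one:
  assumes "norm v = 1" "\<bar>\<sigma>\<bar> = 1"
  obtains h K where "filterlim h (at_right 0) sequentially" "K > 0"
    "(\<lambda>n. (jline (1 + \<sigma> * h n) - jline 1) / of_real (h n powr (3/2))) \<longlonglongrightarrow> of_real K * v"
proof -
  obtain C where C: "\<And>h. 0 < h \<Longrightarrow> h \<le> 1/4 \<Longrightarrow>
    norm (jline (1 + h) - jint 1 + 4 * cis (pi / 4) * of_real (h * sqrt h) * cnj (jodd (of_real (1 / (4 * h)))))
      \<le> C * (h\<^sup>2 * sqrt h)"
    using jint_near_one by blast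
  have right: "\<exists>h K. filterlim h (at_right 0) sequentially \<and> K > 0 \<and>
    (\<lambda>n. (jline (1 + h n) - jint 1) / of_real (h n powr (3/2))) \<longlonglongrightarrow> of_real K * v"
    if v: "norm v = 1" for v
  proof -
    \<comment> \<open>The direction of \<open>jodd\<close> for which - 4 cis (pi / 4) times its
      conjugate points along v.\<close>
    have "norm (- cis (pi / 4) * cnj v) = 1" using v by (simp add: norm_mult)
    then obtain y D where y: "D > 0" "jodd (of_real y) = of_real D * (- cis (pi / 4) * cnj v)"
      by (rule jodd_direction)
    define h where "h n = 1 / (4 * (y + 2 * real n))" for n
    have h: "filterlim h (at_right 0) sequentially"
      unfolding h_def by real_asymp
    have small: "\<forall>\<^sub>F n in sequentially. 0 < h n \<and> h n < 1/4"
      by (rule eventually_compose_filterlim[OF eventually_at_rightI[of 0 "1/4"] h]) auto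
    have h0: "h \<longlonglongrightarrow> 0" using h by (simp add: filterlim_at)
    have jy: "jodd (of_real (1 / (4 * h n))) = jodd (of_real y)" for n
    proof -
      have "complex_of_real (1 / (4 * h n)) = of_real y + 2 * of_int (int n)" by (simp add: h_def)
      then show ?thesis by (simp only: jodd_add_even)
    qed
    have L: "4 * cis (pi / 4) * cnj (jodd (of_real y)) = - (of_real (4 * D) * v)"
    proof -
      have "cis (pi / 4) * cis (- (pi / 4)) = 1" by (simp add: cis_mult)
      then show ?thesis unfolding y(2) by (simp add: cis_cnj mult_ac)
    qed
    have "(\<lambda>n. (jline (1 + h n) - jint 1) / of_real (h n powr (3/2)) - of_real (4 * D) * v) \<longlonglongrightarrow> 0"
    proof (rule Lim_null_comparison[where g = "\<lambda>n. C * h n"])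
      show "(\<lambda>n. C * h n) \<longlonglongrightarrow> 0" using tendsto_mult_left[OF h0, of C] by simp
      show "\<forall>\<^sub>F n in sequentially. norm ((jline (1 + h n) - jint 1) / of_real (h n powr (3/2)) - of_real (4 * D) * v) \<le> C * h n"
        using small
      proof eventually_elim
        case (elim n)
        define w where "w = h n * sqrt (h n)"
        have w: "w > 0" "h n powr (3/2) = w"
          using elim powr_add[of "h n" 1 "1/2"] by (simp_all add: powr_half_sqrt w_def)
        have "(jline (1 + h n) - jint 1) / of_real w - of_real (4 * D) * v
          = (jline (1 + h n) - jint 1 + 4 * cis (pi / 4) * of_real w * cnj (jodd (of_real (1 / (4 * h n))))) / of_real w"
        proof -
          have "4 * cis (pi / 4) * of_real w * cnj (jodd (of_real (1 / (4 * h n)))) = - (of_real (4 * D) * v) * of_real w"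
            unfolding jy using L by (simp add: mult_ac)
          moreover have "X / W - Y = (X + Z) / W" if "Z = - Y * W" "W \<noteq> 0" for X Y Z W :: complex
            using that by (simp add: field_simps)
          ultimately show ?thesis using w(1) by simp
        qed
        also have "norm \<dots> \<le> C * ((h n)\<^sup>2 * sqrt (h n)) / w"
          using C[of "h n"] elim w(1) unfolding w_def[symmetric] norm_divide
          by (simp add: divide_right_mono less_imp_le)
        also have "\<dots> = C * h n" using elim by (simp add: w_def power2_eq_square)
        finally show ?case unfolding w(2) .
      qed
    qed
    then have "(\<lambda>n. (jline (1 + h n) - jint 1) / of_real (h n powr (3/2))) \<longlonglongrightarrow> of_real (4 * D) * v"
      by (rule LIM_zero_cancel)
    moreover have "4 * D > 0" using y by simp
    ultimately show ?thesis using h by blast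
  qed
  from assms(2) have "\<sigma> = 1 \<or> \<sigma> = - 1" by auto
  then show ?thesis
  proof
    assume \<sigma>: "\<sigma> = 1"
    from right[OF assms(1)] obtain h K where hK: "filterlim h (at_right 0) sequentially" "K > 0"
      "(\<lambda>n. (jline (1 + h n) - jint 1) / of_real (h n powr (3/2))) \<longlonglongrightarrow> of_real K * v" by blast
    show ?thesis by (rule that[OF hK(1,2)]) (use hK(3) \<sigma> in simp)
  next
    assume \<sigma>: "\<sigma> = - 1"
    have "norm (- cnj v) = 1" using assms(1) by simp
    from right[OF this] obtain h K where hK: "filterlim h (at_right 0) sequentially" "K > 0"
      "(\<lambda>n. (jline (1 + h n) - jint 1) / of_real (h n powr (3/2))) \<longlonglongrightarrow> of_real K * (- cnj v)" by blast
    have eq: "(jline (1 + \<sigma> * h n) - jline 1) / of_real (h n powr (3/2))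
      = - cnj ((jline (1 + h n) - jint 1) / of_real (h n powr (3/2)))" for n
    proof -
      have "1 + \<sigma> * h n = 1 - h n" by (simp add: \<sigma>)
      then have "jline (1 + \<sigma> * h n) - jline 1 = - cnj (jline (1 + h n) - jint 1)"
        using jint_one_minus[of "h n"] by (simp only: of_real_1)
      then show ?thesis by (simp only: complex_cnj_divide complex_cnj_complex_of_real minus_divide_left)
    qed
    have "- cnj (of_real K * (- cnj v)) = of_real K * v" by simp
    with tendsto_minus[OF tendsto_cnj[OF hK(3)]] show ?thesis
      by (intro that[OF hK(1,2)]) (simp only: eq)
  qed
qed

text \<open>All directions occur at the point 1, so the wanted one divided by the multiplier occurs
  there as well.\<close>

lemma jint_spiral:
  fixes p q :: int
  assumes "coprime p q" "q > 0" "odd (p * q)" "norm v = 1" "\<bar>\<sigma>\<bar> = 1"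
  defines "z \<equiv> real_of_int p / real_of_int q"
  obtains r K where "filterlim r (at_right 0) sequentially" "K > 0"
    "(\<lambda>n. (jline (z + \<sigma> * r n) - jline z) / of_real (r n powr (3/2))) \<longlonglongrightarrow> of_real K * v"
proof -
  obtain a b c d where g: "theta_group a b c d" "a + b = p" "c + d = q"
    using theta_group_cusps[of p q] assms by auto
  then obtain e where e: "e ^ 8 = 1" "theta_multiplier a b c d e" using theta_group_multiplier by blast
  have det: "a * d - b * c = 1" by (rule theta_group_det[OF g(1)])
  define j where "j = real_of_int c * 1 + real_of_int d"
  have jq: "j = real_of_int q" unfolding j_def g(3)[symmetric] by simp
  have j: "j > 0" using assms by (simp add: jq)
  have z: "(real_of_int a * 1 + real_of_int b) / j = z" unfolding z_def jq g(2)[symmetric] by simp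
  have ne: "norm e = 1"
    by (rule norm_eighth_root[OF e(1)])
  have unit: "norm (v / e) = 1" using assms ne by (simp add: norm_divide)
  obtain h K where h: "filterlim h (at_right 0) sequentially" "K > 0"
    "(\<lambda>n. (jline (1 + \<sigma> * h n) - jline 1) / of_real (h n powr (3/2))) \<longlonglongrightarrow> of_real K * (v / e)"
    by (rule jint_spiral_at_one[OF unit assms(5)])
  obtain C where C: "\<And>h \<sigma>. 0 < h \<Longrightarrow> h < 1/4 \<Longrightarrow> \<bar>\<sigma>\<bar> = 1 \<Longrightarrow>
    norm (jline (1 + \<sigma> * h) - jline 1) \<le> C * h powr (3/2)"
    using jint_one_bound by blast
  have num: "0 \<le> (3/2 :: real)" "0 < (1/4 :: real)" by simp_all
  note T = jint_transfer[OF e(2) det j[unfolded j_def] assms(5) num C[OF _ _ assms(5)] h(1,3), folded j_def, unfolded z]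
  show ?thesis
  proof (rule that)
    show "filterlim (\<lambda>n. h n / (j * (j + real_of_int c * \<sigma> * h n))) (at_right 0) sequentially"
      using T(1) by simp
    show "sqrt j / j\<^sup>2 * j\<^sup>2 powr (3/2) * K > 0" using j h(2) by simp
    have "e * of_real (sqrt j / j\<^sup>2 * j\<^sup>2 powr (3/2)) * (of_real K * (v / e)) = of_real (sqrt j / j\<^sup>2 * j\<^sup>2 powr (3/2) * K) * v"
      using ne by auto
    then show "(\<lambda>n. (jline (z + \<sigma> * (h n / (j * (j + real_of_int c * \<sigma> * h n)))) - jline z) /
        of_real ((h n / (j * (j + real_of_int c * \<sigma> * h n))) powr (3/2))) \<longlonglongrightarrow> of_real (sqrt j / j\<^sup>2 * j\<^sup>2 powr (3/2) * K) * v"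
      using T(2) by (simp only:)
  qed
qed

section \<open>Blow-up at irrational points\<close>

text \<open>A stage of the even continued fraction: z is the image of the remainder y under the
  matrix, written without division. The ordering of c and d serves to bound c by a multiple of the
  denominator at y.\<close>

definition cf_state :: "real \<Rightarrow> int \<Rightarrow> int \<Rightarrow> int \<Rightarrow> int \<Rightarrow> real \<Rightarrow> bool" where
  "cf_state z a b c d y \<longleftrightarrow> theta_group a b c d \<and> y \<notin> \<rat> \<and> \<bar>y\<bar> < 1 \<and> \<bar>c\<bar> \<le> \<bar>d\<bar> \<and>
     of_int c * y + of_int d \<noteq> 0 \<and> z * (of_int c * y + of_int d) = of_int a * y + of_int b"

text \<open>One step y = - 1 / (y' + 2 k), appended on the right of the matrix.\<close>

lemma cf_step:
  assumes "cf_state z a b c d y" "\<bar>- 1 / y - 2 * of_int k\<bar> < 1"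
  defines "y' \<equiv> - 1 / y - 2 * of_int k"
  shows "cf_state z b (- a + 2 * k * b) d (- c + 2 * k * d) y'"
    and "\<bar>of_int d * y' + of_int (- c + 2 * k * d)\<bar> = \<bar>of_int c * y + of_int d\<bar> / \<bar>y\<bar>"
proof -
  have S: "theta_group a b c d" "y \<notin> \<rat>" "\<bar>y\<bar> < 1" "\<bar>c\<bar> \<le> \<bar>d\<bar>" "of_int c * y + of_int d \<noteq> 0"
    "z * (of_int c * y + of_int d) = of_int a * y + of_int b"
    using assms(1) by (simp_all add: cf_state_def)
  have y0: "y \<noteq> 0" using S(2) by auto
  have "theta_group b (- a + 2 * k * b) d (- c + 2 * k * d)"
    using theta_group.translation[OF theta_group.inversion[OF S(1)], of k] by simp
  moreover have "y' \<notin> \<rat>"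
  proof
    assume "y' \<in> \<rat>"
    then have "- 1 / (y' + 2 * of_int k) \<in> \<rat>" by (intro Rats_divide Rats_add) auto
    moreover have "- 1 / (y' + 2 * of_int k) = y" using y0 by (simp add: y'_def)
    ultimately have "y \<in> \<rat>" by (simp only:)
    then show False using S(2) by blast
  qed
  \<comment> \<open>A vanishing quotient would require 1 / |y| < 1. A nonzero one keeps the bottom
    row ordered, since |2 k d| is at least 2 |d|.\<close>
  moreover have "k \<noteq> 0"
  proof
    assume "k = 0"
    then have "1 / \<bar>y\<bar> < 1" using assms(2) by simp
    then show False using S(3) y0 by (simp add: field_simps)
  qed
  then have "\<bar>d\<bar> \<le> \<bar>- c + 2 * k * d\<bar>"
  proof -
    have "\<bar>d\<bar> * 1 \<le> \<bar>d\<bar> * \<bar>k\<bar>" using \<open>k \<noteq> 0\<close> by (intro mult_left_mono) auto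
    moreover have "\<bar>2 * k * d\<bar> \<le> \<bar>- c + 2 * k * d\<bar> + \<bar>c\<bar>" by linarith
    moreover have "\<bar>2 * k * d\<bar> = 2 * (\<bar>d\<bar> * \<bar>k\<bar>)" by (simp add: abs_mult)
    ultimately show ?thesis using S(4) by linarith
  qed
  moreover have j: "of_int d * y' + of_int (- c + 2 * k * d) = - (of_int c * y + of_int d) / y"
    using y0 by (simp add: y'_def field_simps)
  moreover have "of_int b * y' + of_int (- a + 2 * k * b) = - (of_int a * y + of_int b) / y"
    using y0 by (simp add: y'_def field_simps)
  moreover have "z * (- (of_int c * y + of_int d) / y) = - (of_int a * y + of_int b) / y"
    using S(6) by (metis mult_minus_right times_divide_eq_right)
  ultimately show "cf_state z b (- a + 2 * k * b) d (- c + 2 * k * d) y'"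
    unfolding cf_state_def using assms(2) S(5) y0 by (simp add: y'_def)
  show "\<bar>of_int d * y' + of_int (- c + 2 * k * d)\<bar> = \<bar>of_int c * y + of_int d\<bar> / \<bar>y\<bar>"
    unfolding j by (simp only: abs_divide abs_minus_cancel)
qed

lemma even_integer_near:
  fixes x :: real
  assumes "x \<notin> \<rat>"
  obtains k :: int where "\<bar>x - 2 * of_int k\<bar> < 1"
proof -
  have "\<bar>of_int (round (x / 2)) - x / 2\<bar> \<le> 1 / 2" by (rule of_int_round_abs_le)
  then have "\<bar>x - 2 * of_int (round (x / 2))\<bar> \<le> 1" by linarith
  moreover have "\<bar>x - 2 * of_int (round (x / 2))\<bar> \<noteq> 1"
  proof
    assume "\<bar>x - 2 * of_int (round (x / 2))\<bar> = 1"
    then have "x = of_int (2 * round (x / 2) + 1) \<or> x = of_int (2 * round (x / 2) - 1)" by auto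
    then show False using assms by (metis Rats_of_int)
  qed
  ultimately have "\<bar>x - 2 * of_int (round (x / 2))\<bar> < 1" by linarith
  then show ?thesis by (rule that)
qed

text \<open>Near the parabolic fixed points \<open>\<plusminus>1\<close> each step lowers \<open>1 / (1 - \<bar>y\<bar>)\<close> by exactly one.\<close>

lemma cf_leave_parabolic:
  assumes "cf_state z a b c d y" "1 / (1 - \<bar>y\<bar>) \<le> real n"
  shows "\<exists>a' b' c' d' y'. cf_state z a' b' c' d' y' \<and> \<bar>y'\<bar> \<le> 1 / 2 \<and>
    \<bar>of_int c * y + of_int d\<bar> \<le> \<bar>of_int c' * y' + of_int d'\<bar>"
  using assms
proof (induction n arbitrary: a b c d y)
  case 0
  have "\<bar>y\<bar> < 1" using 0 by (simp add: cf_state_def)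
  then have "0 < 1 / (1 - \<bar>y\<bar>)" by simp
  then show ?case using 0 by simp
next
  case (Suc n)
  show ?case
  proof (cases "\<bar>y\<bar> \<le> 1 / 2")
    case True
    then show ?thesis using Suc.prems by blast
  next
    case False
    have y1: "\<bar>y\<bar> < 1" using Suc.prems by (simp add: cf_state_def)
    \<comment> \<open>For 1/2 < |y| < 1 this is half the even integer nearest to - 1 / y.\<close>
    define k :: int where "k = (if y > 0 then -1 else 1)"
    define y' where "y' = - 1 / y - 2 * of_int k"
    have y': "\<bar>y'\<bar> = 2 - 1 / \<bar>y\<bar>"
    proof -
      have "1 / \<bar>y\<bar> < 2" using False by (simp add: field_simps)
      then show ?thesis using False by (auto simp: y'_def k_def abs_if field_simps split: if_splits)
    qed
    have "1 / \<bar>y\<bar> > 1" using y1 False by (simp add: field_simps)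
    then have lt: "\<bar>y'\<bar> < 1" unfolding y' by simp
    note step = cf_step[OF Suc.prems(1) lt[unfolded y'_def], folded y'_def]
    have "1 / (1 - \<bar>y'\<bar>) = 1 / (1 - \<bar>y\<bar>) - 1"
      unfolding y' using y1 False by (simp add: field_simps)
    then have "1 / (1 - \<bar>y'\<bar>) \<le> real n" using Suc.prems(2) by simp
    from Suc.IH[OF step(1) this] obtain a' b' c' d' z' where
      n: "cf_state z a' b' c' d' z'" "\<bar>z'\<bar> \<le> 1 / 2" "\<bar>of_int d * y' + of_int (- c + 2 * k * d)\<bar> \<le> \<bar>of_int c' * z' + of_int d'\<bar>"
      by blast
    have "\<bar>of_int c * y + of_int d\<bar> * \<bar>y\<bar> \<le> \<bar>of_int c * y + of_int d\<bar> * 1"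
      using y1 by (intro mult_left_mono) auto
    then have "\<bar>of_int c * y + of_int d\<bar> \<le> \<bar>of_int c * y + of_int d\<bar> / \<bar>y\<bar>"
      using False by (simp add: field_simps)
    with n step(2) show ?thesis by (metis order_trans)
  qed
qed

text \<open>From |y| \<le> 1/2 one step at least doubles the denominator, and the steps that bring
  the remainder back to |y| \<le> 1/2 do not decrease it. The bound on the remainder is kept because
  it also bounds \<open>\<kappa>\<close> in \<open>blowup_scaling\<close>.\<close>

lemma cf_unbounded:
  assumes "z \<notin> \<rat>"
  shows "\<exists>a b c d y. cf_state z a b c d y \<and> \<bar>y\<bar> \<le> 1 / 2 \<and> \<bar>of_int c * y + of_int d\<bar> \<ge> 2 ^ n"
proof (induction n)
  case 0
  obtain k :: int where k: "\<bar>z - 2 * of_int k\<bar> < 1" using even_integer_near[OF assms] by blast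
  have "theta_group 1 (2 * k) 0 1" using theta_group.translation[OF theta_group.one, of k] by simp
  moreover have "z - 2 * of_int k \<notin> \<rat>"
  proof
    assume "z - 2 * of_int k \<in> \<rat>"
    then have "z - 2 * of_int k + 2 * of_int k \<in> \<rat>" by (intro Rats_add) auto
    then show False using assms by simp
  qed
  ultimately have "cf_state z 1 (2 * k) 0 1 (z - 2 * of_int k)" using k by (simp add: cf_state_def)
  moreover obtain n :: nat where "1 / (1 - \<bar>z - 2 * of_int k\<bar>) \<le> real n" using real_arch_simple by blast
  ultimately show ?case using cf_leave_parabolic by fastforce
next
  case (Suc n)
  then obtain a b c d y where s: "cf_state z a b c d y" "\<bar>y\<bar> \<le> 1 / 2" "\<bar>of_int c * y + of_int d\<bar> \<ge> 2 ^ n" by blast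
  have y: "y \<notin> \<rat>" "y \<noteq> 0" using s(1) by (auto simp: cf_state_def)
  have "- 1 / y \<notin> \<rat>"
  proof
    assume "- 1 / y \<in> \<rat>"
    then have "- 1 / (- 1 / y) \<in> \<rat>" by (rule Rats_divide[rotated]) simp
    moreover have "- 1 / (- 1 / y) = y" using y by simp
    ultimately have "y \<in> \<rat>" by (simp only:)
    then show False using y by blast
  qed
  then obtain k :: int where k: "\<bar>- 1 / y - 2 * of_int k\<bar> < 1" using even_integer_near by blast
  note step = cf_step[OF s(1) k]
  obtain m :: nat where "1 / (1 - \<bar>- 1 / y - 2 * of_int k\<bar>) \<le> real m" using real_arch_simple by blast
  from cf_leave_parabolic[OF step(1) this] obtain a' b' c' d' y' where
    t: "cf_state z a' b' c' d' y'" "\<bar>y'\<bar> \<le> 1 / 2"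
      "\<bar>of_int c * y + of_int d\<bar> / \<bar>y\<bar> \<le> \<bar>of_int c' * y' + of_int d'\<bar>"
    unfolding step(2) by blast
  have "2 ^ Suc n \<le> 2 * \<bar>of_int c * y + of_int d\<bar>" using s(3) by simp
  also have "\<dots> \<le> \<bar>of_int c * y + of_int d\<bar> / \<bar>y\<bar>"
    using s(2) y mult_left_mono[of "\<bar>y\<bar> * 2" 1 "\<bar>of_int c * y + of_int d\<bar>"] by (simp add: field_simps)
  finally show ?case using t by (meson order_trans)
qed

text \<open>The bracket in \<open>jint_mobius\<close> at the base point y with
  \<open>k = jline y\<close>, after the powers of j = c y + d have been taken out; \<kappa> = c / j
  is all that remains of the matrix.\<close>

definition blowup :: "real \<Rightarrow> real \<Rightarrow> real \<Rightarrow> complex" where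
  "blowup y \<kappa> h = of_real (sqrt (1 + \<kappa> * h) / (1 + \<kappa> * h)\<^sup>2) * (jline (y + h) - jline y)
     + of_real (3 / 2 * \<kappa> * h) * integral {0..1} (\<lambda>s. of_real (sqrt (1 + \<kappa> * (s * h)) / (1 + \<kappa> * (s * h)) ^ 3)
         * (jline (y + s * h) - jline y))"

text \<open>The window |h| \<le> 1/4 is tied to the bound 2 on \<open>\<kappa>\<close>: 1 - 2 * 1/4
  = 1/2.\<close>

lemma blowup_denominator_pos:
  fixes \<kappa> h s :: real
  assumes "\<bar>\<kappa>\<bar> \<le> 2" "\<bar>h\<bar> \<le> 1 / 4" "s \<in> {0..1}"
  shows "1 + \<kappa> * (s * h) \<ge> 1 / 2"
proof -
  have "\<bar>s * h\<bar> \<le> 1 * (1 / 4)" unfolding abs_mult using assms by (intro mult_mono) auto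
  then have "\<bar>\<kappa> * (s * h)\<bar> \<le> 2 * (1 / 4)" unfolding abs_mult[of \<kappa>] using assms by (intro mult_mono) auto
  then show ?thesis by linarith
qed

text \<open>Increments of \<open>jint\<close> at z over distances of order j^(-2) copy a curve of
  fixed size, scaled by j^(-3/2) and turned by \<open>\<epsilon>\<close>. The bound on
  \<open>\<kappa>\<close> follows from |c| \<le> |d| \<le> j + |c y| \<le> j + |c| / 2.\<close>

lemma blowup_scaling:
  assumes st: "cf_state z a b c d y" and y: "\<bar>y\<bar> \<le> 1 / 2" and mult: "theta_multiplier a b c d \<epsilon>"
  defines "j \<equiv> of_int c * y + of_int d"
  assumes j: "j > 0"
  defines "\<kappa> \<equiv> of_int c / j"
  shows "\<bar>\<kappa>\<bar> \<le> 2"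
    and "\<bar>h\<bar> \<le> 1 / 4 \<Longrightarrow> jline (z + h / (j\<^sup>2 * (1 + \<kappa> * h))) - jline z
          = \<epsilon> * of_real (sqrt j / j\<^sup>2) * blowup y \<kappa> h"
proof -
  have S: "theta_group a b c d" "\<bar>c\<bar> \<le> \<bar>d\<bar>" "z * j = of_int a * y + of_int b"
    using st by (simp_all add: cf_state_def j_def)
  have det: "a * d - b * c = 1" by (rule theta_group_det[OF S(1)])
  have "\<bar>of_int c * y\<bar> \<le> \<bar>of_int c\<bar> * (1 / 2)" unfolding abs_mult using y by (intro mult_left_mono) auto
  moreover have "\<bar>real_of_int c\<bar> \<le> \<bar>real_of_int d\<bar>" using S(2) by linarith
  moreover have "\<bar>real_of_int d\<bar> \<le> j + \<bar>of_int c * y\<bar>" using j by (simp add: j_def)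
  ultimately have "\<bar>real_of_int c\<bar> \<le> 2 * j" by linarith
  then show \<kappa>: "\<bar>\<kappa>\<bar> \<le> 2" using j by (simp add: \<kappa>_def field_simps)
  have ck: "real_of_int c = \<kappa> * j" using j by (simp add: \<kappa>_def)
  have J: "of_int c * (y + u) + of_int d = j * (1 + \<kappa> * u)" for u
  proof -
    have "of_int c * (y + u) + of_int d = j + of_int c * u" by (simp add: j_def algebra_simps)
    then show ?thesis by (simp add: ck algebra_simps)
  qed
  assume h: "\<bar>h\<bar> \<le> 1 / 4"
  have pos: "1 + \<kappa> * (s * h) > 0" if "s \<in> {0..1}" for s
    using blowup_denominator_pos[OF \<kappa> h that] by linarith
  have pos1: "1 + \<kappa> * h > 0" using pos[of 1] by simp
  have g0: "(of_int a * y + of_int b) / (of_int c * y + of_int d) = z"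
    using S(3) j by (simp add: j_def field_simps)
  have gh: "(of_int a * (y + h) + of_int b) / (of_int c * (y + h) + of_int d) = z + h / (j\<^sup>2 * (1 + \<kappa> * h))"
  proof -
    have "(of_int a * (y + h) + of_int b) * j = z * j * (j + of_int c * h) + h * of_int (a * d - b * c)"
      unfolding S(3) by (simp add: j_def algebra_simps)
    then have e: "(of_int a * (y + h) + of_int b) * j = z * j * (j * (1 + \<kappa> * h)) + h"
      using det by (simp add: ck algebra_simps)
    have "A / (j * k) = z + h / (j\<^sup>2 * k)" if "A * j = z * j * (j * k) + h" "k > 0" for A k
      using that j by (simp add: field_simps power2_eq_square)
    from this[OF e pos1] show ?thesis unfolding J .
  qed
  have w2: "sqrt (j * k) / (j * k)\<^sup>2 = sqrt j / j\<^sup>2 * (sqrt k / k\<^sup>2)" for k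
    by (simp add: real_sqrt_mult power_mult_distrib)
  have w3: "of_int c * (sqrt (j * k) / (j * k) ^ 3) = sqrt j / j\<^sup>2 * (\<kappa> * (sqrt k / k ^ 3))" for k
    using j by (simp add: real_sqrt_mult power_mult_distrib ck eval_nat_numeral field_simps)
  define q where "q s = of_real (sqrt (1 + \<kappa> * (s * h)) / (1 + \<kappa> * (s * h)) ^ 3) * (jline (y + s * h) - jline y)" for s
  have "of_real (3 / 2 * of_int c * h) * integral {0..1} (\<lambda>s. of_real (sqrt (j * (1 + \<kappa> * (s * h))) / (j * (1 + \<kappa> * (s * h))) ^ 3) * (jline (y + s * h) - jline y))
    = integral {0..1} (\<lambda>s. of_real (3 / 2 * of_int c * h) * (of_real (sqrt (j * (1 + \<kappa> * (s * h))) / (j * (1 + \<kappa> * (s * h))) ^ 3) * (jline (y + s * h) - jline y)))"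
    by (rule integral_mult_right[symmetric])
  also have "\<dots> = integral {0..1} (\<lambda>s. of_real (sqrt j / j\<^sup>2 * (3 / 2 * \<kappa> * h)) * q s)"
  proof (rule arg_cong[where f = "integral {0..1}"], rule ext)
    fix s
    have "3 / 2 * of_int c * h * (sqrt (j * (1 + \<kappa> * (s * h))) / (j * (1 + \<kappa> * (s * h))) ^ 3)
      = 3 / 2 * h * (of_int c * (sqrt (j * (1 + \<kappa> * (s * h))) / (j * (1 + \<kappa> * (s * h))) ^ 3))" by (simp only: mult_ac)
    also have "\<dots> = sqrt j / j\<^sup>2 * (3 / 2 * \<kappa> * h) * (sqrt (1 + \<kappa> * (s * h)) / (1 + \<kappa> * (s * h)) ^ 3)"
      unfolding w3 by (simp only: mult_ac)
    finally show "of_real (3 / 2 * of_int c * h) * (of_real (sqrt (j * (1 + \<kappa> * (s * h))) / (j * (1 + \<kappa> * (s * h))) ^ 3) * (jline (y + s * h) - jline y))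
       = of_real (sqrt j / j\<^sup>2 * (3 / 2 * \<kappa> * h)) * q s"
      unfolding q_def mult.assoc[symmetric] of_real_mult[symmetric] by (simp only:)
  qed
  also have "\<dots> = of_real (sqrt j / j\<^sup>2) * (of_real (3 / 2 * \<kappa> * h) * integral {0..1} q)"
    by (simp only: integral_mult_right of_real_mult mult.assoc)
  finally have I: "of_real (3 / 2 * of_int c * h) * integral {0..1} (\<lambda>s. of_real (sqrt (j * (1 + \<kappa> * (s * h))) / (j * (1 + \<kappa> * (s * h))) ^ 3) * (jline (y + s * h) - jline y))
    = of_real (sqrt j / j\<^sup>2) * (of_real (3 / 2 * \<kappa> * h) * integral {0..1} q)" .
  have p0: "of_int c * y + of_int d > 0" using j by (simp add: j_def)
  have p1: "of_int c * (y + h) + of_int d > 0" unfolding J using j pos1 by simp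
  have "jline (z + h / (j\<^sup>2 * (1 + \<kappa> * h))) - jline z =
    \<epsilon> * (of_real (sqrt (j * (1 + \<kappa> * h)) / (j * (1 + \<kappa> * h))\<^sup>2) * (jline (y + h) - jline y)
       + of_real (3 / 2 * of_int c * h) * integral {0..1} (\<lambda>s. of_real (sqrt (j * (1 + \<kappa> * (s * h))) / (j * (1 + \<kappa> * (s * h))) ^ 3) * (jline (y + s * h) - jline y)))"
    using jint_mobius[OF mult det p0 p1, of "jline y"] unfolding gh g0 unfolding J by simp
  also have "\<dots> = \<epsilon> * of_real (sqrt j / j\<^sup>2) * blowup y \<kappa> h"
    unfolding I w2 blowup_def q_def[abs_def] of_real_mult[of "sqrt j / j\<^sup>2"] by (simp only: distrib_left mult.assoc)
  finally show "jline (z + h / (j\<^sup>2 * (1 + \<kappa> * h))) - jline z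
          = \<epsilon> * of_real (sqrt j / j\<^sup>2) * blowup y \<kappa> h" .
qed

section \<open>Regularity and corners of the rescaled curve\<close>

lemma continuous_on_jint_of_real: "continuous_on A (\<lambda>x. jline x)"
  by (rule continuous_on_compose2[OF continuous_on_jint]) (auto intro!: continuous_intros)

text \<open>Joint continuity in the three parameters lets the rescaled curves pass to the
  limit.\<close>

lemma continuous_on_blowup:
  "continuous_on (UNIV \<times> {- 2..2} \<times> {- 1/4..1/4}) (\<lambda>(y, \<kappa>, h). blowup y \<kappa> h)"
proof -
  let ?U = "UNIV \<times> {- 2..2} \<times> {- 1/4..1/4} :: (real \<times> real \<times> real) set"
  let ?D = "\<lambda>p s. 1 + fst (snd p) * (s * snd (snd p)) :: real"
  have pos: "?D p s > 0" if "p \<in> ?U" "s \<in> {0..1}" for p s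
    using blowup_denominator_pos[of "fst (snd p)" "snd (snd p)" s] that by force
  have pos1: "1 + fst (snd p) * snd (snd p) > 0" if "p \<in> ?U" for p using pos[OF that, of 1] by simp
  have cj: "continuous_on A (\<lambda>p. jline (f p))" if "continuous_on A f" for f and A :: "'a::topological_space set"
    by (rule continuous_on_compose2[OF continuous_on_jint_of_real[of UNIV] that]) simp
  have "continuous_on ?U (\<lambda>p. integral (cbox 0 1) (\<lambda>s. of_real (sqrt (?D p s) / ?D p s ^ 3)
         * (jline (fst p + s * snd (snd p)) - jline (fst p))))"
  proof (rule integral_continuous_on_param)
    have "continuous_on (?U \<times> cbox 0 1) (\<lambda>q. of_real (sqrt (?D (fst q) (snd q)) / ?D (fst q) (snd q) ^ 3)
         * (jline (fst (fst q) + snd q * snd (snd (fst q))) - jline (fst (fst q))))"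
      using pos by (intro continuous_intros cj) fastforce
    then show "continuous_on (?U \<times> cbox 0 1) (\<lambda>(p, s). of_real (sqrt (?D p s) / ?D p s ^ 3)
         * (jline (fst p + s * snd (snd p)) - jline (fst p)))"
      by (simp add: case_prod_unfold)
  qed
  then have I: "continuous_on ?U (\<lambda>p. integral {0..1} (\<lambda>s. of_real (sqrt (?D p s) / ?D p s ^ 3)
         * (jline (fst p + s * snd (snd p)) - jline (fst p))))" by simp
  have "continuous_on ?U (\<lambda>p. blowup (fst p) (fst (snd p)) (snd (snd p)))"
    unfolding blowup_def using pos1 by (intro continuous_intros cj I) fastforce
  then show ?thesis by (simp add: case_prod_unfold)
qed

text \<open>Differentiable summands are invisible at the scale sqrt r; this isolates the summand
  that has a corner.\<close>

lemma differentiable_increment_over_sqrt: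
  fixes G :: "real \<Rightarrow> complex"
  assumes G: "(G has_vector_derivative D) (at x)" and \<sigma>: "\<bar>\<sigma>\<bar> = 1"
  shows "((\<lambda>r. (G (x + \<sigma> * r) - G x) / of_real (sqrt r)) \<longlongrightarrow> 0) (at_right 0)"
proof -
  define e where "e y = norm (G y - G x - (y - x) *\<^sub>R D) / norm (y - x)" for y
  have e: "(e \<longlongrightarrow> 0) (at x)"
    using G unfolding has_vector_derivative_def has_derivative_iff_norm e_def by simp
  have "filterlim (\<lambda>r. x + \<sigma> * r) (at x) (at_right 0)"
  proof (rule filterlim_atI)
    show "((\<lambda>r. x + \<sigma> * r) \<longlongrightarrow> x) (at_right 0)" by (rule tendsto_eq_intros refl | simp)+
    show "\<forall>\<^sub>F r in at_right 0. x + \<sigma> * r \<noteq> x"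
      using eventually_at_right_less[of 0] by eventually_elim (use \<sigma> in auto)
  qed
  from filterlim_compose[OF e this] have e': "((\<lambda>r. e (x + \<sigma> * r)) \<longlongrightarrow> 0) (at_right 0)" .
  show ?thesis
  proof (rule Lim_null_comparison[where g = "\<lambda>r. sqrt r * (e (x + \<sigma> * r) + norm D)"])
    have "((\<lambda>r. sqrt r * (e (x + \<sigma> * r) + norm D)) \<longlongrightarrow> sqrt 0 * (0 + norm D)) (at_right 0)"
      by (intro tendsto_intros e')
    then show "((\<lambda>r. sqrt r * (e (x + \<sigma> * r) + norm D)) \<longlongrightarrow> 0) (at_right 0)" by simp
    show "\<forall>\<^sub>F r in at_right 0. norm ((G (x + \<sigma> * r) - G x) / of_real (sqrt r)) \<le> sqrt r * (e (x + \<sigma> * r) + norm D)"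
      using eventually_at_right_less[of 0]
    proof eventually_elim
      case (elim r)
      have r: "r = sqrt r * sqrt r" using elim by simp
      have "norm (G (x + \<sigma> * r) - G x) \<le> norm (G (x + \<sigma> * r) - G x - (\<sigma> * r) *\<^sub>R D) + norm ((\<sigma> * r) *\<^sub>R D)"
        by (metis diff_add_cancel norm_triangle_ineq)
      also have "norm (G (x + \<sigma> * r) - G x - (\<sigma> * r) *\<^sub>R D) = r * e (x + \<sigma> * r)"
        using elim \<sigma> by (simp add: e_def abs_mult)
      also have "norm ((\<sigma> * r) *\<^sub>R D) = r * norm D" using elim \<sigma> by (simp add: abs_mult)
      finally have "norm (G (x + \<sigma> * r) - G x) \<le> sqrt r * (sqrt r * (e (x + \<sigma> * r) + norm D))"
        by (subst (asm) (2 3) r) (simp only: distrib_left mult.assoc)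
      then show ?case using elim by (simp add: norm_divide divide_le_eq mult.commute)
    qed
  qed
qed

text \<open>The integral term and the prefactor are differentiable in h, so only the increment of
  \<open>jint\<close> can move at rate sqrt r; the corner is inherited up to a positive
  factor.\<close>

lemma blowup_corner:
  assumes \<kappa>: "\<bar>\<kappa>\<bar> \<le> 2" and h0: "\<bar>h0\<bar> < 1 / 4" and \<sigma>: "\<bar>\<sigma>\<bar> = 1"
    and L: "((\<lambda>r. (jline (y + h0 + \<sigma> * r) - jline (y + h0)) / of_real (sqrt r)) \<longlongrightarrow> L) (at_right 0)"
  shows "((\<lambda>r. (blowup y \<kappa> (h0 + \<sigma> * r) - blowup y \<kappa> h0) / of_real (sqrt r))
      \<longlongrightarrow> of_real (sqrt (1 + \<kappa> * h0) / (1 + \<kappa> * h0)\<^sup>2) * L) (at_right 0)"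
proof -
  define A where "A u = jline (y + u) - jline y" for u
  define m where "m u = sqrt (1 + \<kappa> * u) / (1 + \<kappa> * u)\<^sup>2" for u
  define f where "f u = of_real (sqrt (1 + \<kappa> * u) / (1 + \<kappa> * u) ^ 3) * A u" for u
  define I where "I u = integral {- 1/4..u} f" for u
  let ?T = "{- 1/4..1/4} :: real set"
  have pos: "1 + \<kappa> * u > 0" if "u \<in> ?T" for u
  proof -
    have "\<bar>u\<bar> \<le> 1 / 4" using that by auto
    from blowup_denominator_pos[OF \<kappa> this, of 1] have "1 + \<kappa> * u \<ge> 1 / 2" by simp
    then show ?thesis by linarith
  qed
  have cA: "continuous_on S A" for S
    unfolding A_def by (intro continuous_intros continuous_on_compose2[OF continuous_on_jint_of_real[of UNIV]]) auto
  have cf: "continuous_on ?T f"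
    unfolding f_def using pos by (intro continuous_intros cA) fastforce
  have dI: "(I has_vector_derivative f u) (at u within ?T)" if "u \<in> ?T" for u
    unfolding I_def by (rule integral_has_vector_derivative[OF cf that])
  \<comment> \<open>Substituting u = s * h turns the parametric integral into a difference of values
    of one primitive; starting \<open>I\<close> at - 1/4 covers negative h too.\<close>
  have prim: "blowup y \<kappa> h = of_real (m h) * A h + of_real (3 / 2 * \<kappa>) * (I h - I 0)" if h: "h \<in> ?T" for h
  proof -
    have mem: "s * h \<in> ?T" if "s \<in> {0..1}" for s
    proof -
      have "\<bar>s * h\<bar> \<le> 1 * (1 / 4)" unfolding abs_mult using that h by (intro mult_mono) auto
      then show ?thesis by (auto simp: abs_le_iff)
    qed
    have "((\<lambda>s. h *\<^sub>R f (s * h)) has_integral I (1 * h) - I (0 * h)) {0..1}"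
    proof (rule fundamental_theorem_of_calculus)
      fix s :: real assume s: "s \<in> {0..1}"
      have "((\<lambda>s. s * h) has_vector_derivative h) (at s within {0..1})"
        by (auto intro!: derivative_eq_intros)
      moreover have "(I has_vector_derivative f (s * h)) (at (s * h) within (\<lambda>s. s * h) ` {0..1})"
        by (rule has_vector_derivative_within_subset[OF dI[OF mem[OF s]]]) (use mem in auto)
      ultimately show "((\<lambda>s. I (s * h)) has_vector_derivative h *\<^sub>R f (s * h)) (at s within {0..1})"
        using vector_diff_chain_within by (fastforce simp: o_def)
    qed simp
    then have "integral {0..1} (\<lambda>s. h *\<^sub>R f (s * h)) = I (1 * h) - I (0 * h)" by (rule integral_unique)
    then have "of_real h * integral {0..1} (\<lambda>s. f (s * h)) = I h - I 0"
      by (simp only: scaleR_conv_of_real integral_mult_right mult_1 mult_zero_left)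
    then show ?thesis
      unfolding blowup_def m_def A_def[symmetric] f_def[symmetric] of_real_mult by (simp add: mult.assoc)
  qed
  \<comment> \<open>The differentiable part, from m(u) A(u) = m(u) (A(u) - A(h0)) + m(u)
    A(h0).\<close>
  define G where "G u = of_real (m u) * A h0 + of_real (3 / 2 * \<kappa>) * I u" for u
  have T: "h0 \<in> interior ?T" using h0 by (auto simp: interior_atLeastAtMost_real abs_less_iff)
  have T': "h0 \<in> ?T" using T interior_subset by blast
  have "\<exists>D. (G has_vector_derivative D) (at h0)"
  proof -
    have "\<exists>D. (m has_real_derivative D) (at h0)"
      unfolding m_def using pos[OF T'] by (intro exI) (rule derivative_eq_intros refl | simp)+
    then obtain D where "(m has_real_derivative D) (at h0)" ..
    then have "((\<lambda>u. complex_of_real (m u)) has_vector_derivative of_real D) (at h0)"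
      by (intro has_vector_derivative_of_real) (simp add: has_real_derivative_iff_has_vector_derivative)
    moreover have "(I has_vector_derivative f h0) (at h0)"
      using dI[OF T'] at_within_interior[OF T] by simp
    ultimately have "(G has_vector_derivative (of_real D * A h0 + of_real (3 / 2 * \<kappa>) * f h0)) (at h0)"
      unfolding G_def by (intro has_vector_derivative_add has_vector_derivative_mult_left has_vector_derivative_mult_right)
    then show ?thesis ..
  qed
  then obtain D where "(G has_vector_derivative D) (at h0)" ..
  from differentiable_increment_over_sqrt[OF this \<sigma>]
  have G0: "((\<lambda>r. (G (h0 + \<sigma> * r) - G h0) / of_real (sqrt r)) \<longlongrightarrow> 0) (at_right 0)" .
  have lin: "((\<lambda>r. h0 + \<sigma> * r) \<longlongrightarrow> h0) (at_right 0)" by (rule tendsto_eq_intros refl | simp)+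
  have m0: "((\<lambda>r. m (h0 + \<sigma> * r)) \<longlongrightarrow> m h0) (at_right 0)"
    unfolding m_def using pos[OF T'] by (intro tendsto_intros lin) auto
  have "((\<lambda>r. of_real (m (h0 + \<sigma> * r)) * ((A (h0 + \<sigma> * r) - A h0) / of_real (sqrt r)) + (G (h0 + \<sigma> * r) - G h0) / of_real (sqrt r))
    \<longlongrightarrow> of_real (m h0) * L + 0) (at_right 0)"
    by (intro tendsto_intros m0 G0) (use L in \<open>simp add: A_def add.assoc\<close>)
  moreover have "\<forall>\<^sub>F r in at_right 0. of_real (m (h0 + \<sigma> * r)) * ((A (h0 + \<sigma> * r) - A h0) / of_real (sqrt r)) + (G (h0 + \<sigma> * r) - G h0) / of_real (sqrt r)
     = (blowup y \<kappa> (h0 + \<sigma> * r) - blowup y \<kappa> h0) / of_real (sqrt r)"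
  proof -
    have "\<forall>\<^sub>F r in at_right 0. h0 + \<sigma> * r < 1 / 4"
      by (rule order_tendstoD(2)[OF lin]) (use h0 in auto)
    moreover have "\<forall>\<^sub>F r in at_right 0. - 1 / 4 < h0 + \<sigma> * r"
      by (rule order_tendstoD(1)[OF lin]) (use h0 in auto)
    ultimately show ?thesis
    proof eventually_elim
      case (elim r)
      then have "h0 + \<sigma> * r \<in> ?T" by simp
      then show ?case
        unfolding prim[OF \<open>h0 + \<sigma> * r \<in> ?T\<close>] prim[OF T'] G_def
        by (simp add: add_divide_distrib[symmetric] algebra_simps)
    qed
  qed
  ultimately have "((\<lambda>r. (blowup y \<kappa> (h0 + \<sigma> * r) - blowup y \<kappa> h0) / of_real (sqrt r)) \<longlongrightarrow> of_real (m h0) * L + 0) (at_right 0)"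
    by (rule Lim_transform_eventually)
  then show ?thesis by (simp add: m_def)
qed

text \<open>Odd numerators over powers of 2 lie in the orbit of 0, so corners are dense. Consecutive
  odd numerators are 2 / q apart, less than b - a.\<close>

lemma dyadic_between:
  fixes a b :: real
  assumes "a < b"
  obtains p q :: int where "coprime p q" "q > 0" "even (p * q)" "a < of_int p / of_int q" "of_int p / of_int q < b"
proof -
  obtain k :: nat where k: "2 / (b - a) < 2 ^ k"
    using real_arch_pow[of 2 "2 / (b - a)"] by auto
  define q :: int where "q = 2 ^ Suc k"
  define A where "A = of_int q * a"
  define p where "p = 2 * \<lfloor>(A + 1) / 2\<rfloor> + 1"
  have q: "q > 0" by (simp add: q_def)
  have "2 < of_int q * (b - a)"
  proof -
    have "2 < 2 ^ k * (b - a)" using k assms by (simp add: field_simps)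
    also have "\<dots> \<le> of_int q * (b - a)" using assms by (simp add: q_def)
    finally show ?thesis .
  qed
  then have B: "A + 2 < of_int q * b" by (simp add: A_def algebra_simps)
  have "of_int \<lfloor>(A + 1) / 2\<rfloor> \<le> (A + 1) / 2" "(A + 1) / 2 < of_int \<lfloor>(A + 1) / 2\<rfloor> + 1" by linarith+
  moreover have "real_of_int p = 2 * of_int \<lfloor>(A + 1) / 2\<rfloor> + 1" by (simp add: p_def)
  ultimately have p: "A < of_int p" "of_int p \<le> A + 2" by argo+
  have "odd p" by (simp add: p_def)
  then have "coprime p q" by (simp add: q_def coprime_commute)
  moreover have "even (p * q)" by (simp add: q_def)
  moreover have "a < of_int p / of_int q" using p(1) q by (simp add: A_def field_simps)
  moreover have "of_int p / of_int q < b" using p(2) B q by (simp add: field_simps)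
  ultimately show ?thesis using that q by blast
qed

text \<open>Supplies the unit vector showing that the sector built in
  \<open>corner_directions\<close> is not empty.\<close>

lemma half_slope_in_sector:
  assumes "Re w > 0" "Im w / s = Re w / 2"
  shows "0 < Re (w / of_real (norm w)) \<and> 0 < Im (w / of_real (norm w)) / s \<and>
    Im (w / of_real (norm w)) / s < Re (w / of_real (norm w))"
proof -
  have "w \<noteq> 0" using assms(1) by auto
  then have N: "norm w > 0" by simp
  have "Im (w / of_real (norm w)) / s = (Im w / s) / norm w"
    by (simp add: Im_divide_of_real)
  also have "\<dots> = (Re w / norm w) / 2" unfolding assms(2) by simp
  finally have "Im (w / of_real (norm w)) / s = (Re w / norm w) / 2" .
  moreover have "Re (w / of_real (norm w)) = Re w / norm w" by (simp add: Re_divide_of_real)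
  moreover have "0 < Re w / norm w" using assms(1) N by (rule divide_pos_pos)
  ultimately show ?thesis by simp
qed

text \<open>The two one-sided tangents at a corner are orthogonal, so the ray from the origin through the
  corner cannot contain both branches of the curve.\<close>

lemma corner_directions:
  fixes f :: "real \<Rightarrow> complex"
  assumes cf: "continuous_on {\<alpha>..\<beta>} f" and x0: "\<alpha> < x0" "x0 < \<beta>" and f0: "f x0 \<noteq> 0"
    and right: "((\<lambda>r. (f (x0 + r) - f x0) / of_real (sqrt r)) \<longlongrightarrow> L) (at_right 0)"
    and left: "((\<lambda>r. (f (x0 - r) - f x0) / of_real (sqrt r)) \<longlongrightarrow> \<i> * L) (at_right 0)"
    and L: "L \<noteq> 0"
  obtains V where "openin (top_of_set (sphere 0 1)) V" "V \<noteq> {}"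
    "\<And>v. v \<in> V \<Longrightarrow> \<exists>x\<in>{\<alpha>..\<beta>}. f x \<noteq> 0 \<and> f x / of_real (norm (f x)) = v"
proof -
  \<comment> \<open>Dividing by \<open>f x0\<close> places the corner at 1 and the ray through it on
    the positive real axis.\<close>
  define g where "g x = f x / f x0" for x
  have cg: "continuous_on {\<alpha>..\<beta>} g" unfolding g_def using f0 by (intro continuous_intros cf) auto
  have g0: "g x0 = 1" using f0 by (simp add: g_def)
  have "isCont g x0"
    using cg x0 by (intro continuous_on_interior[OF cg]) (simp add: interior_atLeastAtMost_real)
  then have "((\<lambda>x. Re (g x)) \<longlongrightarrow> 1) (at x0)"
    unfolding isCont_def using tendsto_Re g0 by fastforce
  then have "\<forall>\<^sub>F x in at x0. 0 < Re (g x)" by (rule order_tendstoD) simp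
  then obtain d where d: "d > 0" "\<And>x. x \<noteq> x0 \<Longrightarrow> dist x x0 < d \<Longrightarrow> 0 < Re (g x)"
    unfolding eventually_at by blast
  define \<eta> where "\<eta> = min (d / 2) (min (x0 - \<alpha>) (\<beta> - x0))"
  have \<eta>: "\<eta> > 0" using d x0 by (simp add: \<eta>_def)
  have dom: "x \<in> {\<alpha>..\<beta>}" "0 < Re (g x)" if "\<bar>x - x0\<bar> \<le> \<eta>" for x
  proof -
    show "x \<in> {\<alpha>..\<beta>}" using that by (auto simp: \<eta>_def abs_le_iff)
    show "0 < Re (g x)" using that d(1) d(2)[of x] g0 by (cases "x = x0") (auto simp: \<eta>_def dist_real_def)
  qed
  \<comment> \<open>If the curve stayed on the ray, both one-sided tangents L and i L, divided by
    \<open>f x0\<close>, would be real, forcing L = 0.\<close>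
  have "\<exists>x1. \<bar>x1 - x0\<bar> \<le> \<eta> \<and> Im (g x1) \<noteq> 0"
  proof (rule ccontr)
    assume "\<not> (\<exists>x1. \<bar>x1 - x0\<bar> \<le> \<eta> \<and> Im (g x1) \<noteq> 0)"
    then have flat: "Im (g x) = 0" if "\<bar>x - x0\<bar> \<le> \<eta>" for x using that by blast
    have Im0: "Im (M / f x0) = 0"
      if lim: "((\<lambda>r. (f (x0 + \<sigma> * r) - f x0) / of_real (sqrt r)) \<longlongrightarrow> M) (at_right 0)" and \<sigma>: "\<bar>\<sigma>\<bar> = 1" for \<sigma> M
    proof -
      have "((\<lambda>r. Im ((f (x0 + \<sigma> * r) - f x0) / of_real (sqrt r) / f x0)) \<longlongrightarrow> Im (M / f x0)) (at_right 0)"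
        by (intro tendsto_intros lim f0)
      moreover have "\<forall>\<^sub>F r in at_right 0. Im ((f (x0 + \<sigma> * r) - f x0) / of_real (sqrt r) / f x0) = 0"
      proof (rule eventually_at_rightI[of 0 \<eta>])
        fix r :: real assume r: "r \<in> {0<..<\<eta>}"
        have "(f (x0 + \<sigma> * r) - f x0) / of_real (sqrt r) / f x0 = (g (x0 + \<sigma> * r) - 1) / of_real (sqrt r)"
          using f0 by (simp add: g_def field_simps)
        then show "Im ((f (x0 + \<sigma> * r) - f x0) / of_real (sqrt r) / f x0) = 0"
          using flat[of "x0 + \<sigma> * r"] r \<sigma> by (simp add: abs_mult Im_divide_of_real)
      qed (rule \<eta>)
      then have "((\<lambda>r. Im ((f (x0 + \<sigma> * r) - f x0) / of_real (sqrt r) / f x0)) \<longlongrightarrow> 0) (at_right 0)"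
        by (rule tendsto_eventually)
      ultimately show ?thesis using tendsto_unique[OF trivial_limit_at_right_real] by blast
    qed
    have "Im (L / f x0) = 0" using Im0[of 1 L] right by simp
    moreover have "Re (L / f x0) = 0"
    proof -
      have "Im (\<i> * w) = Re w" for w by simp
      moreover have "Im (\<i> * L / f x0) = 0" using Im0[of "-1" "\<i> * L"] left by simp
      ultimately show ?thesis by (simp only: times_divide_eq_right[symmetric])
    qed
    ultimately have "L / f x0 = 0" by (simp only: complex_eq_iff zero_complex.sel)
    then show False using L f0 by simp
  qed
  then obtain x1 where x1: "\<bar>x1 - x0\<bar> \<le> \<eta>" "Im (g x1) \<noteq> 0" by blast
  \<comment> \<open>With positive real part the slope determines the direction; it runs continuously
    from 0 at \<open>x0\<close> to its nonzero value at \<open>x1\<close>.\<close>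
  define \<tau> where "\<tau> x = Im (g x) / Re (g x)" for x
  define S where "S = closed_segment x0 x1"
  have S: "\<bar>x - x0\<bar> \<le> \<eta>" if "x \<in> S" for x
    using that x1(1) unfolding S_def closed_segment_eq_real_ivl by (auto split: if_splits)
  have c\<tau>: "continuous_on S \<tau>"
    unfolding \<tau>_def using dom S
    by (intro continuous_intros continuous_on_subset[OF cg]) fastforce+
  define s where "s = \<tau> x1"
  have s: "s \<noteq> 0" using x1 dom(2)[OF x1(1)] by (simp add: s_def \<tau>_def)
  have \<tau>0: "\<tau> x0 = 0" by (simp add: \<tau>_def g0)
  have ivt: "\<exists>x\<in>S. \<tau> x = t * s" if "0 \<le> t" "t \<le> 1" for t
  proof -
    have "connected (\<tau> ` S)" unfolding S_def by (rule connected_continuous_image[OF c\<tau>[unfolded S_def]]) simp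
    moreover have "0 \<in> \<tau> ` S" "s \<in> \<tau> ` S" unfolding S_def using \<tau>0 s_def by (auto intro: rev_image_eqI)
    ultimately have "closed_segment 0 s \<subseteq> \<tau> ` S"
      unfolding connected_convex_1 by (rule closed_segment_subset[rotated 2])
    moreover have "t * s \<in> closed_segment 0 s"
      unfolding closed_segment_def using that by (auto intro!: exI[of _ t])
    ultimately have "t * s \<in> \<tau> ` S" by (rule subsetD)
    then show ?thesis by (elim imageE) (rule bexI, rule sym)
  qed
  define u where "u = f x0 / of_real (norm (f x0))"
  have u: "norm u = 1" "u \<noteq> 0" "f x0 = of_real (norm (f x0)) * u" using f0 by (auto simp: u_def norm_divide)
  \<comment> \<open>The open sector of slopes strictly between 0 and s; dividing by s treats both
    signs of s at once.\<close>
  define W where "W = {v. 0 < Re (v / u) \<and> 0 < Im (v / u) / s \<and> Im (v / u) / s < Re (v / u)}"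
  have "open W"
    unfolding W_def using u s by (intro open_Collect_conj open_Collect_less continuous_intros) auto
  have hit: "\<exists>x\<in>{\<alpha>..\<beta>}. f x \<noteq> 0 \<and> f x / of_real (norm (f x)) = v" if v: "v \<in> W" "norm v = 1" for v
  proof -
    define w where "w = v / u"
    have w: "0 < Re w" "0 < Im w / s" "Im w / s < Re w" using v by (auto simp: W_def w_def)
    have "0 \<le> t / R \<and> t / R \<le> 1" if "0 < t" "t < R" for t R :: real
      using that by simp
    from this[OF w(2,3)] have "0 \<le> Im w / s / Re w" "Im w / s / Re w \<le> 1" by blast+
    from ivt[OF this] obtain x where x: "x \<in> S" "\<tau> x = Im w / s / Re w * s" by blast
    have R: "Re (g x) > 0" using dom S x by blast
    have "Im (g x) / Re (g x) = Im w / Re w" using x(2) s by (simp add: \<tau>_def)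
    then have "Im (g x) = Re (g x) / Re w * Im w" using R w by (simp add: field_simps)
    then have g: "g x = of_real (Re (g x) / Re w) * w" using w by (simp add: complex_eq_iff)
    define \<rho> where "\<rho> = Re (g x) / Re w * norm (f x0)"
    have \<rho>: "\<rho> > 0" unfolding \<rho>_def using R w f0 by simp
    have "f x = g x * f x0" using f0 by (simp add: g_def)
    also have "\<dots> = of_real \<rho> * (w * u)" by (subst g, subst u(3)) (simp add: \<rho>_def)
    also have "w * u = v" using u by (simp add: w_def)
    finally have fx: "f x = of_real \<rho> * v" .
    then have "f x \<noteq> 0" "f x / of_real (norm (f x)) = v" using \<rho> v by (auto simp: norm_mult)
    moreover have "x \<in> {\<alpha>..\<beta>}" using dom S x by blast
    ultimately show ?thesis by blast
  qed
  obtain xm where xm: "xm \<in> S" "\<tau> xm = 1 / 2 * s" using ivt[of "1/2"] by auto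
  have ne: "sphere 0 1 \<inter> W \<noteq> {}"
  proof -
    have R: "Re (g xm) > 0" using dom S xm by blast
    have "p / s = q / 2" if "p / q = 1 / 2 * s" "q > 0" for p q
      using that s by (simp add: field_simps)
    from this[OF xm(2)[unfolded \<tau>_def] R] have I: "Im (g xm) / s = Re (g xm) / 2" .
    define v where "v = u * (g xm / of_real (norm (g xm)))"
    have gn: "g xm \<noteq> 0" using R by auto
    have vu: "v / u = g xm / of_real (norm (g xm))" using u by (simp add: v_def)
    have "norm v = 1" using u gn by (simp add: v_def norm_mult norm_divide)
    moreover have "v \<in> W"
      unfolding W_def mem_Collect_eq vu by (rule half_slope_in_sector[OF R I])
    ultimately have "v \<in> sphere 0 1 \<inter> W" unfolding Int_iff mem_sphere_0 by blast
    then show ?thesis by blast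
  qed
  show ?thesis
  proof (rule that[OF _ ne])
    show "openin (top_of_set (sphere 0 1)) (sphere 0 1 \<inter> W)" using \<open>open W\<close> by (rule openin_open_Int)
    fix v assume "v \<in> sphere 0 1 \<inter> W"
    then show "\<exists>x\<in>{\<alpha>..\<beta>}. f x \<noteq> 0 \<and> f x / of_real (norm (f x)) = v"
      unfolding Int_iff mem_sphere_0 using hit by blast
  qed
qed

section \<open>Directions of Riemann's function\<close>

text \<open>Remainders, ratios \<kappa> and multipliers range over a compact set, so a subsequence
  of the blow-ups converges. The limit data come before h in the statement: every h sees the same
  curve. The scale w is positive, so it does not affect directions.\<close>

lemma jint_blowup_limit:
  assumes z: "z \<notin> \<rat>"
  obtains y \<kappa> \<epsilon> where "\<bar>\<kappa>\<bar> \<le> 2" "norm \<epsilon> = 1"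
    "\<forall>h. \<bar>h\<bar> \<le> 1 / 4 \<longrightarrow> (\<exists>r w. r \<longlonglongrightarrow> 0 \<and> (\<forall>n. w n > (0::real)) \<and>
       (\<lambda>n. (jline (z + r n) - jline z) / of_real (w n)) \<longlonglongrightarrow> \<epsilon> * blowup y \<kappa> h)"
proof -
  define P where "P n y \<kappa> \<epsilon> j \<longleftrightarrow> \<bar>y\<bar> \<le> 1 / 2 \<and> \<bar>\<kappa>\<bar> \<le> 2 \<and> norm \<epsilon> = 1 \<and> j \<ge> 2 ^ n \<and>
      (\<forall>h. \<bar>h\<bar> \<le> 1 / 4 \<longrightarrow> jline (z + h / (j\<^sup>2 * (1 + \<kappa> * h))) - jline z
          = \<epsilon> * of_real (sqrt j / j\<^sup>2) * blowup y \<kappa> h)" for n :: nat and y \<kappa> j :: real and \<epsilon>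
  have "\<exists>y \<kappa> \<epsilon> j. P n y \<kappa> \<epsilon> j" for n
  proof -
    obtain a b c d y where s: "cf_state z a b c d y" "\<bar>y\<bar> \<le> 1 / 2" "\<bar>of_int c * y + of_int d\<bar> \<ge> 2 ^ n"
      using cf_unbounded[OF z, of n] by blast
    \<comment> \<open>A matrix and its negative act alike, so the denominator may be taken
      positive.\<close>
    have "\<exists>a b c d. cf_state z a b c d y \<and> of_int c * y + of_int d \<ge> 2 ^ n"
    proof (cases "of_int c * y + of_int d > 0")
      case True
      then show ?thesis using s by auto
    next
      case False
      have "cf_state z (- a) (- b) (- c) (- d) y"
        using s(1) theta_group_uminus[of a b c d] by (auto simp: cf_state_def algebra_simps)
      moreover have "of_int (- c) * y + of_int (- d) \<ge> 2 ^ n" using False s(3) by simp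
      ultimately show ?thesis by blast
    qed
    then obtain a b c d where st: "cf_state z a b c d y" "of_int c * y + of_int d \<ge> 2 ^ n" by blast
    have "theta_group a b c d" using st(1) by (simp add: cf_state_def)
    then obtain \<epsilon> where \<epsilon>: "\<epsilon> ^ 8 = 1" "theta_multiplier a b c d \<epsilon>" using theta_group_multiplier by blast
    have "norm \<epsilon> = 1"
      by (rule norm_eighth_root[OF \<epsilon>(1)])
    moreover have "of_int c * y + of_int d > 0"
      by (rule less_le_trans[OF _ st(2)]) simp
    note scaling = blowup_scaling[OF st(1) s(2) \<epsilon>(2) this]
    ultimately have "P n y (of_int c / (of_int c * y + of_int d)) \<epsilon> (of_int c * y + of_int d)"
      unfolding P_def using s(2) st(2) scaling(1) by (intro conjI allI impI scaling(2))
    then show ?thesis by blast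
  qed
  then obtain Y K E J where "\<And>n. P n (Y n) (K n) (E n) (J n)" by metis
  then have Q: "\<And>n. \<bar>Y n\<bar> \<le> 1 / 2" "\<And>n. \<bar>K n\<bar> \<le> 2" "\<And>n. norm (E n) = 1" "\<And>n. J n \<ge> 2 ^ n"
    "\<And>n h. \<bar>h\<bar> \<le> 1 / 4 \<Longrightarrow> jline (z + h / ((J n)\<^sup>2 * (1 + K n * h))) - jline z
          = E n * of_real (sqrt (J n) / (J n)\<^sup>2) * blowup (Y n) (K n) h"
    unfolding P_def by blast+
  define T where "T = ({- 1/2..1/2} :: real set) \<times> ({- 2..2} :: real set) \<times> (sphere 0 1 :: complex set)"
  have "compact T" unfolding T_def by (intro compact_Times compact_Icc compact_sphere)
  moreover have "\<forall>n. (Y n, K n, E n) \<in> T"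
  proof
    fix n
    show "(Y n, K n, E n) \<in> T" using Q(1-3)[of n] by (auto simp: T_def abs_le_iff)
  qed
  ultimately obtain l \<phi> where \<phi>: "l \<in> T" "strict_mono \<phi>" "((\<lambda>n. (Y n, K n, E n)) \<circ> \<phi>) \<longlonglongrightarrow> l"
    by (rule seq_compactE[OF compact_imp_seq_compact])
  obtain y \<kappa> \<epsilon> where l: "l = (y, \<kappa>, \<epsilon>)" by (metis surj_pair)
  have lims: "(\<lambda>n. Y (\<phi> n)) \<longlonglongrightarrow> y" "(\<lambda>n. K (\<phi> n)) \<longlonglongrightarrow> \<kappa>" "(\<lambda>n. E (\<phi> n)) \<longlonglongrightarrow> \<epsilon>"
    using tendsto_fst[OF \<phi>(3)] tendsto_fst[OF tendsto_snd[OF \<phi>(3)]] tendsto_snd[OF tendsto_snd[OF \<phi>(3)]]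
    unfolding l by (simp_all add: o_def)
  show ?thesis
  proof (rule that)
    show \<kappa>: "\<bar>\<kappa>\<bar> \<le> 2" and "norm \<epsilon> = 1" using \<phi>(1) by (auto simp: l T_def)
    show "\<forall>h. \<bar>h\<bar> \<le> 1 / 4 \<longrightarrow> (\<exists>r w. r \<longlonglongrightarrow> 0 \<and> (\<forall>n. w n > (0::real)) \<and>
       (\<lambda>n. (jline (z + r n) - jline z) / of_real (w n)) \<longlonglongrightarrow> \<epsilon> * blowup y \<kappa> h)"
    proof (intro allI impI)
      fix h :: real assume h: "\<bar>h\<bar> \<le> 1 / 4"
      define r where "r n = h / ((J (\<phi> n))\<^sup>2 * (1 + K (\<phi> n) * h))" for n
      define w where "w n = sqrt (J (\<phi> n)) / (J (\<phi> n))\<^sup>2" for n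
      have Jn: "J (\<phi> n) \<ge> 2 ^ n" for n
      proof -
        have "(2::real) ^ n \<le> 2 ^ \<phi> n" using seq_suble[OF \<phi>(2), of n] by (intro power_increasing) auto
        then show ?thesis using Q(4)[of "\<phi> n"] by linarith
      qed
      have J1: "J (\<phi> n) \<ge> 1" for n using Jn[of n] one_le_power[of "2::real" n] by linarith
      \<comment> \<open>Here |h| \<le> 1/2, the squared denominator is at least 2^n, and 1 +
        \<open>K (\<phi> n)\<close> * h is at least 1/2.\<close>
      have "r \<longlonglongrightarrow> 0"
      proof (rule Lim_null_comparison[where g = "\<lambda>n. (1/2) ^ n"])
        show "\<forall>\<^sub>F n in sequentially. norm (r n) \<le> (1/2) ^ n"
        proof (rule always_eventually, rule allI)
          fix n
          have k: "1 + K (\<phi> n) * h \<ge> 1 / 2" using blowup_denominator_pos[OF Q(2) h, of 1] by simp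
          have "2 ^ n * 1 \<le> J (\<phi> n) * J (\<phi> n)" using Jn[of n] J1[of n] by (intro mult_mono) auto
          then have "2 ^ n * (1 / 2) \<le> (J (\<phi> n))\<^sup>2 * (1 + K (\<phi> n) * h)"
            using k by (intro mult_mono) (auto simp: power2_eq_square)
          then have "\<bar>h\<bar> / ((J (\<phi> n))\<^sup>2 * (1 + K (\<phi> n) * h)) \<le> (1 / 2) / (2 ^ n * (1 / 2))"
            using h by (intro frac_le) auto
          moreover have "norm (r n) = \<bar>h\<bar> / ((J (\<phi> n))\<^sup>2 * (1 + K (\<phi> n) * h))"
            using k by (simp add: r_def abs_mult)
          ultimately show "norm (r n) \<le> (1/2) ^ n" by (simp add: power_one_over)
        qed
        show "(\<lambda>n. (1 / 2 :: real) ^ n) \<longlonglongrightarrow> 0" by (rule LIMSEQ_power_zero) simp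
      qed
      moreover have w: "w n > 0" for n using J1[of n] by (simp add: w_def)
      moreover have "(\<lambda>n. (jline (z + r n) - jline z) / of_real (w n)) \<longlonglongrightarrow> \<epsilon> * blowup y \<kappa> h"
      proof -
        have "(\<lambda>n. (\<lambda>(y, \<kappa>, h). blowup y \<kappa> h) (Y (\<phi> n), K (\<phi> n), h)) \<longlonglongrightarrow> (\<lambda>(y, \<kappa>, h). blowup y \<kappa> h) (y, \<kappa>, h)"
        proof (rule continuous_on_tendsto_compose[OF continuous_on_blowup])
          show "(\<lambda>n. (Y (\<phi> n), K (\<phi> n), h)) \<longlonglongrightarrow> (y, \<kappa>, h)" by (intro tendsto_Pair lims tendsto_const)
          show "(y, \<kappa>, h) \<in> UNIV \<times> {- 2..2} \<times> {- 1/4..1/4}" using \<kappa> h by (auto simp: abs_le_iff)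
          show "\<forall>\<^sub>F n in sequentially. (Y (\<phi> n), K (\<phi> n), h) \<in> UNIV \<times> {- 2..2} \<times> {- 1/4..1/4}"
          proof (rule always_eventually, rule allI)
            fix n
            show "(Y (\<phi> n), K (\<phi> n), h) \<in> UNIV \<times> {- 2..2} \<times> {- 1/4..1/4}"
              using Q(2)[of "\<phi> n"] h by (auto simp: abs_le_iff)
          qed
        qed
        then have "(\<lambda>n. E (\<phi> n) * blowup (Y (\<phi> n)) (K (\<phi> n)) h) \<longlonglongrightarrow> \<epsilon> * blowup y \<kappa> h"
          by (intro tendsto_mult lims) simp
        moreover have "E (\<phi> n) * blowup (Y (\<phi> n)) (K (\<phi> n)) h = (jline (z + r n) - jline z) / of_real (w n)" for n
          unfolding r_def Q(5)[OF h] w_def[symmetric] using w[of n] by simp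
        ultimately show ?thesis by (simp only:)
      qed
      ultimately show "\<exists>r w. r \<longlonglongrightarrow> 0 \<and> (\<forall>n. w n > (0::real)) \<and>
         (\<lambda>n. (jline (z + r n) - jline z) / of_real (w n)) \<longlonglongrightarrow> \<epsilon> * blowup y \<kappa> h" by blast
    qed
  qed
qed

text \<open>A zero of the curve has no direction, and the corner found first may be one. Its nonzero
  right tangent then keeps the curve off 0 just to the right of it, and density supplies another
  corner there.\<close>

lemma blowup_nonzero_corner:
  assumes \<kappa>: "\<bar>\<kappa>\<bar> \<le> 2"
  obtains h0 R where "\<bar>h0\<bar> < 1 / 4" "blowup y \<kappa> h0 \<noteq> 0" "R \<noteq> 0"
    "((\<lambda>r. (blowup y \<kappa> (h0 + r) - blowup y \<kappa> h0) / of_real (sqrt r)) \<longlongrightarrow> R) (at_right 0)"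
    "((\<lambda>r. (blowup y \<kappa> (h0 - r) - blowup y \<kappa> h0) / of_real (sqrt r)) \<longlongrightarrow> \<i> * R) (at_right 0)"
proof -
  have corner: "\<exists>h0 R. a < h0 \<and> h0 < b \<and> R \<noteq> 0 \<and>
    ((\<lambda>r. (blowup y \<kappa> (h0 + r) - blowup y \<kappa> h0) / of_real (sqrt r)) \<longlongrightarrow> R) (at_right 0) \<and>
    ((\<lambda>r. (blowup y \<kappa> (h0 - r) - blowup y \<kappa> h0) / of_real (sqrt r)) \<longlongrightarrow> \<i> * R) (at_right 0)"
    if ab: "a < b" "- 1 / 4 \<le> a" "b \<le> 1 / 4" for a b
  proof -
    obtain p q :: int where pq: "coprime p q" "q > 0" "even (p * q)" "y + a < of_int p / of_int q" "of_int p / of_int q < y + b"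
      using dyadic_between[of "y + a" "y + b"] ab by auto
    define h0 where "h0 = of_int p / of_int q - y"
    have yh: "y + h0 = of_int p / of_int q" by (simp add: h0_def)
    have ab_h0: "a < h0" "h0 < b" using pq(4,5) by (auto simp: h0_def)
    then have h0: "\<bar>h0\<bar> < 1 / 4" using ab unfolding abs_less_iff by linarith
    from jint_corner[OF pq(1-3), folded yh] obtain e K where e: "e ^ 8 = 1" "K > 0"
      "((\<lambda>r. (jline (y + h0 + r) - jline (y + h0)) / of_real (sqrt r)) \<longlongrightarrow> of_real K * (e * cis (pi / 4))) (at_right 0)"
      "((\<lambda>r. (jline (y + h0 - r) - jline (y + h0)) / of_real (sqrt r)) \<longlongrightarrow> - of_real K * (e * cis (- pi / 4))) (at_right 0)"
      by blast
    define m where "m = sqrt (1 + \<kappa> * h0) / (1 + \<kappa> * h0)\<^sup>2"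
    have "1 + \<kappa> * h0 \<ge> 1 / 2" using blowup_denominator_pos[OF \<kappa>, of h0 1] h0 by simp
    then have m: "m > 0" by (simp add: m_def)
    define R where "R = of_real m * (of_real K * (e * cis (pi / 4)))"
    have right: "((\<lambda>r. (jline (y + h0 + 1 * r) - jline (y + h0)) / of_real (sqrt r)) \<longlongrightarrow> of_real K * (e * cis (pi / 4))) (at_right 0)"
      using e(3) by simp
    have left: "((\<lambda>r. (jline (y + h0 + - 1 * r) - jline (y + h0)) / of_real (sqrt r)) \<longlongrightarrow> - of_real K * (e * cis (- pi / 4))) (at_right 0)"
      using e(4) by simp
    have "e \<noteq> 0" using e(1) by auto
    then have "R \<noteq> 0" using m e(2) by (simp add: R_def)
    moreover have "((\<lambda>r. (blowup y \<kappa> (h0 + r) - blowup y \<kappa> h0) / of_real (sqrt r)) \<longlongrightarrow> R) (at_right 0)"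
      using blowup_corner[OF \<kappa> h0 _ right, folded m_def] by (simp add: R_def)
    moreover have "((\<lambda>r. (blowup y \<kappa> (h0 - r) - blowup y \<kappa> h0) / of_real (sqrt r)) \<longlongrightarrow> of_real m * (- of_real K * (e * cis (- pi / 4)))) (at_right 0)"
      using blowup_corner[OF \<kappa> h0 _ left, folded m_def] by simp
    moreover have "of_real m * (- of_real K * (e * cis (- pi / 4))) = \<i> * R"
    proof -
      have "- cis (- pi / 4) = \<i> * cis (pi / 4)" by (simp add: complex_eq_iff cos_45 sin_45)
      then show ?thesis unfolding R_def by (metis (no_types, lifting) mult.left_commute mult_minus_left mult_minus_right)
    qed
    ultimately show ?thesis using ab_h0 by (intro exI[of _ h0] exI[of _ R]) (simp only: simp_thms)
  qed
  obtain h1 R where h1: "- 1 / 4 < h1" "h1 < 1 / 4" "R \<noteq> 0"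
    "((\<lambda>r. (blowup y \<kappa> (h1 + r) - blowup y \<kappa> h1) / of_real (sqrt r)) \<longlongrightarrow> R) (at_right 0)"
    "((\<lambda>r. (blowup y \<kappa> (h1 - r) - blowup y \<kappa> h1) / of_real (sqrt r)) \<longlongrightarrow> \<i> * R) (at_right 0)"
    using corner[of "- 1 / 4" "1 / 4"] by auto
  show ?thesis
  proof (cases "blowup y \<kappa> h1 = 0")
    case False
    show ?thesis by (rule that[of h1 R]) (use h1 False in \<open>auto simp: abs_less_iff\<close>)
  next
    case True
    have "\<forall>\<^sub>F r in at_right 0. (blowup y \<kappa> (h1 + r) - blowup y \<kappa> h1) / of_real (sqrt r) \<noteq> 0"
      by (rule tendsto_imp_eventually_ne[OF h1(4,3)])
    then obtain b where b: "b > 0" "\<And>r. 0 < r \<Longrightarrow> r < b \<Longrightarrow> blowup y \<kappa> (h1 + r) \<noteq> 0"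
      unfolding eventually_at_right_field True by auto
    obtain h0 R' where h0: "h1 < h0" "h0 < min (h1 + b) (1 / 4)" "R' \<noteq> 0"
      "((\<lambda>r. (blowup y \<kappa> (h0 + r) - blowup y \<kappa> h0) / of_real (sqrt r)) \<longlongrightarrow> R') (at_right 0)"
      "((\<lambda>r. (blowup y \<kappa> (h0 - r) - blowup y \<kappa> h0) / of_real (sqrt r)) \<longlongrightarrow> \<i> * R') (at_right 0)"
    proof -
      have "h1 < min (h1 + b) (1 / 4)" "- 1 / 4 \<le> h1" using b h1 by simp_all
      from corner[OF this min.cobounded2] show ?thesis using that by blast
    qed
    have "blowup y \<kappa> h0 \<noteq> 0" using b(2)[of "h0 - h1"] h0 by simp
    moreover have "\<bar>h0\<bar> < 1 / 4" using h0 h1 by auto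
    ultimately show ?thesis using that h0 by blast
  qed
qed

text \<open>Positive rescaling does not change directions, and a nonzero limit keeps the increments
  eventually nonzero.\<close>

lemma direction_tendsto:
  fixes X :: "'a \<Rightarrow> complex"
  assumes lim: "((\<lambda>t. X t / of_real (w t)) \<longlongrightarrow> L) F" and w: "\<forall>\<^sub>F t in F. w t > 0" and L: "L \<noteq> 0"
  shows "\<forall>\<^sub>F t in F. X t \<noteq> 0"
    and "((\<lambda>t. X t / of_real (norm (X t))) \<longlongrightarrow> L / of_real (norm L)) F"
proof -
  have "\<forall>\<^sub>F t in F. X t / of_real (w t) \<noteq> 0" by (rule tendsto_imp_eventually_ne[OF lim L])
  then show "\<forall>\<^sub>F t in F. X t \<noteq> 0" by eventually_elim auto
  have "((\<lambda>t. (X t / of_real (w t)) / of_real (norm (X t / of_real (w t)))) \<longlongrightarrow> L / of_real (norm L)) F"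
    by (intro tendsto_intros lim) (use L in auto)
  moreover have "\<forall>\<^sub>F t in F. (X t / of_real (w t)) / of_real (norm (X t / of_real (w t))) = X t / of_real (norm (X t))"
    using w by eventually_elim (simp add: norm_divide)
  ultimately show "((\<lambda>t. X t / of_real (norm (X t))) \<longlongrightarrow> L / of_real (norm L)) F"
    by (rule Lim_transform_eventually)
qed

section \<open>From the primitive back to \<open>riemann_phi\<close>\<close>

lemma eventually_shift_sequentially:
  assumes "\<forall>\<^sub>F n in sequentially. P n"
  obtains N where "\<And>n. P (n + N)"
  using assms unfolding eventually_sequentially by (metis le_add2)

definition jint_increment :: "real \<Rightarrow> real \<Rightarrow> complex" where
  "jint_increment x s = jline (- 2 * x - 4 * pi * s) - jline (- 2 * x)"

lemma riemann_increment:
  "riemann_phi (riemann_t x + s) - riemann_phi (riemann_t x) = - (\<i> / (4 * pi)) * jint_increment x s"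
proof -
  have "- 4 * pi * (riemann_t x + s) = - 2 * x - 4 * pi * s" "- 4 * pi * riemann_t x = - 2 * x"
    by (simp_all add: riemann_t_def field_simps)
  then show ?thesis unfolding riemann_phi_eq_jint jint_increment_def by (simp only: right_diff_distrib)
qed

lemma riemann_phi_eq_iff: "riemann_phi (riemann_t x + s) = riemann_phi (riemann_t x) \<longleftrightarrow> jint_increment x s = 0"
  using riemann_increment[of x s] by auto

text \<open>Only the phase - i of the factor - i / (4 pi) survives normalisation; a vanishing
  increment gives 0 on both sides by convention.\<close>

lemma riemann_dir_eq: "riemann_dir (riemann_t x) s = - \<i> * (jint_increment x s / of_real (norm (jint_increment x s)))"
proof (cases "jint_increment x s = 0")
  case False
  then show ?thesis unfolding riemann_dir_def riemann_increment by (simp add: norm_mult norm_divide)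
qed (simp add: riemann_dir_def riemann_increment)

lemma riemann_dir_tendsto:
  assumes "((\<lambda>t. jint_increment x (s t) / of_real (w t)) \<longlongrightarrow> of_real K * v) F"
    and "\<forall>\<^sub>F t in F. w t > 0" "K > 0" "norm v = 1"
  shows "\<forall>\<^sub>F t in F. riemann_phi (riemann_t x + s t) \<noteq> riemann_phi (riemann_t x)"
    and "((\<lambda>t. riemann_dir (riemann_t x) (s t)) \<longlongrightarrow> - \<i> * v) F"
proof -
  have nz: "of_real K * v \<noteq> 0" using assms(3,4) by auto
  note D = direction_tendsto[OF assms(1,2) nz]
  show "\<forall>\<^sub>F t in F. riemann_phi (riemann_t x + s t) \<noteq> riemann_phi (riemann_t x)"
    unfolding riemann_phi_eq_iff by (rule D(1))
  have "of_real K * v / of_real (norm (of_real K * v)) = v" using assms(3,4) by (simp add: norm_mult)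
  with D(2) show "((\<lambda>t. riemann_dir (riemann_t x) (s t)) \<longlongrightarrow> - \<i> * v) F"
    unfolding riemann_dir_eq by (intro tendsto_mult tendsto_const) simp
qed

text \<open>The decreasing change of variable exchanges the two tangents of \<open>jint\<close>;
  multiplication by - i then makes the same \<open>e\<close> fit both sides.\<close>

lemma riemann_corner:
  fixes p q :: int
  assumes "coprime p q" "q > 0" "even (p * q)" "- 2 * x = of_int p / of_int q"
  shows "\<exists>e. e \<in> sphere 0 1 \<and> e ^ 8 = 1 \<and>
    (\<forall>\<^sub>F r in at_right 0. riemann_phi (riemann_t x + r) \<noteq> riemann_phi (riemann_t x)) \<and>
    ((\<lambda>r. riemann_dir (riemann_t x) r) \<longlongrightarrow> e * ((1 + \<i>) / complex_of_real (sqrt 2))) (at_right 0) \<and>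
    (\<forall>\<^sub>F r in at_right 0. riemann_phi (riemann_t x - r) \<noteq> riemann_phi (riemann_t x)) \<and>
    ((\<lambda>r. riemann_dir (riemann_t x) (- r)) \<longlongrightarrow> e * ((1 - \<i>) / complex_of_real (sqrt 2))) (at_right 0)"
proof -
  define z where "z = - 2 * x"
  from jint_corner[OF assms(1-3), folded assms(4), folded z_def] obtain e K where e: "e ^ 8 = 1" "K > 0"
    "((\<lambda>r. (jline (z + r) - jline z) / of_real (sqrt r)) \<longlongrightarrow> of_real K * (e * cis (pi / 4))) (at_right 0)"
    "((\<lambda>r. (jline (z - r) - jline z) / of_real (sqrt r)) \<longlongrightarrow> - of_real K * (e * cis (- pi / 4))) (at_right 0)"
    by blast
  have ne: "norm e = 1"
    by (rule norm_eighth_root[OF e(1)])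
  have scale: "filterlim (\<lambda>r. 4 * pi * r) (at_right 0) (at_right (0::real))"
  proof (rule tendsto_imp_filterlim_at_right)
    show "((\<lambda>r. 4 * pi * r) \<longlongrightarrow> 0) (at_right 0)" by (rule tendsto_eq_intros refl | simp)+
    show "\<forall>\<^sub>F r in at_right 0. 0 < 4 * pi * r"
      using eventually_at_right_less[of 0] by eventually_elim simp
  qed
  have pos: "\<forall>\<^sub>F r in at_right 0. sqrt (4 * pi * r) > 0"
    using eventually_at_right_less[of 0] by eventually_elim simp
  have c1: "cis (pi / 4) = (1 + \<i>) / complex_of_real (sqrt 2)" and c2: "cis (- pi / 4) = (1 - \<i>) / complex_of_real (sqrt 2)"
    by (simp_all add: complex_eq_iff cos_45 sin_45 Re_divide_of_real Im_divide_of_real real_div_sqrt field_simps)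
  have c3: "- \<i> * (- (e * cis (- pi / 4))) = e * cis (pi / 4)" "- \<i> * (e * cis (pi / 4)) = e * cis (- pi / 4)"
  proof -
    have "\<i> * cis (- pi / 4) = cis (pi / 4)" "- \<i> * cis (pi / 4) = cis (- pi / 4)"
      by (simp_all add: complex_eq_iff cos_45 sin_45)
    then show "- \<i> * (- (e * cis (- pi / 4))) = e * cis (pi / 4)" "- \<i> * (e * cis (pi / 4)) = e * cis (- pi / 4)"
      by (metis mult.left_commute minus_mult_minus mult_minus_left)+
  qed
  have "((\<lambda>r. jint_increment x r / of_real (sqrt (4 * pi * r))) \<longlongrightarrow> of_real K * (- (e * cis (- pi / 4)))) (at_right 0)"
    using filterlim_compose[OF e(4) scale] by (simp add: jint_increment_def z_def)
  from riemann_dir_tendsto[OF this pos e(2)]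
  have right: "\<forall>\<^sub>F r in at_right 0. riemann_phi (riemann_t x + r) \<noteq> riemann_phi (riemann_t x)"
    "((\<lambda>r. riemann_dir (riemann_t x) r) \<longlongrightarrow> e * cis (pi / 4)) (at_right 0)"
    unfolding c3 using ne by (simp_all add: norm_mult)
  have "((\<lambda>r. jint_increment x (- r) / of_real (sqrt (4 * pi * r))) \<longlongrightarrow> of_real K * (e * cis (pi / 4))) (at_right 0)"
    using filterlim_compose[OF e(3) scale] by (simp add: jint_increment_def z_def)
  from riemann_dir_tendsto[OF this pos e(2)]
  have left: "\<forall>\<^sub>F r in at_right 0. riemann_phi (riemann_t x - r) \<noteq> riemann_phi (riemann_t x)"
    "((\<lambda>r. riemann_dir (riemann_t x) (- r)) \<longlongrightarrow> e * cis (- pi / 4)) (at_right 0)"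
    unfolding c3 using ne by (simp_all add: norm_mult)
  show ?thesis
    by (rule exI[of _ e]) (use e(1) ne right left c1 c2 in simp)
qed

lemma riemann_spiral:
  fixes p q :: int
  assumes "coprime p q" "q > 0" "odd (p * q)" "- 2 * x = of_int p / of_int q" "norm v = 1" "\<bar>\<sigma>\<bar> = 1"
  obtains r where "\<And>n. r n > (0::real)" "r \<longlonglongrightarrow> 0"
    "\<And>n. riemann_phi (riemann_t x + \<sigma> * r n) \<noteq> riemann_phi (riemann_t x)"
    "(\<lambda>n. riemann_dir (riemann_t x) (\<sigma> * r n)) \<longlonglongrightarrow> v"
proof -
  define z where "z = - 2 * x"
  \<comment> \<open>The factor i cancels the phase - i of \<open>riemann_dir_eq\<close>, and the
    sign of \<open>\<sigma>\<close> flips with the orientation.\<close>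
  have v: "norm (\<i> * v) = 1" and \<sigma>: "\<bar>- \<sigma>\<bar> = 1" using assms by (simp_all add: norm_mult)
  obtain r K where r: "filterlim r (at_right 0) sequentially" "K > 0"
    "(\<lambda>n. (jline (z + - \<sigma> * r n) - jline z) / of_real (r n powr (3/2))) \<longlonglongrightarrow> of_real K * (\<i> * v)"
    by (rule jint_spiral[OF assms(1-3) v \<sigma>, folded assms(4), folded z_def])
  define s where "s n = r n / (4 * pi)" for n
  have rpos: "\<forall>\<^sub>F n in sequentially. r n > 0" and r0: "r \<longlonglongrightarrow> 0"
    using r(1) by (auto simp: filterlim_at elim: eventually_mono)
  have "(\<lambda>n. jint_increment x (\<sigma> * s n) / of_real (r n powr (3/2))) \<longlonglongrightarrow> of_real K * (\<i> * v)"
    using r(3) by (simp add: jint_increment_def s_def z_def)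
  moreover have "\<forall>\<^sub>F n in sequentially. r n powr (3/2) > 0" using rpos by eventually_elim simp
  ultimately have D: "\<forall>\<^sub>F n in sequentially. riemann_phi (riemann_t x + \<sigma> * s n) \<noteq> riemann_phi (riemann_t x)"
    "(\<lambda>n. riemann_dir (riemann_t x) (\<sigma> * s n)) \<longlonglongrightarrow> v"
    using riemann_dir_tendsto[of x "\<lambda>n. \<sigma> * s n" "\<lambda>n. r n powr (3/2)" K "\<i> * v" sequentially] r(2) v by simp_all
  from eventually_conj[OF rpos D(1)] obtain N where N:
    "\<And>n. r (n + N) > 0 \<and> riemann_phi (riemann_t x + \<sigma> * s (n + N)) \<noteq> riemann_phi (riemann_t x)"
    using eventually_shift_sequentially by blast
  have "s \<longlonglongrightarrow> 0" using tendsto_divide[OF r0 tendsto_const[of "4 * pi"]] by (simp add: s_def[abs_def])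
  show ?thesis
  proof (rule that[of "\<lambda>n. s (n + N)"])
    show "s (n + N) > 0" "riemann_phi (riemann_t x + \<sigma> * s (n + N)) \<noteq> riemann_phi (riemann_t x)" for n
      using N[of n] by (simp_all add: s_def)
    show "(\<lambda>n. s (n + N)) \<longlonglongrightarrow> 0" by (rule LIMSEQ_ignore_initial_segment[OF \<open>s \<longlonglongrightarrow> 0\<close>])
    show "(\<lambda>n. riemann_dir (riemann_t x) (\<sigma> * s (n + N))) \<longlonglongrightarrow> v" by (rule LIMSEQ_ignore_initial_segment[OF D(2)])
  qed
qed

text \<open>Every direction of the limit curve is a limit of directions of increments at x, so the
  arc swept out at one of its corners serves. The phase - i and the limiting multiplier are merged
  into one factor \<open>u\<close> beforehand.\<close>

lemma riemann_irrational:
  assumes "x \<notin> \<rat>"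
  shows "\<exists>V. openin (top_of_set (sphere 0 1)) V \<and> V \<noteq> {} \<and>
    (\<forall>v\<in>V. \<exists>r. r \<longlonglongrightarrow> 0 \<and> (\<forall>n. riemann_phi (riemann_t x + r n) \<noteq> riemann_phi (riemann_t x)) \<and>
      (\<lambda>n. riemann_dir (riemann_t x) (r n)) \<longlonglongrightarrow> v)"
proof -
  define z where "z = - 2 * x"
  have "z \<notin> \<rat>"
  proof
    assume "z \<in> \<rat>"
    then have "z / (- 2) \<in> \<rat>" by (rule Rats_divide) simp
    then show False using assms by (simp add: z_def)
  qed
  then obtain y \<kappa> \<epsilon> where \<kappa>: "\<bar>\<kappa>\<bar> \<le> 2" and \<epsilon>: "norm \<epsilon> = 1"
    and lim: "\<forall>h. \<bar>h\<bar> \<le> 1 / 4 \<longrightarrow> (\<exists>r w. r \<longlonglongrightarrow> 0 \<and> (\<forall>n. w n > (0::real)) \<and>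
       (\<lambda>n. (jline (z + r n) - jline z) / of_real (w n)) \<longlonglongrightarrow> \<epsilon> * blowup y \<kappa> h)"
    by (rule jint_blowup_limit)
  obtain h0 R where h0: "\<bar>h0\<bar> < 1 / 4" "blowup y \<kappa> h0 \<noteq> 0" "R \<noteq> 0"
    "((\<lambda>r. (blowup y \<kappa> (h0 + r) - blowup y \<kappa> h0) / of_real (sqrt r)) \<longlongrightarrow> R) (at_right 0)"
    "((\<lambda>r. (blowup y \<kappa> (h0 - r) - blowup y \<kappa> h0) / of_real (sqrt r)) \<longlongrightarrow> \<i> * R) (at_right 0)"
    by (rule blowup_nonzero_corner[OF \<kappa>])
  define u where "u = - \<i> * \<epsilon>"
  have u: "u \<noteq> 0" using \<epsilon> by (auto simp: u_def)
  define f where "f h = u * blowup y \<kappa> h" for h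
  have cf: "continuous_on {- 1/4..1/4} f"
  proof -
    have "continuous_on {- 1/4..1/4} (\<lambda>h. (\<lambda>(y, \<kappa>, h). blowup y \<kappa> h) (y, \<kappa>, h))"
      by (rule continuous_on_compose2[OF continuous_on_blowup])
         (use \<kappa> in \<open>auto simp: abs_le_iff intro!: continuous_intros\<close>)
    then show ?thesis unfolding f_def by (intro continuous_intros) simp
  qed
  have fl: "((\<lambda>r. (f (g r) - f h0) / of_real (sqrt r)) \<longlongrightarrow> u * M) (at_right 0)"
    if "((\<lambda>r. (blowup y \<kappa> (g r) - blowup y \<kappa> h0) / of_real (sqrt r)) \<longlongrightarrow> M) (at_right 0)" for g M
    using tendsto_mult_left[OF that, of u] by (simp add: f_def right_diff_distrib)
  obtain V where V: "openin (top_of_set (sphere 0 1)) V" "V \<noteq> {}"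
    "\<And>v. v \<in> V \<Longrightarrow> \<exists>h\<in>{- 1/4..1/4}. f h \<noteq> 0 \<and> f h / of_real (norm (f h)) = v"
  proof (rule corner_directions[OF cf])
    show "- 1/4 < h0" "h0 < 1/4" using h0(1) by auto
    show "f h0 \<noteq> 0" using h0(2) u by (simp add: f_def)
    show "((\<lambda>r. (f (h0 + r) - f h0) / of_real (sqrt r)) \<longlongrightarrow> u * R) (at_right 0)" by (rule fl[OF h0(4)])
    show "((\<lambda>r. (f (h0 - r) - f h0) / of_real (sqrt r)) \<longlongrightarrow> \<i> * (u * R)) (at_right 0)"
      using fl[OF h0(5)] by (simp only: mult.left_commute)
    show "u * R \<noteq> 0" using u h0(3) by simp
  qed blast
  have "\<exists>r. r \<longlonglongrightarrow> 0 \<and> (\<forall>n. riemann_phi (riemann_t x + r n) \<noteq> riemann_phi (riemann_t x)) \<and>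
      (\<lambda>n. riemann_dir (riemann_t x) (r n)) \<longlonglongrightarrow> v" if vV: "v \<in> V" for v
  proof -
    obtain h where h: "h \<in> {- 1/4..1/4}" "f h \<noteq> 0" "f h / of_real (norm (f h)) = v" using V(3)[OF vV] by blast
    have "\<bar>h\<bar> \<le> 1 / 4" using h(1) by (auto simp: abs_le_iff)
    from lim[rule_format, OF this] obtain r w where r: "r \<longlonglongrightarrow> 0" "\<And>n. w n > (0::real)"
       "(\<lambda>n. (jline (z + r n) - jline z) / of_real (w n)) \<longlonglongrightarrow> \<epsilon> * blowup y \<kappa> h" by blast
    define s where "s n = - r n / (4 * pi)" for n
    have inc: "jint_increment x (s n) = jline (z + r n) - jline z" for n
      by (simp add: jint_increment_def s_def z_def)
    define B where "B = \<epsilon> * blowup y \<kappa> h"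
    have fB: "f h = - \<i> * B" by (simp add: f_def u_def B_def)
    have B0: "B \<noteq> 0" using h(2) fB by auto
    have "(\<lambda>n. jint_increment x (s n) / of_real (w n)) \<longlonglongrightarrow> of_real (norm B) * (B / of_real (norm B))"
      using r(3) B0 unfolding inc B_def by simp
    moreover have "- \<i> * (B / of_real (norm B)) = v"
      using h(3) unfolding fB by (simp add: norm_mult)
    moreover have "norm (B / of_real (norm B)) = 1" using B0 by (simp add: norm_divide)
    ultimately have D: "\<forall>\<^sub>F n in sequentially. riemann_phi (riemann_t x + s n) \<noteq> riemann_phi (riemann_t x)"
      "(\<lambda>n. riemann_dir (riemann_t x) (s n)) \<longlonglongrightarrow> v"
      using riemann_dir_tendsto[of x s w "norm B" "B / of_real (norm B)" sequentially] r(2) B0 by simp_all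
    obtain N where N: "\<And>n. riemann_phi (riemann_t x + s (n + N)) \<noteq> riemann_phi (riemann_t x)"
      using eventually_shift_sequentially[OF D(1)] by blast
    have "s \<longlonglongrightarrow> 0" using tendsto_divide[OF tendsto_minus[OF r(1)] tendsto_const[of "4 * pi"]] by (simp add: s_def[abs_def])
    then have "(\<lambda>n. s (n + N)) \<longlonglongrightarrow> 0" by (rule LIMSEQ_ignore_initial_segment)
    moreover have "(\<lambda>n. riemann_dir (riemann_t x) (s (n + N))) \<longlonglongrightarrow> v" by (rule LIMSEQ_ignore_initial_segment[OF D(2)])
    ultimately show ?thesis using N by blast
  qed
  then show ?thesis using V(1,2) by blast
qed

theorem theorem2p14:
  "(\<forall>p q :: int. q > 0 \<and> coprime p q \<and> real_of_int p / real_of_int q \<in> {0..1} \<longrightarrow>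
      (let t = riemann_t (real_of_int p / real_of_int q) in
        (q mod 4 \<in> {0, 1, 3} \<longrightarrow>
          (\<exists>e :: complex. e \<in> sphere 0 1 \<and> e ^ 8 = 1 \<and>
            (\<forall>\<^sub>F r in at_right 0. riemann_phi (t + r) \<noteq> riemann_phi t) \<and>
            ((\<lambda>r. riemann_dir t r) \<longlongrightarrow> e * ((1 + \<i>) / complex_of_real (sqrt 2))) (at_right 0) \<and>
            (\<forall>\<^sub>F r in at_right 0. riemann_phi (t - r) \<noteq> riemann_phi t) \<and>
            ((\<lambda>r. riemann_dir t (- r)) \<longlongrightarrow> e * ((1 - \<i>) / complex_of_real (sqrt 2))) (at_right 0))) \<and>
        (q mod 4 = 2 \<longrightarrow>
          (\<forall>v \<in> sphere (0 :: complex) 1. \<exists>r s :: nat \<Rightarrow> real.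
            (\<forall>n. r n > 0) \<and> r \<longlonglongrightarrow> 0 \<and> (\<forall>n. s n > 0) \<and> s \<longlonglongrightarrow> 0 \<and>
            (\<forall>n. riemann_phi (t + r n) \<noteq> riemann_phi t) \<and>
            (\<lambda>n. riemann_dir t (r n)) \<longlonglongrightarrow> v \<and>
            (\<forall>n. riemann_phi (t - s n) \<noteq> riemann_phi t) \<and>
            (\<lambda>n. riemann_dir t (- s n)) \<longlonglongrightarrow> v)))) \<and>
   (\<forall>\<rho> :: real. \<rho> \<in> {0..1} - \<rat> \<longrightarrow>
      (let t = riemann_t \<rho> in
        \<exists>V. openin (top_of_set (sphere (0 :: complex) 1)) V \<and> V \<noteq> {} \<and>
          (\<forall>v \<in> V. \<exists>r :: nat \<Rightarrow> real. r \<longlonglongrightarrow> 0 \<and>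
            (\<forall>n. riemann_phi (t + r n) \<noteq> riemann_phi t) \<and>
            (\<lambda>n. riemann_dir t (r n)) \<longlonglongrightarrow> v)))"
proof (intro conjI allI impI, goal_cases)
  case (1 p q)
  then have q: "q > 0" and cop: "coprime p q" by blast+
  define x where "x = real_of_int p / real_of_int q"
  \<comment> \<open>For even q the fraction - 2 p / q reduces to - p / (q / 2); the parity of q / 2
    then decides the orbit.\<close>
  have even_case: "- 2 * x = of_int (- p) / of_int (q div 2)" "coprime (- p) (q div 2)" "q div 2 > 0" if ev: "even q"
  proof -
    obtain k where k: "q = 2 * k" using ev by (rule evenE)
    show "- 2 * x = of_int (- p) / of_int (q div 2)" using q by (simp add: x_def k)
    show "coprime (- p) (q div 2)" using cop by (simp add: k)
    show "q div 2 > 0" using q by (simp add: k)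
  qed
  show ?case
    unfolding Let_def x_def[symmetric]
  proof (intro conjI impI ballI, goal_cases)
    case 1
    then have m: "q mod 4 \<in> {0, 1, 3}" .
    \<comment> \<open>If 4 divides q the denominator stays even; if q is odd the numerator is even.
      Both cases lie in the orbit of 0.\<close>
    have "\<exists>p' q' :: int. coprime p' q' \<and> q' > 0 \<and> even (p' * q') \<and> - 2 * x = of_int p' / of_int q'"
    proof (cases "even q")
      case True
      then have "q mod 4 = 0" using m by (auto elim!: evenE) presburger+
      then have "even (q div 2)" by presburger
      then show ?thesis using even_case[OF True] by (metis even_mult_iff)
    next
      case False
      then have "coprime (- 2 * p) q" using cop by (simp add: coprime_commute)
      moreover have "- 2 * x = of_int (- 2 * p) / of_int q" by (simp add: x_def)
      ultimately show ?thesis using q by (metis dvd_triv_left even_mult_iff even_minus)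
    qed
    then obtain p' q' :: int where "coprime p' q'" "q' > 0" "even (p' * q')" "- 2 * x = of_int p' / of_int q'" by blast
    from riemann_corner[OF this]
    show ?case .
  next
    case (2 v)
    then have m: "q mod 4 = 2" and v: "norm v = 1" by simp_all
    \<comment> \<open>Numerator - p and denominator q / 2 are both odd, the orbit of 1.\<close>
    have ev: "even q" using m by presburger
    have "odd p" using cop ev coprime_common_divisor[of p q 2] by auto
    moreover have "odd (q div 2)" using m by presburger
    ultimately have odd: "odd (- p * (q div 2))" by simp
    note spiral = riemann_spiral[OF even_case(2,3)[OF ev] odd even_case(1)[OF ev] v]
    obtain r where r: "\<And>n. r n > (0::real)" "r \<longlonglongrightarrow> 0"
      "\<And>n. riemann_phi (riemann_t x + 1 * r n) \<noteq> riemann_phi (riemann_t x)"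
      "(\<lambda>n. riemann_dir (riemann_t x) (1 * r n)) \<longlonglongrightarrow> v"
      using spiral[of 1] by auto
    obtain s where s: "\<And>n. s n > (0::real)" "s \<longlonglongrightarrow> 0"
      "\<And>n. riemann_phi (riemann_t x + (- 1) * s n) \<noteq> riemann_phi (riemann_t x)"
      "(\<lambda>n. riemann_dir (riemann_t x) ((- 1) * s n)) \<longlonglongrightarrow> v"
      using spiral[of "- 1"] by auto
    show ?case
      using r s by (intro exI[of _ r] exI[of _ s]) simp
  qed
next
  case (2 \<rho>)
  then have "\<rho> \<notin> \<rat>" by blast
  from riemann_irrational[OF this] show ?case unfolding Let_def .
qed

end
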